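(* Let $A>0$ and consider $-y''+q(x)y=\lambda y$ on $[A,\infty)$ with the boundary condition $y(A)=0$, where $q(x)=\frac{q_0}{x^2}+\frac{q_1}{x}+\sum_{n=0}^\infty q_{n+2}x^n$ (real coefficients, series convergent on $(0,\infty)$, $q_0\ge -\tfrac14$, $q_0,q_1$ not both zero), and assume that for some $x_0>0$ either (a) $q\in L_1(x_0,\infty)$, or (b) $q'\in L_1(x_0,\infty)$, $q\in AC_{loc}[x_0,\infty)$ and $\lim_{x\to\infty}q(x)=0$. Let $U_1=(P_1,Q_1,R_1)^T$ be the unique solution of the Appell system with $\lim_{x\to\infty}U_1(x,\lambda)=(\sqrt\lambda,0,1/\sqrt\lambda)^T$, let $u,v$ and the real numbers $\tilde a(\lambda),\tilde b(\lambda),\tilde c(\lambda)$ be as in the context, and let $\alpha(\lambda)=-\frac{\tilde b}{2\tilde a}+i\frac{1}{\tilde a}$, $\alpha_2(\lambda)=\frac1{\tilde a(\lambda)}$. Then the spectral function $\rho_A$ is absolutely continuous on $(0,\infty)$, and for every $\lambda\in(0,\infty)$ its density $f_A(\lambda):=\rho_A'(\lambda)$ satisfies \[ f_A(\lambda)=\lim_{\epsilon\downarrow0}\frac1\pi\,\mathrm{Im}[m_A(\lambda+i\epsilon)]=\frac{\alpha_2(\lambda)}{\pi}=\frac{1}{\pi\tilde a(\lambda)}=\frac{1}{\pi\,[P_1(x,\lambda)v(x,\lambda)^2+Q_1(x,\lambda)v(x,\lambda)v'(x,\lambda)+R_1(x,\lambda)v'(x,\lambda)^2]}\] for every $x\ge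 A$.
   Context: The Appell system is $\frac{d}{dx}(P,Q,R)^T=M(x,\lambda)(P,Q,R)^T$ with $M=\begin{pmatrix}0&\lambda-q&0\\-2&0&2(\lambda-q)\\0&-1&0\end{pmatrix}$. Under the stated hypotheses on $q$ it is known that for every $\lambda\in(0,\infty)$ the Appell system has a unique solution $U_1$ with $\lim_{x\to\infty}U_1(x,\lambda)=(\sqrt\lambda,0,1/\sqrt\lambda)^T$. Let $u(\cdot,\lambda),v(\cdot,\lambda)$ be the solutions of $-y''+qy=\lambda y$ with $u(A)=1,u'(A)=0,v(A)=0,v'(A)=1$. Then $U_1$ can be written uniquely as $U_1=\tilde a\,((u')^2,-2uu',u^2)^T+\tilde b\,(u'v',-(uv'+u'v),uv)^T+\tilde c\,((v')^2,-2vv',v^2)^T$ with real $\tilde a(\lambda),\tilde b(\lambda),\tilde c(\lambda)$. The Titchmarsh–Weyl function $m_A(\lambda)$ ($\mathrm{Im}\lambda\ne0$) is the unique number with $u(\cdot,\lambda)+m_A(\lambda)v(\cdot,\lambda)\in L_2(A,\infty)$; the spectral function is $\rho_A(\lambda)=\lim_{\epsilon\downarrow0}\frac1\pi\int_0^\lambda\mathrm{Im}[m_A(t+i\epsilon)]\,dt$. *)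

theory Defs
  imports "HOL-Analysis.Analysis"
begin

definition abs_cont_on :: "real set \<Rightarrow> (real \<Rightarrow> real) \<Rightarrow> bool" where
  "abs_cont_on S f \<longleftrightarrow>
     (\<forall>e>0. \<exists>d>0. \<forall>(n::nat) (a::nat \<Rightarrow> real) (b::nat \<Rightarrow> real).
        (\<forall>k<n. a k \<le> b k \<and> {a k..b k} \<subseteq> S) \<and>
        (\<forall>i<n. \<forall>j<n. i \<noteq> j \<longrightarrow> b i \<le> a j \<or> b j \<le> a i) \<and>
        (\<Sum>k<n. b k - a k) < d
        \<longrightarrow> (\<Sum>k<n. \<bar>f (b k) - f (a k)\<bar>) < e)"

definition loc_abs_cont_on :: "real set \<Rightarrow> (real \<Rightarrow> real) \<Rightarrow> bool" where
  "loc_abs_cont_on S f \<longleftrightarrow> (\<forall>a b. a \<le> b \<longrightarrow> {a..b} \<subseteq> S \<longrightarrow> abs_cont_on {a..b} f)"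

definition TW_m :: "(real \<Rightarrow> complex \<Rightarrow> complex) \<Rightarrow> (real \<Rightarrow> complex \<Rightarrow> complex)
                     \<Rightarrow> real \<Rightarrow> complex \<Rightarrow> complex" where
  "TW_m u v A l = (THE m. (\<lambda>x. (cmod (u x l + m * v x l))\<^sup>2) integrable_on {A..})"

definition spec_integral :: "(real \<Rightarrow> complex \<Rightarrow> complex) \<Rightarrow> (real \<Rightarrow> complex \<Rightarrow> complex)
                     \<Rightarrow> real \<Rightarrow> real \<Rightarrow> real \<Rightarrow> real" where
  "spec_integral u v A l \<epsilon> =
     (1 / pi) * (if 0 \<le> l
        then integral {0..l} (\<lambda>t. Im (TW_m u v A (complex_of_real t + \<i> * complex_of_real \<epsilon>)))
        else - integral {l..0} (\<lambda>t. Im (TW_m u v A (complex_of_real t + \<i> * complex_of_real \<epsilon>))))"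

definition spec_fun :: "(real \<Rightarrow> complex \<Rightarrow> complex) \<Rightarrow> (real \<Rightarrow> complex \<Rightarrow> complex)
                     \<Rightarrow> real \<Rightarrow> real \<Rightarrow> real" where
  "spec_fun u v A l = Lim (at_right 0) (spec_integral u v A l)"

end

theory Submission
  imports Defs "HOL-Complex_Analysis.Complex_Analysis"
begin

text \<open>
  Put \<open>R = R\<^sub>1(\<cdot>, l)\<close>. The Liouville transformation \<open>y = sqrt R Y\<close>, \<open>\<theta>' = 1 / R\<close> turns
  \<open>- y'' + q y = z y\<close> into \<open>Y'' = -(1 + (z - l) R\<^sup>2) Y\<close>, so \<open>q\<close> only enters through \<open>R\<close>, and
  \<open>l R\<^sup>2 \<rightarrow> 1\<close>. For \<open>z = l + \<i> \<epsilon>\<close> the perturbation \<open>\<epsilon> (R\<^sup>2 - 1/l)\<close> is small compared with the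
  decay rate \<open>\<epsilon> / (2 l)\<close>, hence beyond some \<open>X\<close> independent of \<open>\<epsilon>\<close> the square integrable solution
  is almost purely outgoing. Propagating this from \<open>X\<close> back to \<open>A\<close> gives
  \<open>m\<^sub>A(l + \<i> \<epsilon>) \<rightarrow> - Q(A) / (2 R(A)) + \<i> / R(A)\<close>, locally uniformly in \<open>l > 0\<close> because
  \<open>l R\<^sup>2 \<rightarrow> 1\<close> is uniform for \<open>l \<ge> a\<close>; and \<open>R(A)\<close> is the coefficient \<open>a(l)\<close> of the representation.

  The lower limit 0 of the integral defining \<open>\<rho>\<^sub>A\<close> is outside the range of this limit. There one uses
  that \<open>m\<^sub>A\<close> is a Herglotz function with \<open>m\<^sub>A = O(1 / Im z)\<close>: the imaginary part of its second
  primitive has convex boundary values, and comparison of the antisymmetrised primitive with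
  \<open>e t + C t y\<close> on a small square shows that \<open>Im\<close> of the first primitive converges along the vertical.
\<close>

section \<open>Herglotz functions at a boundary point\<close>

text \<open>The perturbation and the decay rate are both proportional to epsilon, so only their
  ratio matters, and that is governed by \<open>l * R^2 - 1\<close>; this is why the cut-off X can
  be fixed before epsilon. Backwards from X to A the interval is compact, and there epsilon itself
  is small. The other obstacle is that \<open>TW_m\<close> is a definite description and
  \<open>spec_fun\<close> a \<open>Lim\<close>: neither says anything before unique existence of the
  Weyl solution, respectively convergence of the integrals from 0, is proved. Existence comes from
  nested Weyl discs. Uniqueness comes from the limit point property: square integrability bounds the
  sum of squares of the transformed pair by a linear function of x, and since 1/x is not integrable,
  the Wronskian of two such solutions must vanish at infinity. The same linear bound excludes the
  exponentially growing incoming component. Vanishing Wronskians also express differences of m as L2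
  products of Weyl solutions, which yields positivity, the bound O(1 / Im z) and holomorphy.\<close>

lemma convex_right_slope_limit:
  fixes g :: "real \<Rightarrow> real"
  assumes g: "convex_on {-1..1} g"
  shows "\<exists>D. ((\<lambda>t. (g t - g 0) / t) \<longlongrightarrow> D) (at_right 0)"
proof -
  define s where "s = (\<lambda>t. (g t - g 0) / t)"
  have mono: "s a \<le> s b" if "0 < a" "a \<le> b" "b \<le> 1" for a b
  proof -
    have "g ((1 - a/b) *\<^sub>R 0 + (a/b) *\<^sub>R b) \<le> (1 - a/b) * g 0 + (a/b) * g b"
      by (rule convex_onD[OF g]) (use that in auto)
    then have "g a - g 0 \<le> (a/b) * (g b - g 0)"
      using that by (simp add: algebra_simps)
    then show ?thesis
      using that by (simp add: s_def field_simps)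
  qed
  \<comment> \<open>The point 0 is the convex combination of -1 and b with weights b/(1+b) and
    1/(1+b), so the slope over [-1, 0] lies below every slope from 0. This keeps the infimum of the
    slopes finite.\<close>
  have lower: "s b \<ge> g 0 - g (-1)" if "0 < b" "b \<le> 1" for b
  proof -
    have "g ((1 - 1/(1+b)) *\<^sub>R (-1) + (1/(1+b)) *\<^sub>R b) \<le> (1 - 1/(1+b)) * g (-1) + (1/(1+b)) * g b"
      by (rule convex_onD[OF g]) (use that in auto)
    moreover have "(1 - 1/(1+b)) *\<^sub>R (-1) + (1/(1+b)) *\<^sub>R b = 0"
      using that by (simp add: field_simps)
    ultimately have "g 0 \<le> (1 - 1/(1+b)) * g (-1) + (1/(1+b)) * g b"
      by simp
    also have "1 - 1/(1+b) = b/(1+b)"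
      using that by (simp add: field_simps)
    also have "b/(1+b) * g (-1) + 1/(1+b) * g b = (b * g (-1) + g b) / (1+b)"
      by (simp add: add_divide_distrib)
    finally have "g 0 * (1+b) \<le> b * g (-1) + g b"
      using that by (simp add: pos_le_divide_eq)
    then show ?thesis
      unfolding s_def using that by (subst pos_le_divide_eq) (simp_all add: algebra_simps)
  qed
  define D where "D = Inf (s ` {0<..1})"
  have bdd: "bdd_below (s ` {0<..1})"
    using lower by (intro bdd_belowI2[where m="g 0 - g (-1)"]) auto
  have "(s \<longlongrightarrow> D) (at_right 0)"
  proof (rule order_tendstoI)
    fix a assume "a < D"
    have "D \<le> s t" if "0 < t" "t \<le> 1" for t
      unfolding D_def using that by (intro cInf_lower[OF _ bdd]) auto
    then show "\<forall>\<^sub>F t in at_right 0. a < s t"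
      using \<open>a < D\<close> by (intro eventually_at_rightI[of 0 1]) (auto intro: less_le_trans)
  next
    fix a assume "D < a"
    then obtain b where b: "0 < b" "b \<le> 1" "s b < a"
      unfolding D_def by (subst (asm) cInf_less_iff[OF _ bdd]) auto
    then show "\<forall>\<^sub>F t in at_right 0. s t < a"
      by (intro eventually_at_rightI[of 0 b]) (auto intro!: le_less_trans[OF mono, of _ b])
  qed
  then show ?thesis unfolding s_def by blast
qed

text \<open>A convex function may have a corner at 0, so only one-sided derivatives are available;
  the symmetric quotient converges to their sum. That corresponds to a possible point mass or jump
  at the endpoint and is all that the antisymmetrised primitive sees.\<close>

lemma convex_symmetric_slope_limit:
  fixes g :: "real \<Rightarrow> real"
  assumes g: "convex_on {-1..1} g"
  shows "\<exists>D. ((\<lambda>t. (g t - g (-t)) / t) \<longlongrightarrow> D) (at_right 0)"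
proof -
  have "convex_on {-1..1} (\<lambda>t. g (- t))"
  proof (rule convex_onI)
    fix t x y :: real assume "0 < t" "t < 1" "x \<in> {-1..1}" "y \<in> {-1..1}"
    then show "g (- ((1 - t) *\<^sub>R x + t *\<^sub>R y)) \<le> (1 - t) * g (- x) + t * g (- y)"
      using convex_onD[OF g, of t "-x" "-y"] by (simp add: algebra_simps)
  qed simp
  from convex_right_slope_limit[OF this] convex_right_slope_limit[OF g]
  obtain D1 D2 where "((\<lambda>t. (g t - g 0) / t) \<longlongrightarrow> D1) (at_right 0)"
     "((\<lambda>t. (g (-t) - g 0) / t) \<longlongrightarrow> D2) (at_right 0)" by auto
  from tendsto_diff[OF this] show ?thesis
    by (intro exI[of _ "D1 - D2"]) (simp add: diff_divide_distrib[symmetric])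
qed

text \<open>The quadratic comparison function is the real part of \<open>-\<i> C z\<^sup>2 / 2\<close>, namely \<open>C Re z Im z\<close>.\<close>

lemma harmonic_corner_bound:
  fixes f :: "complex \<Rightarrow> complex"
  assumes r: "0 < r"
    and cont: "continuous_on (cbox 0 (Complex r r)) f"
    and hol: "f holomorphic_on box 0 (Complex r r)"
    and left: "\<And>y. 0 \<le> y \<Longrightarrow> y \<le> r \<Longrightarrow> Re (f (Complex 0 y)) \<le> 0"
    and bot: "\<And>t. 0 \<le> t \<Longrightarrow> t \<le> r \<Longrightarrow> Re (f (Complex t 0)) \<le> e * t"
    and right: "\<And>y. 0 \<le> y \<Longrightarrow> y \<le> r \<Longrightarrow> Re (f (Complex r y)) \<le> e * r + C * r * y"
    and top: "\<And>t. 0 \<le> t \<Longrightarrow> t \<le> r \<Longrightarrow> Re (f (Complex t r)) \<le> e * t + C * t * r"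
    and t: "0 < t" "t < r" and y: "0 < y" "y < r"
  shows "Re (f (Complex t y)) \<le> e * t + C * t * y"
proof -
  define h where "h = (\<lambda>z. f z - complex_of_real e * z + \<i> * complex_of_real (C/2) * z\<^sup>2)"
  have Re_h: "Re (h (Complex a b)) = Re (f (Complex a b)) - e * a - C * a * b" for a b
    unfolding h_def by (simp add: power2_eq_square algebra_simps complex_eq_iff)
  define S where "S = box 0 (Complex r r)"
  have ne: "S \<noteq> {}"
    unfolding S_def using r by (auto simp: box_ne_empty Basis_complex_def inner_complex_def)
  have fr: "frontier S = cbox 0 (Complex r r) - box 0 (Complex r r)" and cl: "closure S = cbox 0 (Complex r r)"
    using ne unfolding S_def by (simp_all add: frontier_box)
  have "Re (h (Complex t y)) \<le> 0"
  proof (rule maximum_real_frontier[of h S])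
    show "h holomorphic_on interior S"
      unfolding h_def S_def using hol by (simp add: interior_open open_box) (intro holomorphic_intros; simp)
    show "continuous_on (closure S) h"
      unfolding cl h_def using cont by (intro continuous_intros)
    show "bounded S" by (simp add: S_def bounded_box)
    show "Complex t y \<in> S" using t y by (simp add: S_def in_box_complex_iff)
    fix z assume "z \<in> frontier S"
    then have z: "0 \<le> Re z" "Re z \<le> r" "0 \<le> Im z" "Im z \<le> r"
      and "Re z = 0 \<or> Re z = r \<or> Im z = 0 \<or> Im z = r"
      unfolding fr by (auto simp: in_box_complex_iff in_cbox_complex_iff)
    then have "Re (f (Complex (Re z) (Im z))) - e * Re z - C * Re z * Im z \<le> 0"
    proof (elim disjE)
      assume "Re z = 0" then show ?thesis using left[of "Im z"] z by simp
    next
      assume "Re z = r" then show ?thesis using right[of "Im z"] z by simp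
    next
      assume "Im z = 0" then show ?thesis using bot[of "Re z"] z by simp
    next
      assume "Im z = r" then show ?thesis using top[of "Re z"] z by simp
    qed
    then show "Re (h z) \<le> 0" using Re_h[of "Re z" "Im z"] by simp
  qed
  then show ?thesis unfolding Re_h by simp
qed

text \<open>Along a vertical line the derivative is only multiplied by the imaginary unit, so a
  bound that depends on the height alone can be integrated as a real function. The two uses
  integrate y^(-3/2) and y^(-1/2).\<close>

lemma vertical_increment_bound:
  fixes f f' :: "complex \<Rightarrow> complex"
  assumes f: "\<And>y. 0 < y \<Longrightarrow> (f has_field_derivative f' (Complex t y)) (at (Complex t y))"
    and phi: "\<And>y. 0 < y \<Longrightarrow> (\<phi> has_real_derivative \<phi>' y) (at y)"
    and le: "\<And>y. 0 < y \<Longrightarrow> y \<le> b \<Longrightarrow> norm (f' (Complex t y)) \<le> \<phi>' y"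
    and ab: "0 < a" "a \<le> b"
  shows "norm (f (Complex t b) - f (Complex t a)) \<le> \<phi> b - \<phi> a"
proof (cases "a = b")
  case False
  have v: "((\<lambda>s. f (Complex t s)) has_vector_derivative \<i> * f' (Complex t y)) (at y)" if "0 < y" for y
  proof -
    have "((\<lambda>s. of_real t + \<i> * of_real s) has_vector_derivative \<i>) (at y)"
      by (auto intro!: derivative_eq_intros)
    then have "(Complex t has_vector_derivative \<i>) (at y)"
      by (simp add: Complex_eq[abs_def])
    from field_vector_diff_chain_at[OF this f[OF that]] show ?thesis
      by (simp add: o_def)
  qed
  show ?thesis
  proof (rule differentiable_bound_general)
    show "a < b" using False ab by simp
    show "continuous_on {a..b} (\<lambda>s. f (Complex t s))"
      by (rule continuous_on_vector_derivative[where f'="\<lambda>y. \<i> * f' (Complex t y)"]) (use v ab in \<open>auto intro: has_vector_derivative_at_within\<close>)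
    show "continuous_on {a..b} \<phi>"
      by (rule DERIV_continuous_on[where D=\<phi>']) (use phi ab in \<open>auto intro: has_field_derivative_at_within\<close>)
    show "(\<phi> has_vector_derivative \<phi>' y) (at y)" if "a < y" for y
      using phi[of y] that ab by (simp add: has_real_derivative_iff_has_vector_derivative)
    show "((\<lambda>s. f (Complex t s)) has_vector_derivative \<i> * f' (Complex t y)) (at y)" if "a < y" for y
      using v that ab by simp
    show "norm (\<i> * f' (Complex t y)) \<le> \<phi>' y" if "a < y" "y < b" for y
      using le that ab by (simp add: norm_mult)
  qed
qed simp

lemma convex_on_limit:
  fixes f :: "nat \<Rightarrow> real \<Rightarrow> real"
  assumes "\<And>n. convex_on S (f n)" "\<And>x. x \<in> S \<Longrightarrow> (\<lambda>n. f n x) \<longlonglongrightarrow> g x" and S: "convex S"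
  shows "convex_on S g"
proof (rule convex_onI[OF _ S])
  fix t x y :: real assume t: "0 < t" "t < 1" and xy: "x \<in> S" "y \<in> S"
  have mem: "(1 - t) *\<^sub>R x + t *\<^sub>R y \<in> S"
    using convexD[OF S xy(1) xy(2), of "1-t" t] t by simp
  show "g ((1 - t) *\<^sub>R x + t *\<^sub>R y) \<le> (1 - t) * g x + t * g y"
  proof (rule LIMSEQ_le)
    show "(\<lambda>n. f n ((1 - t) *\<^sub>R x + t *\<^sub>R y)) \<longlonglongrightarrow> g ((1 - t) *\<^sub>R x + t *\<^sub>R y)"
      by (rule assms(2)[OF mem])
    show "(\<lambda>n. (1 - t) * f n x + t * f n y) \<longlonglongrightarrow> (1 - t) * g x + t * g y"
      by (intro tendsto_intros assms(2) xy)
    show "\<exists>N. \<forall>n\<ge>N. f n ((1 - t) *\<^sub>R x + t *\<^sub>R y) \<le> (1 - t) * f n x + t * f n y"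
      using convex_onD[OF assms(1)] t xy by auto
  qed
qed

lemma upper_half_plane: "convex {z. 0 < Im z}" "open {z. 0 < Im z}"
  using convex_halfspace_Im_gt[of 0] open_halfspace_Im_gt[of 0] by (simp_all add: conj_commute)

text \<open>Under the bound \<open>O(1 / Im z)\<close> a second primitive of \<open>m\<close> extends continuously to the real axis;
  positivity of \<open>Im m\<close> makes its imaginary part convex there.\<close>

lemma second_primitive_boundary_extension:
  fixes m F G :: "complex \<Rightarrow> complex"
  assumes F: "\<And>z. Im z > 0 \<Longrightarrow> (F has_field_derivative m z) (at z)"
    and G: "\<And>z. Im z > 0 \<Longrightarrow> (G has_field_derivative F z) (at z)"
    and pos: "\<And>z. Im z > 0 \<Longrightarrow> 0 \<le> Im (m z)"
    and bd: "\<And>z. \<bar>Re z\<bar> \<le> 1 \<Longrightarrow> 0 < Im z \<Longrightarrow> Im z \<le> 1 \<Longrightarrow> norm (m z) \<le> C / Im z"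
  obtains H where "continuous_on (cbox (Complex (-1) 0) (Complex 1 (1/2))) H"
    "\<And>z. \<bar>Re z\<bar> \<le> 1 \<Longrightarrow> 0 < Im z \<Longrightarrow> Im z \<le> 1/2 \<Longrightarrow> H z = G z"
    "convex_on {-1..1} (\<lambda>t. Im (H (of_real t)))"
proof -
  have C: "C \<ge> 0" using order_trans[OF norm_ge_zero bd[of \<i>]] by simp
  have "continuous_on (cbox (Complex (-1) 1) (Complex 1 1)) F"
    by (rule DERIV_continuous_on) (auto simp: in_cbox_complex_iff intro!: has_field_derivative_at_within[OF F])
  then have "bounded (F ` cbox (Complex (-1) 1) (Complex 1 1))"
    by (intro compact_imp_bounded compact_continuous_image) auto
  then obtain M where M0: "M > 0" "\<And>z. z \<in> cbox (Complex (-1) 1) (Complex 1 1) \<Longrightarrow> norm (F z) \<le> M"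
    unfolding bounded_pos by auto
  have M: "M > 0" "norm (F (Complex t 1)) \<le> M" if "\<bar>t\<bar> \<le> 1" for t
    using M0(1) M0(2)[of "Complex t 1"] that by (simp_all add: in_cbox_complex_iff abs_le_iff)
  define B where "B = M + 2 * C"
  have B: "B > 0" unfolding B_def using C M0 by linarith
  have F_bound: "norm (F (Complex t y)) \<le> B / sqrt y" if t: "\<bar>t\<bar> \<le> 1" and y: "0 < y" "y \<le> 1" for t y
  proof -
    \<comment> \<open>The bound C / y would integrate to a logarithm. Weakening it to C / y^(3/2),
      valid for y at most 1, gives the power 1 / sqrt y, which is still integrable at 0 and makes G
      Hoelder continuous of order 1/2 along verticals.\<close>
    have "norm (F (Complex t 1) - F (Complex t y)) \<le> (- 2 * C / sqrt 1) - (- 2 * C / sqrt y)"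
    proof (rule vertical_increment_bound[where f'=m and \<phi>'="\<lambda>y. C / (y * sqrt y)"])
      show "((\<lambda>y. - 2 * C / sqrt y) has_real_derivative C / (y * sqrt y)) (at y)" if "0 < y" for y
        using that by (auto intro!: derivative_eq_intros simp: field_simps)
      show "norm (m (Complex t y)) \<le> C / (y * sqrt y)" if "0 < y" "y \<le> 1" for y
      proof -
        have "norm (m (Complex t y)) \<le> C / y" using bd[of "Complex t y"] that t by simp
        also have "\<dots> \<le> C / (y * sqrt y)"
          using that C by (intro divide_left_mono) (auto simp: mult_le_cancel_left1)
        finally show ?thesis .
      qed
    qed (use F y in auto)
    then have "norm (F (Complex t y)) \<le> M + 2 * C / sqrt y - 2 * C"
      using M(2)[OF t] norm_triangle_sub[of "F (Complex t y)" "F (Complex t 1)"]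
      by (simp add: norm_minus_commute)
    also have "\<dots> \<le> M / sqrt y + 2 * C / sqrt y"
    proof -
      have "M \<le> M / sqrt y" using M0 y by (simp add: pos_le_divide_eq mult_le_cancel_left1)
      then show ?thesis using C by linarith
    qed
    finally show ?thesis by (simp add: B_def add_divide_distrib)
  qed
  have G_incr: "norm (G (Complex t b) - G (Complex t a)) \<le> 2 * B * sqrt (b - a)"
    if t: "\<bar>t\<bar> \<le> 1" and ab: "0 < a" "a \<le> b" "b \<le> 1" for t a b
  proof -
    have "norm (G (Complex t b) - G (Complex t a)) \<le> 2 * B * sqrt b - 2 * B * sqrt a"
    proof (rule vertical_increment_bound[where f'=F and \<phi>'="\<lambda>y. B / sqrt y"])
      show "((\<lambda>y. 2 * B * sqrt y) has_real_derivative B / sqrt y) (at y)" if "0 < y" for y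
        using that by (auto intro!: derivative_eq_intros simp: field_simps)
    qed (use F_bound G that in auto)
    also have "\<dots> \<le> 2 * B * sqrt (b - a)"
    proof -
      have "sqrt b \<le> sqrt a + sqrt (b - a)"
        using ab sqrt_add_le_add_sqrt[of a "b - a"] by simp
      then have "2 * B * sqrt b \<le> 2 * B * (sqrt a + sqrt (b - a))"
        using B by (intro mult_left_mono) auto
      then show ?thesis by (simp add: algebra_simps)
    qed
    finally show ?thesis .
  qed
  define K where "K = cbox (Complex (-1) 0) (Complex 1 (1/2))"
  \<comment> \<open>Shifts by at most 1/2 above the rectangle \<open>K\<close>, itself of height
    1/2, stay at heights in (0, 1], where \<open>G_incr\<close> applies; they replace boundary
    values of G by values inside the half-plane.\<close>
  define e where "e = (\<lambda>n::nat. 1 / (real n + 2))"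
  have e: "0 < e n" "e n \<le> 1/2" for n by (auto simp: e_def field_simps)
  have e_lim: "e \<longlonglongrightarrow> 0" unfolding e_def by real_asymp
  define Gn where "Gn = (\<lambda>n z. G (Complex (Re z) (Im z + e n)))"
  have Gn_diff: "dist (Gn m z) (Gn n z) \<le> 2 * B * sqrt \<bar>e m - e n\<bar>" if "z \<in> K" for m n z
  proof -
    have z: "\<bar>Re z\<bar> \<le> 1" "0 \<le> Im z" "Im z \<le> 1/2" using that by (auto simp: K_def in_cbox_complex_iff)
    show ?thesis
    proof (cases "e m \<le> e n")
      case True
      then show ?thesis
        using G_incr[OF z(1), of "Im z + e m" "Im z + e n"] z e[of m] e[of n]
        by (simp add: Gn_def dist_norm norm_minus_commute)
    next
      case False
      then show ?thesis
        using G_incr[OF z(1), of "Im z + e n" "Im z + e m"] z e[of m] e[of n]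
        by (simp add: Gn_def dist_norm norm_minus_commute)
    qed
  qed
  have "uniformly_Cauchy_on K Gn"
  proof (rule uniformly_Cauchy_onI)
    fix d :: real assume d: "d > 0"
    define h where "h = (d / (2 * B))\<^sup>2"
    have h: "h > 0" using d B by (simp add: h_def)
    have "Cauchy e" using e_lim by (rule LIMSEQ_imp_Cauchy)
    from metric_CauchyD[OF this h] obtain N where N: "\<And>m n. m \<ge> N \<Longrightarrow> n \<ge> N \<Longrightarrow> \<bar>e m - e n\<bar> < h"
      by (auto simp: dist_real_def)
    have "dist (Gn m z) (Gn n z) < d" if "z \<in> K" "m \<ge> N" "n \<ge> N" for z m n
    proof -
      have "sqrt \<bar>e m - e n\<bar> < sqrt h" using N that by simp
      also have "sqrt h = d / (2 * B)" using d B by (simp add: h_def)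
      finally have "2 * B * sqrt \<bar>e m - e n\<bar> < d" using B by (simp add: field_simps)
      then show ?thesis using Gn_diff[OF that(1), of m n] by linarith
    qed
    then show "\<exists>M. \<forall>z\<in>K. \<forall>m\<ge>M. \<forall>n\<ge>M. dist (Gn m z) (Gn n z) < d" by blast
  qed
  then obtain H where H: "uniform_limit K Gn H sequentially"
    using Cauchy_uniformly_convergent uniformly_convergent_on_def by blast
  have G_cont: "continuous_on {z. 0 < Im z} G"
    by (rule DERIV_continuous_on) (auto intro!: has_field_derivative_at_within[OF G])
  have "continuous_on K H"
  proof (rule uniform_limit_theorem[OF _ H])
    show "\<forall>\<^sub>F n in sequentially. continuous_on K (Gn n)"
    proof (rule always_eventually, rule allI)
      fix n
      show "continuous_on K (Gn n)"
        unfolding Gn_def Complex_eq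
        by (rule continuous_on_compose2[OF G_cont])
           (use e[of n] in \<open>auto intro!: continuous_intros simp: K_def in_cbox_complex_iff add_nonneg_pos\<close>)
    qed
  qed simp
  have ptw: "(\<lambda>n. Gn n z) \<longlonglongrightarrow> H z" if "z \<in> K" for z
    by (rule tendsto_uniform_limitI[OF H that])
  show thesis
  proof (rule that[of H])
    show "continuous_on (cbox (Complex (-1) 0) (Complex 1 (1/2))) H"
      using \<open>continuous_on K H\<close> by (simp add: K_def)
    show "H z = G z" if z: "\<bar>Re z\<bar> \<le> 1" "0 < Im z" "Im z \<le> 1/2" for z
    proof (rule LIMSEQ_unique)
      show "(\<lambda>n. Gn n z) \<longlonglongrightarrow> H z"
        by (rule ptw) (use z in \<open>auto simp: K_def in_cbox_complex_iff\<close>)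
      have "(\<lambda>n. of_real (Re z) + \<i> * of_real (Im z + e n)) \<longlonglongrightarrow> of_real (Re z) + \<i> * of_real (Im z + 0)"
        by (intro tendsto_intros e_lim)
      then have "(\<lambda>n. Complex (Re z) (Im z + e n)) \<longlonglongrightarrow> z"
        by (simp add: Complex_eq complex_eq[symmetric])
      moreover have "isCont G z" using G[OF z(2)] by (rule DERIV_isCont)
      ultimately show "(\<lambda>n. Gn n z) \<longlonglongrightarrow> G z"
        unfolding Gn_def by (rule isCont_tendsto_compose[rotated])
    qed
    show "convex_on {-1..1} (\<lambda>t. Im (H (of_real t)))"
    proof (rule convex_on_limit)
      show "convex_on {-1..1} (\<lambda>t. Im (G (Complex t (e n))))" for n
      proof (rule f''_ge0_imp_convex)
        have der: "((\<lambda>t. Im (f (Complex t (e n)))) has_real_derivative Im (f' (Complex t (e n)))) (at t)"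
          if "\<And>z. Im z > 0 \<Longrightarrow> (f has_field_derivative f' z) (at z)" for f f' t
        proof -
          have "((\<lambda>s. of_real s + \<i> * of_real (e n)) has_vector_derivative 1) (at t)"
            by (auto intro!: derivative_eq_intros)
          then have "((\<lambda>s. Complex s (e n)) has_vector_derivative 1) (at t)"
            by (simp add: Complex_eq[abs_def])
          moreover have "(f has_field_derivative f' (Complex t (e n))) (at (Complex t (e n)))"
            using that e by simp
          ultimately have "((\<lambda>s. f (Complex s (e n))) has_vector_derivative f' (Complex t (e n))) (at t)"
            using field_vector_diff_chain_at[of "\<lambda>s. Complex s (e n)" 1 t f] by (simp add: o_def)
          then show ?thesis
            unfolding has_real_derivative_iff_has_vector_derivative
            by (rule bounded_linear.has_vector_derivative[OF bounded_linear_Im])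
        qed
        show "((\<lambda>t. Im (G (Complex t (e n)))) has_real_derivative Im (F (Complex t (e n)))) (at t)" for t
          by (rule der[OF G])
        show "((\<lambda>t. Im (F (Complex t (e n)))) has_real_derivative Im (m (Complex t (e n)))) (at t)" for t
          by (rule der[OF F])
        show "0 \<le> Im (m (Complex t (e n)))" for t using pos e by simp
      qed simp
      show "(\<lambda>n. Im (G (Complex t (e n)))) \<longlonglongrightarrow> Im (H (of_real t))" if "t \<in> {-1..1}" for t
        using tendsto_Im[OF ptw[of "of_real t"]] that by (simp add: Gn_def K_def in_cbox_complex_iff)
    qed simp
  qed
qed

text \<open>With D the limit of the symmetric slopes, Re f is Im H(z) minus its mirror value across
  the imaginary axis, minus D Re z. It vanishes on the imaginary axis and is o(t) on the real axis.
  The harmonic comparison turns this into a bound proportional to t in the interior; dividing by t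
  gives the horizontal derivative on the imaginary axis, which is 2 Im F - D. Hence Im F tends to
  D/2.\<close>

lemma herglotz_primitive_limit:
  fixes m F :: "complex \<Rightarrow> complex"
  assumes F: "\<And>z. Im z > 0 \<Longrightarrow> (F has_field_derivative m z) (at z)"
    and pos: "\<And>z. Im z > 0 \<Longrightarrow> 0 \<le> Im (m z)"
    and bd: "\<And>z. \<bar>Re z\<bar> \<le> 1 \<Longrightarrow> 0 < Im z \<Longrightarrow> Im z \<le> 1 \<Longrightarrow> norm (m z) \<le> C / Im z"
  shows "\<exists>L. ((\<lambda>y. Im (F (Complex 0 y))) \<longlongrightarrow> L) (at_right 0)"
proof -
  have "F holomorphic_on {z. 0 < Im z}"
    using F by (auto simp: holomorphic_on_open upper_half_plane)
  from holomorphic_convex_primitive'[OF upper_half_plane this]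
  obtain G where G0: "\<And>z. z \<in> {z. 0 < Im z} \<Longrightarrow> (G has_field_derivative F z) (at z within {z. 0 < Im z})"
    by blast
  have G: "(G has_field_derivative F z) (at z)" if "0 < Im z" for z
    using G0[of z] at_within_open[OF _ upper_half_plane(2), of z] that by simp
  obtain H where Hcont: "continuous_on (cbox (Complex (-1) 0) (Complex 1 (1/2))) H"
    and HG: "\<And>z. \<bar>Re z\<bar> \<le> 1 \<Longrightarrow> 0 < Im z \<Longrightarrow> Im z \<le> 1/2 \<Longrightarrow> H z = G z"
    and Hconv: "convex_on {-1..1} (\<lambda>t. Im (H (of_real t)))"
    using second_primitive_boundary_extension[OF F G pos bd] by blast
  obtain D where D: "((\<lambda>t. (Im (H (of_real t)) - Im (H (of_real (-t)))) / t) \<longlongrightarrow> D) (at_right 0)"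
    using convex_symmetric_slope_limit[OF Hconv] by blast
  define f where "f = (\<lambda>z. - \<i> * (H z + cnj (H (- cnj z))) - of_real D * z)"
  \<comment> \<open>Differentiation takes place on \<open>f0\<close>, since H is only known to be
    continuous on a closed rectangle, while G is holomorphic in the whole half-plane.\<close>
  define f0 where "f0 = (\<lambda>z. - \<i> * (G z + cnj (G (- cnj z))) - of_real D * z)"
  define f' where "f' = (\<lambda>z. - \<i> * (F z - cnj (F (- cnj z))) - of_real D)"
  have f0_deriv: "(f0 has_field_derivative f' z) (at z)" if "Im z > 0" for z
  proof -
    have "(G has_field_derivative F (- cnj z)) (at (- cnj z))" using that by (intro G) simp
    moreover have "((\<lambda>w. - w) has_field_derivative - 1) (at (cnj z))"
      by (auto intro!: derivative_eq_intros)
    ultimately have "((\<lambda>w. G (- w)) has_field_derivative F (- cnj z) * (- 1)) (at (cnj z))"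
      by (rule DERIV_chain2)
    then have "((\<lambda>w. G (- w)) has_field_derivative - F (- cnj z)) (at (cnj z))" by simp
    from has_field_derivative_cnj_cnj[OF this]
    have "((\<lambda>w. cnj (G (- cnj w))) has_field_derivative - cnj (F (- cnj z))) (at z)"
      by (simp add: o_def)
    then show ?thesis unfolding f0_def f'_def
      by (auto intro!: derivative_eq_intros G that)
  qed
  have ff0: "f z = f0 z" if "\<bar>Re z\<bar> \<le> 1" "0 < Im z" "Im z \<le> 1/2" for z
    using that by (simp add: f_def f0_def HG)
  have f_cont: "continuous_on (cbox 0 (Complex r r)) f" if "0 < r" "r \<le> 1/2" for r
    unfolding f_def
    by (intro continuous_intros continuous_on_compose2[OF Hcont])
       (use that in \<open>auto simp: in_cbox_complex_iff\<close>)
  have left: "Re (f (Complex 0 y)) = 0" for y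
  proof -
    have "- cnj (Complex 0 y) = Complex 0 y" by (simp add: complex_eq_iff)
    then show ?thesis by (simp add: f_def)
  qed
  have bot: "Re (f (Complex t 0)) = Im (H (of_real t)) - Im (H (of_real (-t))) - D * t" for t
  proof -
    have "- cnj (Complex t 0) = Complex (- t) 0" by (simp add: complex_eq_iff)
    then show ?thesis by (simp add: f_def complex_of_real_def)
  qed
  have axis: "Re (f' (Complex 0 y)) = 2 * Im (F (Complex 0 y)) - D" for y
  proof -
    have "- cnj (Complex 0 y) = Complex 0 y" by (simp add: complex_eq_iff)
    then show ?thesis by (simp add: f'_def)
  qed
  have main: "\<forall>\<^sub>F y in at_right 0. \<bar>2 * Im (F (Complex 0 y)) - D\<bar> < e" if "e > 0" for e
  proof -
    define d where "d = e / 4"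
    have d: "d > 0" using that by (simp add: d_def)
    from tendstoD[OF D d] obtain r0 where r0: "r0 > 0"
      "\<And>t. 0 < t \<Longrightarrow> t < r0 \<Longrightarrow> \<bar>(Im (H (of_real t)) - Im (H (of_real (-t)))) / t - D\<bar> < d"
      unfolding eventually_at_right_field dist_real_def by blast
    \<comment> \<open>Below r0 the slopes are within d of D; below 1/2 the square stays in the
      region where H is continuous and agrees with G.\<close>
    define r where "r = min (r0/2) (1/2)"
    have r: "0 < r" "r \<le> 1/2" "r < r0" using r0(1) by (auto simp: r_def)
    have bot_le: "\<bar>Re (f (Complex t 0))\<bar> \<le> d * t" if "0 \<le> t" "t \<le> r" for t
    proof (cases "t = 0")
      case False
      then have "0 < t" "t < r0" using that r by auto
      from r0(2)[OF this] have "\<bar>(Im (H (of_real t)) - Im (H (of_real (-t))) - D * t) / t\<bar> < d"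
        using \<open>0 < t\<close> by (simp add: diff_divide_distrib)
      then show ?thesis
        unfolding bot abs_divide using \<open>0 < t\<close> by (simp add: pos_divide_less_eq)
    qed (simp add: left)
    have fc: "continuous_on (cbox 0 (Complex r r)) f" by (rule f_cont[OF r(1,2)])
    have fy: "continuous_on {0..r} (\<lambda>y. Re (f (Complex r y)))"
      unfolding Complex_eq by (intro continuous_intros continuous_on_compose2[OF fc])
         (use r in \<open>auto simp: in_cbox_complex_iff\<close>)
    have "\<forall>\<^sub>F y in at_right 0. \<bar>Re (f (Complex r y))\<bar> < 2 * d * r"
    proof -
      have "((\<lambda>y. \<bar>Re (f (Complex r y))\<bar>) \<longlongrightarrow> \<bar>Re (f (Complex r 0))\<bar>) (at_right 0)"
        by (intro tendsto_rabs continuous_on_Icc_at_rightD[OF fy r(1)])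
      moreover have "\<bar>Re (f (Complex r 0))\<bar> < 2 * d * r"
      proof -
        have "\<bar>Re (f (Complex r 0))\<bar> \<le> d * r" using bot_le[of r] r by simp
        moreover have "0 < d * r" using d r by simp
        ultimately show ?thesis by linarith
      qed
      ultimately show ?thesis by (rule order_tendstoD(2))
    qed
    then obtain y0 where y0: "y0 > 0" "\<And>y. 0 < y \<Longrightarrow> y < y0 \<Longrightarrow> \<bar>Re (f (Complex r y))\<bar> < 2 * d * r"
      unfolding eventually_at_right_field by blast
    have "bounded ((\<lambda>y. Re (f (Complex r y))) ` {0..r})"
      by (intro compact_imp_bounded compact_continuous_image fy) simp
    then obtain M1 where "M1 > 0" "\<forall>x\<in>(\<lambda>y. Re (f (Complex r y))) ` {0..r}. norm x \<le> M1"
      unfolding bounded_pos by blast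
    then have M1: "M1 > 0" "\<And>y. 0 \<le> y \<Longrightarrow> y \<le> r \<Longrightarrow> \<bar>Re (f (Complex r y))\<bar> \<le> M1"
      by auto
    have F_cont: "continuous_on {z. 0 < Im z} F"
      by (rule DERIV_continuous_on) (auto intro!: has_field_derivative_at_within[OF F])
    have "continuous_on (cbox (Complex 0 r) (Complex r r)) f'"
      unfolding f'_def
      by (intro continuous_intros continuous_on_compose2[OF F_cont])
         (use r in \<open>auto simp: in_cbox_complex_iff\<close>)
    then have "bounded (f' ` cbox (Complex 0 r) (Complex r r))"
      by (intro compact_imp_bounded compact_continuous_image) auto
    then obtain M2 where M2: "M2 > 0" "\<And>z. z \<in> cbox (Complex 0 r) (Complex r r) \<Longrightarrow> norm (f' z) \<le> M2"
      unfolding bounded_pos by auto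
    \<comment> \<open>The first entry lets C r y dominate the maximum M1 on the part y >= y0 of the
      right side; the second lets C t r dominate the gradient bound M2 t on the top. C depends on r,
      which is harmless because only C y survives as y tends to 0.\<close>
    define C where "C = max (M1 / (r * y0)) (M2 / r)"
    have C: "C > 0" unfolding C_def using M1 r y0 by (simp add: less_max_iff_disj)
    \<comment> \<open>Near the real axis continuity at the corner, where the value is at most d r,
      gives 2 d r; higher up the term C r y takes over. This slack is why the comparison is run with
      2 d.\<close>
    have right: "\<bar>Re (f (Complex r y))\<bar> \<le> 2 * d * r + C * r * y" if y: "0 \<le> y" "y \<le> r" for y
    proof (cases "y < y0")
      case True
      have "\<bar>Re (f (Complex r y))\<bar> \<le> 2 * d * r"
      proof (cases "y = 0")
        case True
        have "\<bar>Re (f (Complex r 0))\<bar> \<le> d * r" using bot_le[of r] r by simp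
        moreover have "0 < d * r" using d r by simp
        ultimately show ?thesis using True by simp
      qed (use y0(2)[of y] \<open>y < y0\<close> y in auto)
      then show ?thesis using C r y by (smt (verit) mult_nonneg_nonneg)
    next
      case False
      have "M1 = M1 / (r * y0) * (r * y0)" using r y0 by simp
      also have "\<dots> \<le> C * (r * y)"
        using C r y0 False M1 by (intro mult_mono) (auto simp: C_def)
      finally have "\<bar>Re (f (Complex r y))\<bar> \<le> C * r * y"
        using M1(2)[OF y] by (simp add: mult.assoc)
      moreover have "0 < 2 * d * r" using d r by simp
      ultimately show ?thesis by linarith
    qed
    have top: "\<bar>Re (f (Complex t r))\<bar> \<le> 2 * d * t + C * t * r" if t: "0 \<le> t" "t \<le> r" for t
    proof -
      have "norm (f0 (Complex t r) - f0 (Complex 0 r)) \<le> M2 * norm (Complex t r - Complex 0 r)"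
      proof (rule field_differentiable_bound[where S="cbox (Complex 0 r) (Complex r r)" and f'=f'])
        show "(f0 has_field_derivative f' z) (at z within cbox (Complex 0 r) (Complex r r))"
          if "z \<in> cbox (Complex 0 r) (Complex r r)" for z
          by (rule has_field_derivative_at_within[OF f0_deriv]) (use that r in \<open>auto simp: in_cbox_complex_iff\<close>)
      qed (use M2 t in \<open>auto simp: in_cbox_complex_iff\<close>)
      moreover have "Complex t r - Complex 0 r = of_real t"
        by (simp add: complex_eq_iff)
      moreover have "f0 (Complex t r) = f (Complex t r)" "f0 (Complex 0 r) = f (Complex 0 r)"
        using ff0 t r by auto
      ultimately have "norm (f (Complex t r) - f (Complex 0 r)) \<le> M2 * t" using t by simp
      then have "\<bar>Re (f (Complex t r))\<bar> \<le> M2 * t"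
        using abs_Re_le_cmod[of "f (Complex t r) - f (Complex 0 r)"] by (simp add: left)
      also have "M2 * t = M2 / r * (t * r)" using r by simp
      also have "\<dots> \<le> C * (t * r)" by (intro mult_right_mono) (use t r in \<open>auto simp: C_def\<close>)
      also have "\<dots> \<le> 2 * d * t + C * t * r" using d t by (simp add: mult.assoc)
      finally show ?thesis .
    qed
    have f_hol: "f holomorphic_on box 0 (Complex r r)"
    proof -
      have "f0 holomorphic_on box 0 (Complex r r)"
        unfolding holomorphic_on_def field_differentiable_def
        by (metis (no_types, lifting) f0_deriv has_field_derivative_at_within in_box_complex_iff
            greaterThanLessThan_iff zero_complex.sel(2))
      then show ?thesis
        by (rule holomorphic_transform) (use r in \<open>auto simp: in_box_complex_iff intro!: ff0[symmetric]\<close>)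
    qed
    have inner: "\<bar>Re (f (Complex t y))\<bar> \<le> (2 * d + C * y) * t" if ty: "0 < t" "t < r" "0 < y" "y < r" for t y
    proof -
      have bot': "Re (f (Complex t 0)) \<le> 2 * d * t" "Re (- f (Complex t 0)) \<le> 2 * d * t"
        if "0 \<le> t" "t \<le> r" for t
      proof -
        have "0 \<le> d * t" using d that by simp
        then show "Re (f (Complex t 0)) \<le> 2 * d * t" "Re (- f (Complex t 0)) \<le> 2 * d * t"
          using bot_le[OF that] by (simp_all add: abs_le_iff)
      qed
      have right': "Re (f (Complex r y)) \<le> 2 * d * r + C * r * y" "Re (- f (Complex r y)) \<le> 2 * d * r + C * r * y"
        if "0 \<le> y" "y \<le> r" for y
        using right[OF that] by (simp_all add: abs_le_iff)
      have top': "Re (f (Complex t r)) \<le> 2 * d * t + C * t * r" "Re (- f (Complex t r)) \<le> 2 * d * t + C * t * r"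
        if "0 \<le> t" "t \<le> r" for t
        using top[OF that] by (simp_all add: abs_le_iff)
      have left': "Re (f (Complex 0 y)) \<le> 0" "Re (- f (Complex 0 y)) \<le> 0" for y
        by (simp_all add: left)
      have "Re (f (Complex t y)) \<le> 2 * d * t + C * t * y"
        by (rule harmonic_corner_bound[OF r(1) fc f_hol left'(1) bot'(1) right'(1) top'(1) ty])
      moreover have "Re (- f (Complex t y)) \<le> 2 * d * t + C * t * y"
        by (rule harmonic_corner_bound[OF r(1) continuous_on_minus[OF fc] holomorphic_on_minus[OF f_hol]
              left'(2) bot'(2) right'(2) top'(2) ty])
      ultimately show ?thesis unfolding abs_le_iff by (simp add: algebra_simps)
    qed
    \<comment> \<open>Re f vanishes at t = 0, so the quotient of the interior bound by t passes to
      the derivative in t at the imaginary axis.\<close>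
    have axis_le: "\<bar>2 * Im (F (Complex 0 y)) - D\<bar> \<le> 2 * d + C * y" if y: "0 < y" "y < r" for y
    proof -
      have "((\<lambda>s. of_real s + \<i> * of_real y) has_vector_derivative 1) (at 0)"
        by (auto intro!: derivative_eq_intros)
      then have "((\<lambda>s. Complex s y) has_vector_derivative 1) (at 0)"
        by (simp add: Complex_eq[abs_def])
      then have "((\<lambda>s. f0 (Complex s y)) has_vector_derivative f' (Complex 0 y)) (at 0)"
        using field_vector_diff_chain_at[of "\<lambda>s. Complex s y" 1 0 f0, OF _ f0_deriv] y by (simp add: o_def)
      then have "((\<lambda>s. Re (f0 (Complex s y))) has_real_derivative Re (f' (Complex 0 y))) (at 0)"
        unfolding has_real_derivative_iff_has_vector_derivative
        by (rule bounded_linear.has_vector_derivative[OF bounded_linear_Re])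
      then have "((\<lambda>s. (Re (f0 (Complex s y)) - Re (f0 (Complex 0 y))) / s) \<longlongrightarrow> Re (f' (Complex 0 y))) (at_right 0)"
        unfolding has_field_derivative_iff by (simp add: filterlim_at_split)
      then have "((\<lambda>s. \<bar>(Re (f0 (Complex s y)) - Re (f0 (Complex 0 y))) / s\<bar>) \<longlongrightarrow> \<bar>Re (f' (Complex 0 y))\<bar>) (at_right 0)"
        by (rule tendsto_rabs)
      moreover have "\<forall>\<^sub>F s in at_right 0. \<bar>(Re (f0 (Complex s y)) - Re (f0 (Complex 0 y))) / s\<bar> \<le> 2 * d + C * y"
      proof (rule eventually_at_rightI[of 0 r])
        fix s assume s: "s \<in> {0<..<r}"
        then have "f0 (Complex s y) = f (Complex s y)" "f0 (Complex 0 y) = f (Complex 0 y)"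
          using ff0 y r by auto
        then show "\<bar>(Re (f0 (Complex s y)) - Re (f0 (Complex 0 y))) / s\<bar> \<le> 2 * d + C * y"
          using inner[of s y] s y by (simp add: left pos_divide_le_eq)
      qed (rule r)
      ultimately show ?thesis
        unfolding axis by (rule tendsto_upperbound) simp
    qed
    show ?thesis
    proof (rule eventually_at_rightI)
      show "0 < min r (d / C)" using r d C by simp
      fix y assume y: "y \<in> {0<..<min r (d / C)}"
      then have "C * y < d" using C by (simp add: field_simps)
      then show "\<bar>2 * Im (F (Complex 0 y)) - D\<bar> < e"
        using axis_le[of y] y d by (simp add: d_def)
    qed
  qed
  have "((\<lambda>y. 2 * Im (F (Complex 0 y))) \<longlongrightarrow> D) (at_right 0)"
    by (rule tendstoI) (use main in \<open>simp add: dist_real_def\<close>)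
  from tendsto_mult_left[OF this, of "1/2"] show ?thesis
    by (intro exI[of _ "D/2"]) simp
qed

text \<open>At height y the integral is the increment of Im F between the two endpoints, so
  convergence has to be shown only at single points, by translation to 0. No boundary limit of m
  itself is required, which is what makes the endpoint 0 accessible.\<close>

lemma stieltjes_inversion_limit:
  fixes m :: "complex \<Rightarrow> complex"
  assumes m: "m holomorphic_on {z. 0 < Im z}"
    and pos: "\<And>z. Im z > 0 \<Longrightarrow> 0 \<le> Im (m z)"
    and bd: "\<And>r. \<exists>C. \<forall>z. \<bar>Re z\<bar> \<le> r \<longrightarrow> 0 < Im z \<longrightarrow> Im z \<le> 1 \<longrightarrow> norm (m z) \<le> C / Im z"
    and ab: "a \<le> b"
  shows "\<exists>L. ((\<lambda>\<epsilon>. integral {a..b} (\<lambda>t. Im (m (of_real t + \<i> * of_real \<epsilon>)))) \<longlongrightarrow> L) (at_right 0)"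
proof -
  from holomorphic_convex_primitive'[OF upper_half_plane m]
  obtain F where F0: "\<And>z. z \<in> {z. 0 < Im z} \<Longrightarrow> (F has_field_derivative m z) (at z within {z. 0 < Im z})"
    by blast
  have F: "(F has_field_derivative m z) (at z)" if "0 < Im z" for z
    using F0[of z] at_within_open[OF _ upper_half_plane(2), of z] that by simp
  have lim: "\<exists>L. ((\<lambda>y. Im (F (Complex x y))) \<longlongrightarrow> L) (at_right 0)" for x
  proof -
    obtain C where C: "\<And>z. \<bar>Re z\<bar> \<le> \<bar>x\<bar> + 1 \<Longrightarrow> 0 < Im z \<Longrightarrow> Im z \<le> 1 \<Longrightarrow> norm (m z) \<le> C / Im z"
      using bd by blast
    have "\<exists>L. ((\<lambda>y. Im (F (of_real x + Complex 0 y))) \<longlongrightarrow> L) (at_right 0)"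
    proof (rule herglotz_primitive_limit)
      show "((\<lambda>z. F (of_real x + z)) has_field_derivative m (of_real x + z)) (at z)" if "0 < Im z" for z
      proof -
        have "((\<lambda>z. of_real x + z) has_field_derivative 1) (at z)"
          by (auto intro!: derivative_eq_intros)
        moreover have "(F has_field_derivative m (of_real x + z)) (at (of_real x + z))"
          using that by (intro F) simp
        ultimately have "((\<lambda>z. F (of_real x + z)) has_field_derivative m (of_real x + z) * 1) (at z)"
          by (rule DERIV_chain2[rotated])
        then show ?thesis by simp
      qed
      show "norm (m (of_real x + z)) \<le> C / Im z" if "\<bar>Re z\<bar> \<le> 1" "0 < Im z" "Im z \<le> 1" for z
        using C[of "of_real x + z"] that by simp
    qed (simp add: pos)
    moreover have "of_real x + Complex 0 y = Complex x y" for y by (simp add: complex_eq_iff)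
    ultimately show ?thesis by simp
  qed
  have int: "integral {a..b} (\<lambda>t. Im (m (of_real t + \<i> * of_real y))) = Im (F (Complex b y)) - Im (F (Complex a y))"
    if "y > 0" for y
  proof (rule integral_unique, rule fundamental_theorem_of_calculus[OF ab])
    fix t
    have "((\<lambda>s. of_real s + \<i> * of_real y) has_vector_derivative 1) (at t)"
      by (auto intro!: derivative_eq_intros)
    then have "((\<lambda>s. F (of_real s + \<i> * of_real y)) has_vector_derivative m (of_real t + \<i> * of_real y)) (at t)"
      using field_vector_diff_chain_at[of "\<lambda>s. of_real s + \<i> * of_real y" 1 t F, OF _ F] that by (simp add: o_def)
    then show "((\<lambda>s. Im (F (Complex s y))) has_vector_derivative Im (m (of_real t + \<i> * of_real y))) (at t within {a..b})"
      unfolding Complex_eq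
      by (rule has_vector_derivative_at_within[OF bounded_linear.has_vector_derivative[OF bounded_linear_Im]])
  qed
  from lim[of a] lim[of b] obtain La Lb where
    "((\<lambda>y. Im (F (Complex b y))) \<longlongrightarrow> Lb) (at_right 0)" "((\<lambda>y. Im (F (Complex a y))) \<longlongrightarrow> La) (at_right 0)" by blast
  from tendsto_diff[OF this] have "((\<lambda>y. integral {a..b} (\<lambda>t. Im (m (of_real t + \<i> * of_real y)))) \<longlongrightarrow> Lb - La) (at_right 0)"
    by (rule Lim_transform_eventually) (auto simp: int intro!: eventually_at_rightI[of 0 1])
  then show ?thesis by blast
qed

section \<open>Asymptotics of the Appell system\<close>

lemma integral_tendsto_at_top:
  fixes f :: "real \<Rightarrow> 'a::euclidean_space"
  assumes f: "f absolutely_integrable_on {a..}"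
  shows "((\<lambda>b. integral {a..b} f) \<longlongrightarrow> integral {a..} f) at_top"
proof -
  have "((\<lambda>b. set_lebesgue_integral lebesgue {a..b} f) \<longlongrightarrow> set_lebesgue_integral lebesgue {a..} f) at_top"
    by (rule tendsto_set_lebesgue_integral_at_top) (use f in auto)
  moreover have "set_lebesgue_integral lebesgue {a..} f = integral {a..} f"
    by (rule set_lebesgue_integral_eq_integral(2)[OF f])
  moreover have "set_lebesgue_integral lebesgue {a..b} f = integral {a..b} f" for b
    by (rule set_lebesgue_integral_eq_integral(2)[OF absolutely_integrable_on_subinterval[OF f]]) auto
  ultimately show ?thesis by simp
qed

lemma tail_integral_tendsto_0:
  fixes f :: "real \<Rightarrow> real"
  assumes f: "f absolutely_integrable_on {a..}"
  shows "((\<lambda>x. integral {x..} f) \<longlongrightarrow> 0) at_top"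
proof -
  have sub: "f integrable_on {x..}" if "x \<ge> a" for x
    by (rule set_lebesgue_integral_eq_integral(1)[OF set_integrable_subset[OF f]]) (use that in auto)
  have split: "integral {a..} f - integral {a..x} f = integral {x..} f" if "x \<ge> a" for x
  proof -
    have "(f has_integral (integral {a..x} f + integral {x..} f)) ({a..x} \<union> {x..})"
    proof (rule has_integral_Un)
      show "(f has_integral integral {a..x} f) {a..x}"
        by (rule integrable_integral, rule integrable_on_subinterval[OF sub[of a]]) auto
      show "(f has_integral integral {x..} f) {x..}"
        by (rule integrable_integral[OF sub[OF that]])
      have "{a..x} \<inter> {x..} \<subseteq> {x}" by auto
      then show "negligible ({a..x} \<inter> {x..})"
        by (rule negligible_subset[rotated]) simp
    qed
    moreover have "{a..x} \<union> {x..} = {a..}" using that by auto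
    ultimately have "integral {a..} f = integral {a..x} f + integral {x..} f"
      by (simp add: integral_unique)
    then show ?thesis by simp
  qed
  have "((\<lambda>x. integral {a..} f - integral {a..x} f) \<longlongrightarrow> integral {a..} f - integral {a..} f) at_top"
    by (intro tendsto_intros integral_tendsto_at_top f)
  then have "((\<lambda>x. integral {a..} f - integral {a..x} f) \<longlongrightarrow> 0) at_top" by simp
  then show ?thesis
    by (rule Lim_transform_eventually) (use split in \<open>auto simp: eventually_at_top_linorder\<close>)
qed

lemma nondecreasing_from_derivative:
  fixes f :: "real \<Rightarrow> real"
  assumes der: "\<And>x. a \<le> x \<Longrightarrow> x \<le> b \<Longrightarrow> (f has_real_derivative f' x) (at x within {A..})"
    and nonneg: "\<And>x. a \<le> x \<Longrightarrow> x \<le> b \<Longrightarrow> 0 \<le> f' x" and ab: "A \<le> a" "a \<le> b"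
  shows "f a \<le> f b"
proof (rule DERIV_nonneg_imp_increasing_open[OF ab(2)])
  show "continuous_on {a..b} f"
    by (rule DERIV_continuous_on[where D=f']) (use ab in \<open>auto intro: DERIV_subset[OF der]\<close>)
  fix x assume "a < x" "x < b"
  then have "at x within {A..} = at x"
    using ab by (intro at_within_interior) auto
  with der[of x] nonneg[of x] \<open>a < x\<close> \<open>x < b\<close> show "\<exists>y. DERIV f x :> y \<and> y \<ge> 0"
    by auto
qed

text \<open>A Gronwall estimate started at infinity: integrate -(ln S)' <= g from X to T and let T
  tend to infinity.\<close>

lemma log_derivative_tail_bound:
  fixes S g :: "real \<Rightarrow> real"
  assumes der: "\<And>x. x \<ge> X \<Longrightarrow> (S has_real_derivative S' x) (at x within {X..})"
    and pos: "\<And>x. x \<ge> X \<Longrightarrow> 0 < S x"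
    and le: "\<And>x. x \<ge> X \<Longrightarrow> \<bar>S' x\<bar> \<le> g x * S x"
    and g: "g integrable_on {X..}"
    and lim: "(S \<longlongrightarrow> s) at_top" and s: "s > 0"
  shows "S X \<le> s * exp (integral {X..} g)"
proof -
  have g_nonneg: "0 \<le> g x" if "x \<ge> X" for x
    using le[OF that] pos[OF that] by (smt (verit) mult_neg_pos)
  have ln_le: "ln (S X) \<le> ln (S T) + integral {X..} g" if T: "T \<ge> X" for T
  proof -
    have "((\<lambda>x. S' x / S x) has_integral ln (S T) - ln (S X)) {X..T}"
    proof (rule fundamental_theorem_of_calculus[OF T])
      fix x assume "x \<in> {X..T}"
      then have "((\<lambda>x. ln (S x)) has_real_derivative S' x / S x) (at x within {X..T})"
        using pos[of x] by (auto intro!: derivative_eq_intros DERIV_subset[OF der] simp: divide_inverse mult.commute)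
      then show "((\<lambda>x. ln (S x)) has_vector_derivative S' x / S x) (at x within {X..T})"
        by (simp add: has_real_derivative_iff_has_vector_derivative)
    qed
    moreover have "(g has_integral integral {X..T} g) {X..T}"
      by (rule integrable_integral, rule integrable_on_subinterval[OF g]) auto
    ultimately have "- (ln (S T) - ln (S X)) \<le> integral {X..T} g"
    proof (rule has_integral_le[OF has_integral_neg])
      fix x assume "x \<in> {X..T}"
      then have "- S' x \<le> g x * S x" using le[of x] by auto
      moreover have "0 < S x" using pos \<open>x \<in> {X..T}\<close> by simp
      ultimately have "(- S' x) / S x \<le> g x" by (simp only: pos_divide_le_eq)
      then show "- (S' x / S x) \<le> g x" by simp
    qed
    moreover have "integral {X..T} g \<le> integral {X..} g"
      by (rule integral_subset_le) (use g g_nonneg in \<open>auto intro: integrable_on_subinterval\<close>)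
    ultimately show ?thesis by linarith
  qed
  have "((\<lambda>T. ln (S T) + integral {X..} g) \<longlongrightarrow> ln s + integral {X..} g) at_top"
    using lim s by (intro tendsto_intros) auto
  then have "ln (S X) \<le> ln s + integral {X..} g"
    by (rule tendsto_lowerbound) (use ln_le in \<open>auto simp: eventually_at_top_linorder\<close>)
  then have "exp (ln (S X)) \<le> exp (ln s + integral {X..} g)" by simp
  then show ?thesis using pos[of X] s by (simp add: exp_add)
qed

text \<open>The sum of a positive number and its inverse attains its minimum 2 only at 1.
  Multiplying out gives (\<rho> - 1)^2 <= \<eta> \<rho>, and the hypotheses keep \<rho> below 3. It
  is applied to \<rho> = sqrt l R.\<close>

lemma near_one_from_sum_inverse:
  fixes \<rho> :: real
  assumes "0 < \<rho>" "0 \<le> \<eta>" "\<eta> \<le> 1" "1 / \<rho> + \<rho> \<le> 2 + \<eta>"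
  shows "\<bar>\<rho>\<^sup>2 - 1\<bar> \<le> 4 * sqrt (3 * \<eta>)"
proof -
  have "0 < 1 / \<rho>" using assms by simp
  then have \<rho>3: "\<rho> \<le> 3" using assms by linarith
  have "(1 / \<rho> + \<rho>) * \<rho> \<le> (2 + \<eta>) * \<rho>"
    using assms by (intro mult_right_mono) auto
  then have "(\<rho> - 1)\<^sup>2 \<le> \<eta> * \<rho>"
    using assms by (simp add: power2_eq_square algebra_simps)
  also have "\<dots> \<le> 3 * \<eta>" using mult_left_mono[OF \<rho>3 assms(2)] by simp
  finally have "\<bar>\<rho> - 1\<bar> \<le> sqrt (3 * \<eta>)" by (intro real_le_rsqrt) simp
  then have "\<bar>\<rho> - 1\<bar> * (\<rho> + 1) \<le> sqrt (3 * \<eta>) * 4"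
    using \<rho>3 assms by (intro mult_mono) auto
  moreover have "\<bar>\<rho>\<^sup>2 - 1\<bar> = \<bar>\<rho> - 1\<bar> * (\<rho> + 1)"
  proof -
    have "\<rho>\<^sup>2 - 1 = (\<rho> - 1) * (\<rho> + 1)" by (simp add: power2_eq_square algebra_simps)
    then show ?thesis using assms by (simp add: abs_mult)
  qed
  ultimately show ?thesis by simp
qed

section \<open>Appell solutions: invariant, positivity and uniform estimates\<close>

definition appell_solution ::
  "real \<Rightarrow> (real \<Rightarrow> real) \<Rightarrow> real \<Rightarrow> (real \<Rightarrow> real) \<Rightarrow> (real \<Rightarrow> real) \<Rightarrow> (real \<Rightarrow> real) \<Rightarrow> bool" where
  "appell_solution A q l P Q R \<longleftrightarrow>
     (\<forall>x\<ge>A. (P has_real_derivative (l - q x) * Q x) (at x within {A..}) \<and>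
            (Q has_real_derivative - 2 * P x + 2 * (l - q x) * R x) (at x within {A..}) \<and>
            (R has_real_derivative - Q x) (at x within {A..})) \<and>
     (P \<longlongrightarrow> sqrt l) at_top \<and> (Q \<longlongrightarrow> 0) at_top \<and> (R \<longlongrightarrow> 1 / sqrt l) at_top"

lemma appell_solutionD:
  assumes "appell_solution A q l P Q R"
  shows "\<And>x. x \<ge> A \<Longrightarrow> (P has_real_derivative (l - q x) * Q x) (at x within {A..})"
    "\<And>x. x \<ge> A \<Longrightarrow> (Q has_real_derivative - 2 * P x + 2 * (l - q x) * R x) (at x within {A..})"
    "\<And>x. x \<ge> A \<Longrightarrow> (R has_real_derivative - Q x) (at x within {A..})"
    "(P \<longlongrightarrow> sqrt l) at_top" "(Q \<longlongrightarrow> 0) at_top" "(R \<longlongrightarrow> 1 / sqrt l) at_top"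
  using assms unfolding appell_solution_def by auto

text \<open>The Appell flow preserves the discriminant of the quadratic form with coefficients P, Q,
  R; the value 4 is read off at infinity.\<close>

lemma appell_invariant:
  assumes U: "appell_solution A q l P Q R" and l: "l > 0" and x: "x \<ge> A"
  shows "4 * P x * R x - (Q x)\<^sup>2 = 4"
proof -
  note D = appell_solutionD[OF U]
  let ?I = "\<lambda>x. 4 * P x * R x - (Q x)\<^sup>2"
  have "\<exists>c. \<forall>x\<in>{A..}. ?I x = c"
  proof (rule has_field_derivative_zero_constant)
    show "(?I has_real_derivative 0) (at x within {A..})" if "x \<in> {A..}" for x
      using that by (auto intro!: derivative_eq_intros D simp: algebra_simps power2_eq_square)
  qed simp
  then obtain c where c: "\<And>x. x \<ge> A \<Longrightarrow> ?I x = c" by auto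
  have "(?I \<longlongrightarrow> 4 * sqrt l * (1 / sqrt l) - 0\<^sup>2) at_top"
    by (intro tendsto_intros D)
  then have "(?I \<longlongrightarrow> 4) at_top" using l by simp
  moreover have "(?I \<longlongrightarrow> c) at_top"
    by (rule tendsto_eventually) (use c in \<open>auto simp: eventually_at_top_linorder\<close>)
  ultimately have "c = 4"
    using tendsto_unique[OF trivial_limit_at_top_linorder] by blast
  with c[OF x] show ?thesis by simp
qed

text \<open>A zero of R would turn the invariant into -Q^2 = 4. Hence R keeps the sign of its limit,
  and P inherits it from 4 P R >= 4.\<close>

lemma appell_pos:
  assumes U: "appell_solution A q l P Q R" and l: "l > 0" and x: "x \<ge> A"
  shows "0 < R x" "0 < P x"
proof -
  note D = appell_solutionD[OF U]
  have ne: "R t \<noteq> 0" if "t \<ge> A" for t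
  proof
    assume "R t = 0"
    then have "(Q t)\<^sup>2 = - 4" using appell_invariant[OF U l that] by simp
    moreover have "0 \<le> (Q t)\<^sup>2" by simp
    ultimately show False by linarith
  qed
  show R: "0 < R x"
  proof (rule ccontr)
    assume "\<not> 0 < R x"
    then have "R x \<le> 0" by simp
    have "\<forall>\<^sub>F t in at_top. 0 < R t"
      using order_tendstoD(1)[OF D(6), of 0] l by simp
    then obtain T where T: "\<And>t. t \<ge> T \<Longrightarrow> 0 < R t" by (auto simp: eventually_at_top_linorder)
    have cont: "continuous_on {x..max x T} R"
      by (rule DERIV_continuous_on[where D="\<lambda>t. - Q t"]) (use x in \<open>auto intro: DERIV_subset[OF D(3)]\<close>)
    have "\<exists>t\<ge>x. t \<le> max x T \<and> R t = 0"
      by (rule IVT'[OF \<open>R x \<le> 0\<close> _ _ cont]) (use T[of "max x T"] in auto)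
    then show False using ne x by force
  qed
  have "0 < 4 * P x * R x" using appell_invariant[OF U l x] zero_le_power2[of "Q x"] by linarith
  then show "0 < P x" using R by (simp add: zero_less_mult_iff)
qed

text \<open>By the invariant Q^2 <= 4 P R, and the arithmetic-geometric mean inequality applied to P
  and c R does the rest. The uses are c = l and c = 1.\<close>

lemma appell_Q_bound:
  assumes U: "appell_solution A q l P Q R" and l: "l > 0" and x: "x \<ge> A" and c: "c > 0"
  shows "sqrt c * \<bar>Q x\<bar> \<le> P x + c * R x"
proof -
  have "(sqrt c * \<bar>Q x\<bar>)\<^sup>2 = c * (Q x)\<^sup>2" using c by (simp add: power_mult_distrib)
  also have "\<dots> = c * (4 * P x * R x - 4)" using appell_invariant[OF U l x] by simp
  also have "\<dots> \<le> (P x + c * R x)\<^sup>2"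
  proof -
    have "0 \<le> (P x - c * R x)\<^sup>2" by simp
    then show ?thesis using c by (simp add: power2_eq_square algebra_simps)
  qed
  finally show ?thesis
    by (rule power2_le_imp_le) (use appell_pos[OF U l x] c in simp)
qed

lemma appell_inverse_le:
  assumes U: "appell_solution A q l P Q R" and l: "l > 0" and x: "x \<ge> A"
  shows "1 / R x \<le> P x"
proof -
  have "4 \<le> 4 * P x * R x" using appell_invariant[OF U l x] zero_le_power2[of "Q x"] by linarith
  then show ?thesis using appell_pos[OF U l x] by (simp add: pos_divide_le_eq)
qed

text \<open>This is the common end of the two decay cases, with c = l or c = l - q. Replacing P by
  its lower bound 1 / R and c by (1 - \<eta>/32) l leaves 1/\<rho> + \<rho> for \<rho> = sqrt l R.
  Since \<rho> <= 3, the correction costs at most 3 \<eta>/32, which fits into the half of \<eta>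
  that the last hypothesis leaves free.\<close>

lemma appell_near_limit:
  assumes U: "appell_solution A q l P Q R" and l: "l > 0" and x: "x \<ge> A"
    and \<eta>: "0 \<le> \<eta>" "\<eta> \<le> 1"
    and c: "(1 - \<eta> / 32) * l \<le> c"
    and le: "P x + c * R x \<le> 2 * sqrt l * (1 + \<eta> / 4)"
  shows "\<bar>l * (R x)\<^sup>2 - 1\<bar> \<le> 4 * sqrt (3 * \<eta>)" "P x \<le> 4 * sqrt l"
proof -
  have R: "R x > 0" using appell_pos[OF U l x] by simp
  define s where "s = sqrt l"
  have s: "s > 0" "l = s * s" using l by (simp_all add: s_def)
  define \<rho> where "\<rho> = s * R x"
  have \<rho>: "\<rho> > 0" using R s by (simp add: \<rho>_def)
  have cR: "(1 - \<eta> / 32) * l * R x \<le> c * R x" using c R by (intro mult_right_mono) auto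
  have "1 / R x + (1 - \<eta> / 32) * l * R x \<le> 2 * s * (1 + \<eta> / 4)"
    using le cR appell_inverse_le[OF U l x] by (simp add: s_def)
  then have "(1 / R x + (1 - \<eta> / 32) * l * R x) / s \<le> 2 * s * (1 + \<eta> / 4) / s"
    using s by (intro divide_right_mono) auto
  moreover have "(1 / R x + (1 - \<eta> / 32) * l * R x) / s = 1 / \<rho> + (1 - \<eta> / 32) * \<rho>"
    using s R by (simp add: \<rho>_def add_divide_distrib)
  moreover have "2 * s * (1 + \<eta> / 4) / s = 2 * (1 + \<eta> / 4)" using s by simp
  ultimately have main: "1 / \<rho> + (1 - \<eta> / 32) * \<rho> \<le> 2 + \<eta> / 2" by simp
  have "0 < 1 / \<rho>" using \<rho> by simp
  moreover have "(31/32) * \<rho> \<le> (1 - \<eta> / 32) * \<rho>" using \<eta> \<rho> by (intro mult_right_mono) auto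
  ultimately have "\<rho> \<le> 3" using main \<eta> by linarith
  then have "\<eta> / 32 * \<rho> \<le> \<eta> / 32 * 3" using \<eta> by (intro mult_left_mono) auto
  then have "1 / \<rho> + \<rho> \<le> 2 + \<eta>" using main \<eta> by (simp add: algebra_simps)
  from near_one_from_sum_inverse[OF \<rho> \<eta> this]
  show "\<bar>l * (R x)\<^sup>2 - 1\<bar> \<le> 4 * sqrt (3 * \<eta>)"
    by (simp add: \<rho>_def s power2_eq_square algebra_simps)
  have "0 \<le> c * R x" using cR \<eta> l R by (smt (verit) mult_nonneg_nonneg divide_le_eq_1)
  then have "P x \<le> 2 * sqrt l * (1 + \<eta> / 4)" using le by simp
  also have "\<dots> \<le> 2 * sqrt l * 2" using \<eta> l by (intro mult_left_mono) auto
  finally show "P x \<le> 4 * sqrt l" by simp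
qed

lemma exp_tail_integral_eventually:
  fixes g :: "real \<Rightarrow> real"
  assumes g: "g absolutely_integrable_on {X0..}" and e: "e > 0"
  shows "\<forall>\<^sub>F x in at_top. exp (integral {x..} g) \<le> 1 + e"
proof -
  have "((\<lambda>x. exp (integral {x..} g)) \<longlongrightarrow> exp 0) at_top"
    by (intro tendsto_intros tail_integral_tendsto_0[OF g])
  then have "\<forall>\<^sub>F x in at_top. exp (integral {x..} g) < 1 + e"
    by (rule order_tendstoD(2)) (use e in simp)
  then show ?thesis by (rule eventually_mono) simp
qed

text \<open>The sums \<open>P + l R\<close> (integrable \<open>q\<close>) and \<open>P + (l - q) R\<close> (integrable \<open>q'\<close>) have logarithmic
  derivatives bounded by an integrable function, uniformly for \<open>l \<ge> a\<close>, and tend to \<open>2 sqrt l\<close>.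
  Together with \<open>P R \<ge> 1\<close> this forces \<open>R\<close> to be near \<open>1 / sqrt l\<close>.\<close>

lemma appell_uniform_asymptotics:
  fixes q q' :: "real \<Rightarrow> real"
  assumes q: "q absolutely_integrable_on {X0..} \<or>
      (q' absolutely_integrable_on {X0..} \<and>
       (\<forall>x\<ge>X0. (q has_real_derivative q' x) (at x within {X0..})) \<and> (q \<longlongrightarrow> 0) at_top)"
    and a: "a > 0" and d: "d > 0"
  shows "\<exists>X\<ge>A. \<forall>l\<ge>a. \<forall>P Q R x. appell_solution A q l P Q R \<longrightarrow> x \<ge> X \<longrightarrow>
           \<bar>l * (R x)\<^sup>2 - 1\<bar> \<le> d \<and> P x \<le> 4 * sqrt l"
proof -
  \<comment> \<open>Chosen so that 4 sqrt(3 \<eta>) <= d.\<close>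
  define \<eta> where "\<eta> = min 1 (d\<^sup>2 / 48)"
  have \<eta>: "0 < \<eta>" "\<eta> \<le> 1" using d by (auto simp: \<eta>_def)
  have "sqrt (3 * \<eta>) \<le> sqrt ((d / 4)\<^sup>2)"
    by (rule real_sqrt_le_mono) (simp add: \<eta>_def power_divide)
  then have \<eta>d: "4 * sqrt (3 * \<eta>) \<le> d" using d by simp
  from q show ?thesis
  proof
    assume q1: "q absolutely_integrable_on {X0..}"
    \<comment> \<open>The derivative of P + l R is -q Q, and |Q| is at most (P + l R) / sqrt l;
      replacing l by its lower bound a makes g independent of l.\<close>
    define g where "g = (\<lambda>t. \<bar>q t\<bar> / sqrt a)"
    have g: "g absolutely_integrable_on {X0..}"
      unfolding g_def using q1 by (intro set_integrable_divide set_integrable_abs)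
    obtain X1 where X1: "\<And>x. x \<ge> X1 \<Longrightarrow> exp (integral {x..} g) \<le> 1 + \<eta> / 4"
      using exp_tail_integral_eventually[OF g, of "\<eta>/4"] \<eta> by (auto simp: eventually_at_top_linorder)
    define X where "X = max A (max X0 X1)"
    have "\<bar>l * (R x)\<^sup>2 - 1\<bar> \<le> d \<and> P x \<le> 4 * sqrt l"
      if la: "l \<ge> a" and U: "appell_solution A q l P Q R" and x: "x \<ge> X" for l P Q R x
    proof -
      note D = appell_solutionD[OF U]
      have l: "l > 0" and xA: "x \<ge> A" "x \<ge> X0" "x \<ge> X1" using la a x by (auto simp: X_def)
      have "P x + l * R x \<le> 2 * sqrt l * exp (integral {x..} g)"
      proof (rule log_derivative_tail_bound[where S="\<lambda>t. P t + l * R t" and S'="\<lambda>t. - q t * Q t"])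
        fix t assume t: "t \<ge> x"
        then have tA: "t \<ge> A" using xA by simp
        show "((\<lambda>t. P t + l * R t) has_real_derivative - q t * Q t) (at t within {x..})"
          by (rule DERIV_subset[of _ _ _ "{A..}"])
             (use tA xA in \<open>auto intro!: derivative_eq_intros D simp: algebra_simps\<close>)
        show pos: "0 < P t + l * R t" using appell_pos[OF U l tA] l by (simp add: add_pos_pos)
        have "sqrt a * \<bar>Q t\<bar> \<le> sqrt l * \<bar>Q t\<bar>" using la by (intro mult_right_mono) auto
        also have "\<dots> \<le> P t + l * R t" by (rule appell_Q_bound[OF U l tA l])
        finally have "\<bar>Q t\<bar> \<le> (P t + l * R t) / sqrt a" using a by (simp add: pos_le_divide_eq mult.commute)
        then have "\<bar>q t\<bar> * \<bar>Q t\<bar> \<le> \<bar>q t\<bar> * ((P t + l * R t) / sqrt a)" by (intro mult_left_mono) auto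
        then show "\<bar>- q t * Q t\<bar> \<le> g t * (P t + l * R t)" by (simp add: g_def abs_mult)
      next
        show "g integrable_on {x..}"
          by (rule set_lebesgue_integral_eq_integral(1)[OF set_integrable_subset[OF g]]) (use xA in auto)
        have "((\<lambda>t. P t + l * R t) \<longlongrightarrow> sqrt l + l * (1 / sqrt l)) at_top"
          by (intro tendsto_intros D)
        moreover have "l * (1 / sqrt l) = sqrt l" using l by (simp add: real_div_sqrt)
        ultimately show "((\<lambda>t. P t + l * R t) \<longlongrightarrow> 2 * sqrt l) at_top" by simp
      qed (use l in simp)
      also have "\<dots> \<le> 2 * sqrt l * (1 + \<eta> / 4)"
        using X1 xA l by (intro mult_left_mono) auto
      finally have le: "P x + l * R x \<le> 2 * sqrt l * (1 + \<eta> / 4)" .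
      have cl: "(1 - \<eta> / 32) * l \<le> l" using \<eta> l by simp
      from appell_near_limit[OF U l xA(1) _ \<eta>(2) cl le] \<eta> \<eta>d show ?thesis by auto
    qed
    then show ?thesis by (intro exI[of _ X]) (auto simp: X_def)
  next
    assume q2: "q' absolutely_integrable_on {X0..} \<and>
       (\<forall>x\<ge>X0. (q has_real_derivative q' x) (at x within {X0..})) \<and> (q \<longlongrightarrow> 0) at_top"
    \<comment> \<open>In P + (l - q) R the terms with Q cancel and the derivative is -q' R; since l
      - q >= a/2 far out, R is at most the sum divided by a/2.\<close>
    define g where "g = (\<lambda>t. \<bar>q' t\<bar> / (a / 2))"
    have g: "g absolutely_integrable_on {X0..}"
      unfolding g_def using q2 by (intro set_integrable_divide set_integrable_abs) auto
    obtain X1 where X1: "\<And>x. x \<ge> X1 \<Longrightarrow> exp (integral {x..} g) \<le> 1 + \<eta> / 4"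
      using exp_tail_integral_eventually[OF g, of "\<eta>/4"] \<eta> by (auto simp: eventually_at_top_linorder)
    have "\<forall>\<^sub>F x in at_top. dist (q x) 0 < a * \<eta> / 32"
      by (rule tendstoD) (use q2 a \<eta> in auto)
    \<comment> \<open>The threshold yields both l - q >= (1 - \<eta>/32) l, as
      \<open>appell_near_limit\<close> demands of c, and |q| <= a/2.\<close>
    then obtain X2 where X2: "\<And>x. x \<ge> X2 \<Longrightarrow> \<bar>q x\<bar> < a * \<eta> / 32"
      by (auto simp: eventually_at_top_linorder)
    define X where "X = max (max A X0) (max X1 X2)"
    have "\<bar>l * (R x)\<^sup>2 - 1\<bar> \<le> d \<and> P x \<le> 4 * sqrt l"
      if la: "l \<ge> a" and U: "appell_solution A q l P Q R" and x: "x \<ge> X" for l P Q R x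
    proof -
      note D = appell_solutionD[OF U]
      have l: "l > 0" and xA: "x \<ge> A" "x \<ge> X0" "x \<ge> X1" "x \<ge> X2" using la a x by (auto simp: X_def)
      have q_le: "\<bar>q t\<bar> \<le> l * \<eta> / 32" "\<bar>q t\<bar> \<le> a / 2" if "t \<ge> x" for t
      proof -
        have "a * \<eta> \<le> l * \<eta>" "a * \<eta> \<le> a" using la a \<eta> by (auto intro: mult_right_mono)
        then show "\<bar>q t\<bar> \<le> l * \<eta> / 32" "\<bar>q t\<bar> \<le> a / 2" using X2[of t] that xA a by linarith+
      qed
      have "P x + (l - q x) * R x \<le> 2 * sqrt l * exp (integral {x..} g)"
      proof (rule log_derivative_tail_bound[where S="\<lambda>t. P t + (l - q t) * R t" and S'="\<lambda>t. - q' t * R t"])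
        fix t assume t: "t \<ge> x"
        then have tA: "t \<ge> A" "t \<ge> X0" using xA by simp_all
        have sub: "{x..} \<subseteq> {A..}" "{x..} \<subseteq> {X0..}" using xA by auto
        show "((\<lambda>t. P t + (l - q t) * R t) has_real_derivative - q' t * R t) (at t within {x..})"
          using q2 tA
          by (auto intro!: derivative_eq_intros DERIV_subset[OF D(1) sub(1)] DERIV_subset[OF D(3) sub(1)]
               DERIV_subset[of q "q' t" t "{X0..}", OF _ sub(2)] simp: algebra_simps)
        have half: "a / 2 \<le> l - q t" using q_le(2)[OF t] la by linarith
        note pp = appell_pos[OF U l tA(1)]
        have "a / 2 * R t \<le> (l - q t) * R t" using half pp by (intro mult_right_mono) auto
        then have aR: "a / 2 * R t \<le> P t + (l - q t) * R t" using pp by linarith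
        moreover have "0 < a / 2 * R t" using a pp by simp
        ultimately show "0 < P t + (l - q t) * R t" by linarith
        have "R t \<le> (P t + (l - q t) * R t) / (a / 2)"
          using aR a by (subst pos_le_divide_eq) (auto simp: mult.commute)
        then have "\<bar>q' t\<bar> * R t \<le> \<bar>q' t\<bar> * ((P t + (l - q t) * R t) / (a / 2))" by (intro mult_left_mono) auto
        moreover have "\<bar>- q' t * R t\<bar> = \<bar>q' t\<bar> * R t" using pp by (simp add: abs_mult)
        ultimately show "\<bar>- q' t * R t\<bar> \<le> g t * (P t + (l - q t) * R t)"
          unfolding g_def by (simp only: times_divide_eq_left times_divide_eq_right)
      next
        show "g integrable_on {x..}"
          by (rule set_lebesgue_integral_eq_integral(1)[OF set_integrable_subset[OF g]]) (use xA in auto)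
        have "((\<lambda>t. P t + (l - q t) * R t) \<longlongrightarrow> sqrt l + (l - 0) * (1 / sqrt l)) at_top"
          using q2 by (intro tendsto_intros D) auto
        moreover have "l * (1 / sqrt l) = sqrt l" using l by (simp add: real_div_sqrt)
        ultimately show "((\<lambda>t. P t + (l - q t) * R t) \<longlongrightarrow> 2 * sqrt l) at_top" by simp
      qed (use l in simp)
      also have "\<dots> \<le> 2 * sqrt l * (1 + \<eta> / 4)"
        using X1 xA l by (intro mult_left_mono) auto
      finally have le: "P x + (l - q x) * R x \<le> 2 * sqrt l * (1 + \<eta> / 4)" .
      have cl: "(1 - \<eta> / 32) * l \<le> l - q x" using q_le(1)[of x] by (simp add: algebra_simps)
      from appell_near_limit[OF U l xA(1) _ \<eta>(2) cl le] \<eta> \<eta>d show ?thesis by auto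
    qed
    then show ?thesis by (intro exI[of _ X]) (auto simp: X_def)
  qed
qed

text \<open>Beyond X the asymptotics bound P + R. Going back to A, Gronwall applies because (P + R)'
  = (l - q - 1) Q and |Q| <= P + R, the case c = 1 of \<open>appell_Q_bound\<close>.\<close>

lemma appell_uniformly_bounded:
  fixes q q' :: "real \<Rightarrow> real"
  assumes q: "q absolutely_integrable_on {X0..} \<or>
      (q' absolutely_integrable_on {X0..} \<and>
       (\<forall>x\<ge>X0. (q has_real_derivative q' x) (at x within {X0..})) \<and> (q \<longlongrightarrow> 0) at_top)"
    and q_cont: "continuous_on {A..} q" and a: "a > 0"
  shows "\<exists>B>0. \<forall>l\<in>{a..b}. \<forall>P Q R x. appell_solution A q l P Q R \<longrightarrow> x \<ge> A \<longrightarrow> P x \<le> B \<and> R x \<le> B"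
proof -
  from appell_uniform_asymptotics[OF q a, of 1 A] obtain X where X: "X \<ge> A"
    and XU: "\<And>l P Q R x. l \<ge> a \<Longrightarrow> appell_solution A q l P Q R \<Longrightarrow> x \<ge> X \<Longrightarrow>
           \<bar>l * (R x)\<^sup>2 - 1\<bar> \<le> 1 \<and> P x \<le> 4 * sqrt l" by auto
  have "bounded (q ` {A..X})"
    by (intro compact_imp_bounded compact_continuous_image continuous_on_subset[OF q_cont]) auto
  then obtain M where M: "M > 0" "\<And>x. x \<in> {A..X} \<Longrightarrow> \<bar>q x\<bar> \<le> M"
    unfolding bounded_pos by auto
  \<comment> \<open>The summands bound P by 4 sqrt l and R by 1 + R^2, where l R^2 <= 2 and l >=
    a.\<close>
  define B0 where "B0 = 4 * sqrt \<bar>b\<bar> + (1 + 2 / a)"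
  define K where "K = \<bar>b\<bar> + 1 + M"
  define B where "B = B0 * exp (K * (X - A))"
  have B0: "B0 > 0" using a by (simp add: B0_def add_nonneg_pos)
  have K: "K > 0" using M by (simp add: K_def)
  have B0_le: "B0 \<le> B" using B0 K X by (simp add: B_def mult_le_cancel_left1)
  have "P x \<le> B \<and> R x \<le> B"
    if lab: "l \<in> {a..b}" and U: "appell_solution A q l P Q R" and x: "x \<ge> A" for l P Q R x
  proof -
    note D = appell_solutionD[OF U]
    have l: "l > 0" "l \<ge> a" "l \<le> \<bar>b\<bar>" using lab a by auto
    have far: "P t + R t \<le> B0" if t: "t \<ge> X" for t
    proof -
      note XUt = XU[OF l(2) U t]
      have "a * (R t)\<^sup>2 \<le> l * (R t)\<^sup>2" using l by (intro mult_right_mono) auto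
      also have "\<dots> \<le> 2" using XUt by linarith
      finally have "(R t)\<^sup>2 \<le> 2 / a" using a by (simp add: pos_le_divide_eq mult.commute)
      moreover have "R t \<le> 1 + (R t)\<^sup>2"
      proof -
        have "0 \<le> (R t - 1)\<^sup>2 + (R t)\<^sup>2 + 1" by simp
        then show ?thesis by (simp add: power2_eq_square algebra_simps)
      qed
      moreover have "P t \<le> 4 * sqrt \<bar>b\<bar>" using XUt l(3) real_sqrt_le_mono[of l "\<bar>b\<bar>"] by linarith
      ultimately show ?thesis unfolding B0_def by linarith
    qed
    have "P x + R x \<le> B"
    proof (cases "x \<ge> X")
      case True then show ?thesis using far B0_le by force
    next
      case False
      have "(P x + R x) * exp (K * x) \<le> (P X + R X) * exp (K * X)"
      proof (rule nondecreasing_from_derivative[where A=A and f="\<lambda>t. (P t + R t) * exp (K * t)"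
            and f'="\<lambda>t. ((l - q t - 1) * Q t + K * (P t + R t)) * exp (K * t)"])
        fix t assume t: "x \<le> t" "t \<le> X"
        then have tA: "t \<ge> A" using x by simp
        show "((\<lambda>t. (P t + R t) * exp (K * t)) has_real_derivative
           ((l - q t - 1) * Q t + K * (P t + R t)) * exp (K * t)) (at t within {A..})"
          using tA by (auto intro!: derivative_eq_intros D simp: algebra_simps)
        have Qt: "\<bar>Q t\<bar> \<le> P t + R t" using appell_Q_bound[OF U l(1) tA, of 1] by simp
        have "\<bar>(l - q t - 1) * Q t\<bar> \<le> K * (P t + R t)"
          unfolding abs_mult
        proof (rule mult_mono)
          show "\<bar>l - q t - 1\<bar> \<le> K" using M(2)[of t] t tA l by (auto simp: K_def)
        qed (use Qt K in auto)
        then show "0 \<le> ((l - q t - 1) * Q t + K * (P t + R t)) * exp (K * t)"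
          by (intro mult_nonneg_nonneg) auto
      qed (use x False in auto)
      also have "\<dots> \<le> B0 * exp (K * X)" using far[of X] by (intro mult_right_mono) auto
      finally have "P x + R x \<le> B0 * exp (K * X) / exp (K * x)" by (simp add: pos_le_divide_eq)
      also have "\<dots> = B0 * exp (K * (X - x))" by (simp add: exp_diff right_diff_distrib)
      also have "\<dots> \<le> B" unfolding B_def using B0 K x by (intro mult_left_mono) auto
      finally show ?thesis .
    qed
    then show ?thesis using appell_pos[OF U l(1) x] by auto
  qed
  then show ?thesis using B0 B0_le by (intro exI[of _ B]) auto
qed

section \<open>Liouville transformation and limit point property\<close>

definition schroedinger_solution ::
  "real \<Rightarrow> (real \<Rightarrow> real) \<Rightarrow> complex \<Rightarrow> (real \<Rightarrow> complex) \<Rightarrow> (real \<Rightarrow> complex) \<Rightarrow> bool" where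
  "schroedinger_solution A q z y y' \<longleftrightarrow>
     (\<forall>x\<ge>A. (y has_vector_derivative y' x) (at x within {A..}) \<and>
            (y' has_vector_derivative (of_real (q x) - z) * y x) (at x within {A..}))"

lemma schroedinger_solutionD:
  assumes "schroedinger_solution A q z y y'"
  shows "\<And>x. x \<ge> A \<Longrightarrow> (y has_vector_derivative y' x) (at x within {A..})"
    "\<And>x. x \<ge> A \<Longrightarrow> (y' has_vector_derivative (of_real (q x) - z) * y x) (at x within {A..})"
    "continuous_on {A..} y" "continuous_on {A..} y'"
proof -
  show *: "(y has_vector_derivative y' x) (at x within {A..})"
    "(y' has_vector_derivative (of_real (q x) - z) * y x) (at x within {A..})" if "x \<ge> A" for x
    using assms that unfolding schroedinger_solution_def by auto
  show "continuous_on {A..} y" "continuous_on {A..} y'"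
    using * by (auto simp: continuous_on_eq_continuous_within intro: has_vector_derivative_continuous)
qed

lemma schroedinger_solution_cnj:
  assumes "schroedinger_solution A q z y y'"
  shows "schroedinger_solution A q (cnj z) (\<lambda>x. cnj (y x)) (\<lambda>x. cnj (y' x))"
  unfolding schroedinger_solution_def
proof (intro allI impI conjI)
  fix x assume x: "x \<ge> A"
  show "((\<lambda>x. cnj (y x)) has_vector_derivative cnj (y' x)) (at x within {A..})"
    by (rule bounded_linear.has_vector_derivative[OF bounded_linear_cnj schroedinger_solutionD(1)[OF assms x]])
  show "((\<lambda>x. cnj (y' x)) has_vector_derivative (of_real (q x) - cnj z) * cnj (y x)) (at x within {A..})"
    using bounded_linear.has_vector_derivative[OF bounded_linear_cnj schroedinger_solutionD(2)[OF assms x]] by simp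
qed

lemma schroedinger_solution_add_scaled:
  assumes "schroedinger_solution A q z y y'" "schroedinger_solution A q z w w'"
  shows "schroedinger_solution A q z (\<lambda>x. y x + c * w x) (\<lambda>x. y' x + c * w' x)"
  unfolding schroedinger_solution_def
  using schroedinger_solutionD(1,2)[OF assms(1)] schroedinger_solutionD(1,2)[OF assms(2)]
  by (auto intro!: derivative_eq_intros simp: algebra_simps)

lemma has_real_derivative_cmod_squared:
  assumes "(f has_vector_derivative f') (at x within S)"
  shows "((\<lambda>x. (cmod (f x))\<^sup>2) has_real_derivative 2 * Re (cnj (f x) * f')) (at x within S)"
proof -
  have "((\<lambda>x. Re (f x)) has_real_derivative Re f') (at x within S)"
    "((\<lambda>x. Im (f x)) has_real_derivative Im f') (at x within S)"
    unfolding has_real_derivative_iff_has_vector_derivative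
    using bounded_linear.has_vector_derivative[OF bounded_linear_Re assms]
      bounded_linear.has_vector_derivative[OF bounded_linear_Im assms] by simp_all
  from DERIV_add[OF DERIV_power[OF this(1), of 2] DERIV_power[OF this(2), of 2]]
  show ?thesis unfolding cmod_power2 by (simp add: algebra_simps)
qed

section \<open>Wronskians, Liouville variables and the limit point property\<close>

definition wronskian ::
  "(real \<Rightarrow> complex) \<Rightarrow> (real \<Rightarrow> complex) \<Rightarrow> (real \<Rightarrow> complex) \<Rightarrow> (real \<Rightarrow> complex) \<Rightarrow> real \<Rightarrow> complex" where
  "wronskian y y' w w' x = y x * w' x - y' x * w x"

lemma wronskian_integral:
  assumes y: "schroedinger_solution A q z1 y y'" and w: "schroedinger_solution A q z2 w w'"
    and b: "A \<le> b"
  shows "((\<lambda>x. (z1 - z2) * (y x * w x)) has_integral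
           wronskian y y' w w' b - wronskian y y' w w' A) {A..b}"
proof (rule fundamental_theorem_of_calculus[OF b])
  fix x assume x: "x \<in> {A..b}"
  have "(wronskian y y' w w' has_vector_derivative (z1 - z2) * (y x * w x)) (at x within {A..})"
    unfolding wronskian_def[abs_def]
    using x by (auto intro!: derivative_eq_intros schroedinger_solutionD(1,2)[OF y] schroedinger_solutionD(1,2)[OF w]
        simp: algebra_simps)
  then show "(wronskian y y' w w' has_vector_derivative (z1 - z2) * (y x * w x)) (at x within {A..b})"
    by (rule has_vector_derivative_within_subset) auto
qed

definition square_integrable_from :: "real \<Rightarrow> (real \<Rightarrow> complex) \<Rightarrow> bool" where
  "square_integrable_from A y \<longleftrightarrow> (\<lambda>x. (cmod (y x))\<^sup>2) integrable_on {A..}"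

lemma square_integrable_product:
  assumes "square_integrable_from A y" "square_integrable_from A w"
    and "continuous_on {A..} y" "continuous_on {A..} w"
  shows "(\<lambda>x. y x * w x) absolutely_integrable_on {A..}"
proof (rule measurable_bounded_by_integrable_imp_absolutely_integrable)
  show "(\<lambda>x. y x * w x) \<in> borel_measurable (lebesgue_on {A..})"
    by (intro continuous_imp_measurable_on_sets_lebesgue continuous_intros assms) auto
  show "(\<lambda>x. (cmod (y x))\<^sup>2 + (cmod (w x))\<^sup>2) integrable_on {A..}"
    using assms unfolding square_integrable_from_def by (intro integrable_add)
  show "cmod (y x * w x) \<le> (cmod (y x))\<^sup>2 + (cmod (w x))\<^sup>2" for x
    using sum_squares_bound[of "cmod (y x)" "cmod (w x)"] zero_le_power2[of "cmod (y x)"]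
      zero_le_power2[of "cmod (w x)"]
    by (simp only: norm_mult)
qed auto

text \<open>\<open>V\<close> is the derivative of \<open>Y\<close> with respect to the phase \<open>\<theta>\<close>, \<open>\<theta>' = 1 / R\<close>, in which the
  equation becomes \<open>Y'' = -(1 + (z - l) R\<^sup>2) Y\<close>,
  free of \<open>q\<close>.\<close>

definition liouville_Y :: "(real \<Rightarrow> real) \<Rightarrow> (real \<Rightarrow> complex) \<Rightarrow> real \<Rightarrow> complex" where
  "liouville_Y R y x = of_real (1 / sqrt (R x)) * y x"

definition liouville_V ::
  "(real \<Rightarrow> real) \<Rightarrow> (real \<Rightarrow> real) \<Rightarrow> (real \<Rightarrow> complex) \<Rightarrow> (real \<Rightarrow> complex) \<Rightarrow> real \<Rightarrow> complex" where
  "liouville_V Q R y y' x = of_real (sqrt (R x)) * y' x + of_real (Q x / (2 * sqrt (R x))) * y x"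

text \<open>In the derivative of V the potential from sqrt R times the second derivative of y
  cancels the one from the derivative of Q, and P is eliminated by the invariant. What remains
  depends on R and z - l only.\<close>

lemma liouville_derivatives:
  assumes U: "appell_solution A q l P Q R" and l: "l > 0"
    and y: "schroedinger_solution A q z y y'" and x: "x \<ge> A"
  shows "(liouville_Y R y has_vector_derivative of_real (1 / R x) * liouville_V Q R y y' x) (at x within {A..})"
    and "(liouville_V Q R y y' has_vector_derivative
            - (of_real (1 / R x) * ((1 + (z - of_real l) * of_real ((R x)\<^sup>2)) * liouville_Y R y x))) (at x within {A..})"
proof -
  note D = appell_solutionD[OF U] and Dy = schroedinger_solutionD[OF y]
  define s where "s = sqrt (R x)"
  have R: "R x > 0" using appell_pos[OF U l x] by simp
  then have s: "s > 0" "R x = s * s" by (simp_all add: s_def)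
  have inv: "Q x * Q x = 4 * P x * (s * s) - 4"
    using appell_invariant[OF U l x] s by (simp add: power2_eq_square)
  have d1: "((\<lambda>x. 1 / sqrt (R x)) has_real_derivative Q x / (2 * s * s * s)) (at x within {A..})"
    using D(3)[OF x] R s
    by (auto intro!: derivative_eq_intros simp: s_def[symmetric] field_simps)
  have d2: "((\<lambda>x. sqrt (R x)) has_real_derivative - Q x / (2 * s)) (at x within {A..})"
    using D(3)[OF x] R s
    by (auto intro!: derivative_eq_intros simp: s_def[symmetric] field_simps)
  have d3: "((\<lambda>x. Q x / (2 * sqrt (R x))) has_real_derivative (l - q x) * s - 1 / (s * s * s)) (at x within {A..})"
  proof -
    have "((\<lambda>x. Q x * (1 / sqrt (R x)) / 2) has_real_derivative
        ((- 2 * P x + 2 * (l - q x) * R x) * (1 / s) + Q x / (2 * s * s * s) * Q x) / 2) (at x within {A..})"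
      using DERIV_cdivide[OF DERIV_mult[OF D(2)[OF x] d1], of 2] by (simp only: s_def[symmetric])
    moreover have "((- 2 * P x + 2 * (l - q x) * R x) * (1 / s) + Q x / (2 * s * s * s) * Q x) / 2 =
        (l - q x) * s - 1 / (s * s * s)"
      using s(1) by (simp add: s(2) inv divide_simps) (simp add: inv algebra_simps)
    moreover have "(\<lambda>x. Q x * (1 / sqrt (R x)) / 2) = (\<lambda>x. Q x / (2 * sqrt (R x)))"
      by (simp add: fun_eq_iff)
    ultimately show ?thesis by (simp only:)
  qed
  have Rc: "complex_of_real (R x) = of_real s * of_real s" and sc: "complex_of_real s \<noteq> 0"
    using s by auto
  show "(liouville_Y R y has_vector_derivative of_real (1 / R x) * liouville_V Q R y y' x) (at x within {A..})"
    unfolding liouville_Y_def[abs_def] liouville_V_def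
    using has_vector_derivative_mult[OF has_vector_derivative_of_real[OF d1] Dy(1)[OF x]]
    by (rule has_vector_derivative_eq_rhs)
       (use sc in \<open>simp add: s_def[symmetric] Rc field_simps\<close>)
  have "((\<lambda>x. of_real (sqrt (R x)) * y' x + of_real (Q x / (2 * sqrt (R x))) * y x) has_vector_derivative
     (of_real (sqrt (R x)) * ((of_real (q x) - z) * y x) + of_real (- Q x / (2 * s)) * y' x) +
     (of_real (Q x / (2 * sqrt (R x))) * y' x + of_real ((l - q x) * s - 1 / (s * s * s)) * y x)) (at x within {A..})"
    by (intro has_vector_derivative_add has_vector_derivative_mult has_vector_derivative_of_real d2 d3 Dy x)
  then show "(liouville_V Q R y y' has_vector_derivative
            - (of_real (1 / R x) * ((1 + (z - of_real l) * of_real ((R x)\<^sup>2)) * liouville_Y R y x))) (at x within {A..})"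
    unfolding liouville_Y_def liouville_V_def[abs_def]
    by (rule has_vector_derivative_eq_rhs)
       (use sc in \<open>simp add: s_def[symmetric] Rc divide_simps power2_eq_square, simp add: algebra_simps\<close>)
qed

text \<open>The passage from (y, y') to (Y, V) has determinant 1.\<close>

lemma liouville_wronskian:
  assumes "R x > 0"
  shows "wronskian y y' w w' x =
    liouville_Y R y x * liouville_V Q R w w' x - liouville_V Q R y y' x * liouville_Y R w x"
proof -
  define s where "s = sqrt (R x)"
  have "complex_of_real s \<noteq> 0" using assms by (simp add: s_def)
  then show ?thesis
    unfolding wronskian_def liouville_Y_def liouville_V_def s_def[symmetric]
    by (simp add: field_simps)
qed

text \<open>The oscillator energy for Y'' = -Y in the phase variable. It is conserved at z = l, so
  its growth is driven by z - l alone.\<close>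

definition liouville_energy ::
  "(real \<Rightarrow> real) \<Rightarrow> (real \<Rightarrow> real) \<Rightarrow> (real \<Rightarrow> complex) \<Rightarrow> (real \<Rightarrow> complex) \<Rightarrow> real \<Rightarrow> real" where
  "liouville_energy Q R y y' x = (cmod (liouville_V Q R y y' x))\<^sup>2 + (cmod (liouville_Y R y x))\<^sup>2"

lemma liouville_energy_derivative:
  assumes U: "appell_solution A q l P Q R" and l: "l > 0"
    and y: "schroedinger_solution A q z y y'" and x: "x \<ge> A"
  shows "(liouville_energy Q R y y' has_real_derivative
     - 2 * R x * Re ((z - of_real l) * (cnj (liouville_V Q R y y' x) * liouville_Y R y x))) (at x within {A..})"
proof -
  note L = liouville_derivatives[OF U l y x]
  have R: "R x > 0" using appell_pos[OF U l x] by simp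
  define r where "r = complex_of_real (R x)"
  define V where "V = liouville_V Q R y y' x"
  define Y where "Y = liouville_Y R y x"
  define \<eta> where "\<eta> = z - of_real l"
  have h1: "(liouville_energy Q R y y' has_real_derivative
      2 * Re (cnj V * - (of_real (1 / R x) * ((1 + \<eta> * of_real ((R x)\<^sup>2)) * Y))) + 2 * Re (cnj Y * (of_real (1 / R x) * V)))
      (at x within {A..})"
    unfolding liouville_energy_def[abs_def] V_def Y_def \<eta>_def
    by (intro DERIV_add has_real_derivative_cmod_squared L)
  have h2: "Re (cnj V * - (of_real (1 / R x) * ((1 + \<eta> * of_real ((R x)\<^sup>2)) * Y)))
      = - (1 / R x) * Re (cnj V * Y) - R x * Re (\<eta> * (cnj V * Y))"
  proof -
    have "cnj V * - (of_real (1 / R x) * ((1 + \<eta> * of_real ((R x)\<^sup>2)) * Y)) =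
        of_real (- (1 / R x)) * (cnj V * Y) - of_real (R x) * (\<eta> * (cnj V * Y))"
      using R by (simp add: power2_eq_square field_simps)
    then show ?thesis by (simp only:) (simp add: add_divide_distrib)
  qed
  have h3: "Re (cnj Y * (of_real (1 / R x) * V)) = 1 / R x * Re (cnj V * Y)"
    by (simp add: algebra_simps add_divide_distrib)
  have "2 * Re (cnj V * - (of_real (1 / R x) * ((1 + \<eta> * of_real ((R x)\<^sup>2)) * Y))) + 2 * Re (cnj Y * (of_real (1 / R x) * V))
      = - 2 * R x * Re (\<eta> * (cnj V * Y))"
  proof -
    have "2 * (- (1 / r) * a - r * b) + 2 * (1 / r * a) = - 2 * r * b" for r a b :: real
      by (simp add: algebra_simps)
    then show ?thesis unfolding h2 h3 .
  qed
  with h1 show ?thesis unfolding V_def Y_def \<eta>_def by (simp only:)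
qed

text \<open>The root of the energy grows at a rate at most proportional to |y|. For square
  integrable y the integral of |y| up to T is of the order of sqrt(1 + T - A) by Cauchy-Schwarz, so
  the energy itself grows at most linearly.\<close>

lemma liouville_energy_growth:
  assumes U: "appell_solution A q l P Q R" and l: "l > 0"
    and B: "\<And>x. x \<ge> A \<Longrightarrow> R x \<le> B"
    and y: "schroedinger_solution A q z y y'" and L2: "square_integrable_from A y"
  shows "\<exists>C>0. \<forall>x\<ge>A. liouville_energy Q R y y' x \<le> C * (1 + (x - A))"
proof -
  define E where "E = liouville_energy Q R y y'"
  define V where "V = liouville_V Q R y y'"
  define Y where "Y = liouville_Y R y"
  define E' where "E' = (\<lambda>x. - 2 * R x * Re ((z - of_real l) * (cnj (V x) * Y x)))"
  define c where "c = cmod (z - of_real l) * sqrt B"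
  define I where "I = integral {A..} (\<lambda>x. (cmod (y x))\<^sup>2)"
  have R: "R x > 0" if "x \<ge> A" for x using appell_pos[OF U l that] by simp
  have Bpos: "B > 0" using R[of A] B[of A] by simp
  have c: "c \<ge> 0" using Bpos by (simp add: c_def)
  have I: "I \<ge> 0" unfolding I_def using L2 by (intro integral_nonneg) (auto simp: square_integrable_from_def)
  have E0: "E x \<ge> 0" for x by (simp add: E_def liouville_energy_def)
  \<comment> \<open>The added 1 keeps the square root differentiable where the energy vanishes. One
    factor sqrt R is absorbed by sqrt R |Y| = |y|, the other is bounded by sqrt B.\<close>
  have f_le: "E' x / (2 * sqrt (E x + 1)) \<le> c * cmod (y x)" if x: "x \<ge> A" for x
  proof -
    have "(cmod (V x))\<^sup>2 \<le> E x + 1"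
      by (simp add: E_def liouville_energy_def V_def)
    then have V: "cmod (V x) \<le> sqrt (E x + 1)" by (rule real_le_rsqrt)
    have "R x * cmod (Y x) = sqrt (R x) * (sqrt (R x) * cmod (Y x))"
      using R[OF x] by (simp add: mult.assoc[symmetric])
    also have "\<dots> = sqrt (R x) * cmod (y x)"
      using R[OF x] by (simp add: Y_def liouville_Y_def norm_mult norm_divide)
    also have "\<dots> \<le> sqrt B * cmod (y x)" using B[OF x] by (intro mult_right_mono) auto
    finally have RY: "R x * cmod (Y x) \<le> sqrt B * cmod (y x)" .
    have "E' x \<le> 2 * (cmod (z - of_real l) * (cmod (V x) * (R x * cmod (Y x))))"
    proof -
      define t where "t = (z - of_real l) * (cnj (V x) * Y x)"
      have "- Re t \<le> cmod t" using abs_Re_le_cmod[of t] by linarith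
      then have "2 * R x * - Re t \<le> 2 * R x * cmod t"
        using R[OF x] by (intro mult_left_mono) auto
      moreover have "E' x = 2 * R x * - Re t" unfolding E'_def t_def[symmetric] by simp
      moreover have "cmod t = cmod (z - of_real l) * (cmod (V x) * cmod (Y x))"
        by (simp add: t_def norm_mult)
      ultimately show ?thesis by (simp only: mult_ac)
    qed
    also have "\<dots> \<le> 2 * (cmod (z - of_real l) * (sqrt (E x + 1) * (sqrt B * cmod (y x))))"
      by (rule mult_left_mono[OF mult_left_mono[OF mult_mono[OF V RY]]]) (use R[OF x] E0[of x] in auto)
    finally show ?thesis
      using E0[of x] by (simp add: c_def pos_divide_le_eq mult_ac)
  qed
  have main: "E T \<le> (sqrt (E A + 1) + c / 2 * (I + 1))\<^sup>2 * (1 + (T - A))" if T: "T \<ge> A" for T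
  proof -
    \<comment> \<open>The weight balances 2 |y| <= \<tau> |y|^2 + 1/\<tau>: integrated up to T, both
      terms are of order \<tau>.\<close>
    define \<tau> where "\<tau> = sqrt (1 + (T - A))"
    have \<tau>: "\<tau> \<ge> 1" "\<tau>\<^sup>2 = 1 + (T - A)" using T by (simp_all add: \<tau>_def)
    have "((\<lambda>x. E' x / (2 * sqrt (E x + 1))) has_integral sqrt (E T + 1) - sqrt (E A + 1)) {A..T}"
    proof (rule fundamental_theorem_of_calculus[OF T])
      fix x assume x: "x \<in> {A..T}"
      have "(E has_real_derivative E' x) (at x within {A..})"
        using liouville_energy_derivative[OF U l y] x by (simp add: E_def E'_def V_def Y_def)
      then have "((\<lambda>x. sqrt (E x + 1)) has_real_derivative E' x / (2 * sqrt (E x + 1))) (at x within {A..})"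
        using E0[of x] by (auto intro!: derivative_eq_intros simp: field_simps)
      then show "((\<lambda>x. sqrt (E x + 1)) has_vector_derivative E' x / (2 * sqrt (E x + 1))) (at x within {A..T})"
        unfolding has_real_derivative_iff_has_vector_derivative
        by (rule has_vector_derivative_within_subset) auto
    qed
    moreover have int: "(\<lambda>x. (cmod (y x))\<^sup>2) integrable_on {A..T}"
      using L2 unfolding square_integrable_from_def by (rule integrable_on_subinterval) auto
    have "((\<lambda>x. c / 2 * (\<tau> * (cmod (y x))\<^sup>2 + 1 / \<tau>)) has_integral
        c / 2 * (\<tau> * integral {A..T} (\<lambda>x. (cmod (y x))\<^sup>2) + (T - A) * (1 / \<tau>))) {A..T}"
      using has_integral_const_real[of "1 / \<tau>" A T] T
      by (intro has_integral_mult_right has_integral_add integrable_integral[OF int]) simp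
    ultimately have "sqrt (E T + 1) - sqrt (E A + 1) \<le>
        c / 2 * (\<tau> * integral {A..T} (\<lambda>x. (cmod (y x))\<^sup>2) + (T - A) * (1 / \<tau>))"
    proof (rule has_integral_le)
      fix x assume x: "x \<in> {A..T}"
      have "2 * cmod (y x) \<le> \<tau> * (cmod (y x))\<^sup>2 + 1 / \<tau>"
      proof -
        have "0 \<le> (\<tau> * cmod (y x) - 1)\<^sup>2 / \<tau>" using \<tau> by simp
        also have "\<dots> = \<tau> * (cmod (y x))\<^sup>2 + 1 / \<tau> - 2 * cmod (y x)"
          using \<tau>(1) by (simp add: power2_eq_square field_simps)
        finally show ?thesis by linarith
      qed
      from mult_left_mono[OF this c] show "E' x / (2 * sqrt (E x + 1)) \<le> c / 2 * (\<tau> * (cmod (y x))\<^sup>2 + 1 / \<tau>)"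
        using f_le[of x] x by simp
    qed
    also have "\<dots> \<le> c / 2 * (\<tau> * I + \<tau>)"
    proof (intro mult_left_mono add_mono)
      show "integral {A..T} (\<lambda>x. (cmod (y x))\<^sup>2) \<le> I"
        unfolding I_def using L2 by (intro integral_subset_le int) (auto simp: square_integrable_from_def)
      have "T - A \<le> \<tau> * \<tau>" using \<tau> by (simp add: power2_eq_square)
      then show "(T - A) * (1 / \<tau>) \<le> \<tau>" using \<tau> by (simp add: pos_divide_le_eq)
    qed (use \<tau> c in auto)
    also have "c / 2 * (\<tau> * I + \<tau>) = c / 2 * (I + 1) * \<tau>" by (simp add: distrib_left distrib_right mult_ac)
    finally have "sqrt (E T + 1) \<le> sqrt (E A + 1) * 1 + c / 2 * (I + 1) * \<tau>"
      by simp
    also have "\<dots> \<le> sqrt (E A + 1) * \<tau> + c / 2 * (I + 1) * \<tau>"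
      using \<tau> E0[of A] by (intro add_right_mono mult_left_mono) auto
    finally have "sqrt (E T + 1) \<le> (sqrt (E A + 1) + c / 2 * (I + 1)) * \<tau>"
      by (simp add: algebra_simps)
    then have "(sqrt (E T + 1))\<^sup>2 \<le> ((sqrt (E A + 1) + c / 2 * (I + 1)) * \<tau>)\<^sup>2"
      using E0[of T] by (intro power_mono) auto
    then show ?thesis using E0[of T] \<tau> by (simp add: power_mult_distrib)
  qed
  have "sqrt (E A + 1) + c / 2 * (I + 1) > 0"
    using E0[of A] c I by (intro add_pos_nonneg) auto
  then show ?thesis
    using main unfolding E_def by (intro exI[of _ "(sqrt (E A + 1) + c / 2 * (I + 1))\<^sup>2"]) (auto simp: E_def)
qed

text \<open>Otherwise an integrable function would dominate c / (1 + x - A), whose integral diverges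
  logarithmically. This is exactly the borderline that linear energy growth requires.\<close>

lemma square_integrable_not_harmonic:
  assumes L2: "square_integrable_from A y" "square_integrable_from A w" and c: "c > 0" and X: "X \<ge> A"
  shows "\<exists>x\<ge>X. (cmod (y x))\<^sup>2 + (cmod (w x))\<^sup>2 < c / (1 + (x - A))"
proof (rule ccontr)
  assume "\<not> ?thesis"
  then have le: "c / (1 + (x - A)) \<le> (cmod (y x))\<^sup>2 + (cmod (w x))\<^sup>2" if "x \<ge> X" for x
    using that by (meson not_le)
  define f where "f = (\<lambda>x. (cmod (y x))\<^sup>2 + (cmod (w x))\<^sup>2)"
  have f: "f integrable_on {A..}"
    using L2 unfolding f_def square_integrable_from_def by (intro integrable_add)
  define J where "J = integral {A..} f"
  have "c * ln (1 + (T - A)) \<le> c * ln (1 + (X - A)) + J" if T: "T \<ge> X" for T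
  proof -
    have "((\<lambda>x. c / (1 + (x - A))) has_integral c * ln (1 + (T - A)) - c * ln (1 + (X - A))) {X..T}"
    proof (rule fundamental_theorem_of_calculus[OF T])
      fix x assume "x \<in> {X..T}"
      then have "((\<lambda>x. c * ln (1 + (x - A))) has_real_derivative c / (1 + (x - A))) (at x within {X..T})"
        using X by (auto intro!: derivative_eq_intros simp: field_simps)
      then show "((\<lambda>x. c * ln (1 + (x - A))) has_vector_derivative c / (1 + (x - A))) (at x within {X..T})"
        by (simp add: has_real_derivative_iff_has_vector_derivative)
    qed
    moreover have fi: "f integrable_on {X..T}" by (rule integrable_on_subinterval[OF f]) (use X in auto)
    have "(f has_integral integral {X..T} f) {X..T}" by (rule integrable_integral[OF fi])
    ultimately have "c * ln (1 + (T - A)) - c * ln (1 + (X - A)) \<le> integral {X..T} f"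
      by (rule has_integral_le) (use le in \<open>auto simp: f_def\<close>)
    also have "\<dots> \<le> J"
      unfolding J_def by (rule integral_subset_le) (use X f fi in \<open>auto simp: f_def\<close>)
    finally show ?thesis by simp
  qed
  then have bd: "ln (1 + (T - A)) \<le> (c * ln (1 + (X - A)) + J) / c" if "T \<ge> X" for T
    using that c by (simp add: pos_le_divide_eq mult.commute)
  have "filterlim (\<lambda>T. ln (1 + (T - A))) at_top at_top" by real_asymp
  then have "\<forall>\<^sub>F T in at_top. ln (1 + (T - A)) > (c * ln (1 + (X - A)) + J) / c"
    by (simp add: filterlim_at_top_dense)
  from eventually_happens[OF eventually_conj[OF this eventually_ge_at_top[of X]]]
  obtain T where "T \<ge> X" "ln (1 + (T - A)) > (c * ln (1 + (X - A)) + J) / c"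
    by auto
  with bd[of T] show False by linarith
qed

text \<open>In Liouville variables each product in the Wronskian has one factor V, whose square
  grows at most linearly, and one factor Y, whose square is at most B times |y|^2 or |w|^2 because 1
  / R <= P <= B. At suitable points arbitrarily far out the linear growth is beaten.\<close>

lemma wronskian_not_bounded_below:
  assumes U: "appell_solution A q l P Q R" and l: "l > 0"
    and B: "\<And>x. x \<ge> A \<Longrightarrow> R x \<le> B" "\<And>x. x \<ge> A \<Longrightarrow> P x \<le> B"
    and y: "schroedinger_solution A q z1 y y'" "square_integrable_from A y"
    and w: "schroedinger_solution A q z2 w w'" "square_integrable_from A w"
    and c: "c > 0" and X: "X \<ge> A"
  shows "\<exists>x\<ge>X. cmod (wronskian y y' w w' x) < c"
proof -
  obtain C1 where C1: "C1 > 0" "\<And>x. x \<ge> A \<Longrightarrow> liouville_energy Q R y y' x \<le> C1 * (1 + (x - A))"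
    using liouville_energy_growth[OF U l B(1) y(1) y(2)] by auto
  obtain C2 where C2: "C2 > 0" "\<And>x. x \<ge> A \<Longrightarrow> liouville_energy Q R w w' x \<le> C2 * (1 + (x - A))"
    using liouville_energy_growth[OF U l B(1) w(1) w(2)] by auto
  define C where "C = C1 + C2"
  have C: "C > 0" using C1 C2 by (simp add: C_def)
  have R: "R x > 0" if "x \<ge> A" for x using appell_pos[OF U l that] by simp
  have Bpos: "B > 0" using R[of A] B[of A] by simp
  have Ybd: "(cmod (liouville_Y R f x))\<^sup>2 \<le> B * (cmod (f x))\<^sup>2" if "x \<ge> A" for x f
  proof -
    have "(cmod (liouville_Y R f x))\<^sup>2 = 1 / R x * (cmod (f x))\<^sup>2"
      using R[OF that] by (simp add: liouville_Y_def norm_mult power_mult_distrib norm_divide power_divide)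
    also have "\<dots> \<le> B * (cmod (f x))\<^sup>2"
      using appell_inverse_le[OF U l that] B(2)[OF that] by (intro mult_right_mono) auto
    finally show ?thesis .
  qed
  have W: "(cmod (wronskian y y' w w' x))\<^sup>2 \<le> 2 * (C * (1 + (x - A))) * (B * ((cmod (y x))\<^sup>2 + (cmod (w x))\<^sup>2))"
    if x: "x \<ge> A" for x
  proof -
    define Yy where "Yy = cmod (liouville_Y R y x)"
    define Yw where "Yw = cmod (liouville_Y R w x)"
    define Vy where "Vy = cmod (liouville_V Q R y y' x)"
    define Vw where "Vw = cmod (liouville_V Q R w w' x)"
    have nn: "0 \<le> C1 * (1 + (x - A))" "0 \<le> C2 * (1 + (x - A))" using C1 C2 x by auto
    have "Vy\<^sup>2 \<le> C1 * (1 + (x - A))" "Vw\<^sup>2 \<le> C2 * (1 + (x - A))"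
      using C1(2)[OF x] C2(2)[OF x] unfolding liouville_energy_def Vy_def Vw_def
      by (smt (verit) zero_le_power2)+
    then have V: "Vy\<^sup>2 \<le> C * (1 + (x - A))" "Vw\<^sup>2 \<le> C * (1 + (x - A))"
      using nn by (simp_all add: C_def distrib_right)
    have "cmod (wronskian y y' w w' x) \<le> Yy * Vw + Vy * Yw"
      unfolding liouville_wronskian[where R=R and Q=Q, OF R[OF x]] Yy_def Yw_def Vy_def Vw_def
      by (rule order_trans[OF norm_triangle_ineq4]) (simp add: norm_mult)
    then have "(cmod (wronskian y y' w w' x))\<^sup>2 \<le> (Yy * Vw + Vy * Yw)\<^sup>2"
      by (intro power_mono) auto
    also have "\<dots> \<le> 2 * (Vw\<^sup>2 * Yy\<^sup>2 + Vy\<^sup>2 * Yw\<^sup>2)"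
    proof -
      have "0 \<le> (Yy * Vw - Vy * Yw)\<^sup>2" by simp
      then show ?thesis by (simp add: power2_eq_square algebra_simps)
    qed
    also have "\<dots> \<le> 2 * (C * (1 + (x - A)) * (B * (cmod (y x))\<^sup>2) + C * (1 + (x - A)) * (B * (cmod (w x))\<^sup>2))"
      using V Ybd[OF x, of y] Ybd[OF x, of w] C x unfolding Yy_def Yw_def
      by (intro mult_left_mono add_mono mult_mono) auto
    finally show ?thesis by (simp add: algebra_simps)
  qed
  define \<kappa> where "\<kappa> = c\<^sup>2 / (2 * C * B)"
  have "\<kappa> > 0" using c C Bpos by (simp add: \<kappa>_def)
  from square_integrable_not_harmonic[OF y(2) w(2) this X]
  obtain x where x: "x \<ge> X" "(cmod (y x))\<^sup>2 + (cmod (w x))\<^sup>2 < \<kappa> / (1 + (x - A))" by blast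
  have xA: "x \<ge> A" using x X by simp
  have "(cmod (wronskian y y' w w' x))\<^sup>2 \<le> 2 * (C * (1 + (x - A))) * (B * ((cmod (y x))\<^sup>2 + (cmod (w x))\<^sup>2))"
    by (rule W[OF xA])
  also have "\<dots> < 2 * (C * (1 + (x - A))) * (B * (\<kappa> / (1 + (x - A))))"
    using x C Bpos xA by (intro mult_strict_left_mono) auto
  also have "\<dots> = 2 * C * B * \<kappa>" using xA by simp
  also have "\<dots> = c\<^sup>2" using C Bpos by (simp add: \<kappa>_def field_simps)
  finally have "cmod (wronskian y y' w w' x) < c"
    by (rule power_less_imp_less_base) (use c in simp)
  with x show ?thesis by blast
qed

text \<open>The Wronskian has a limit at infinity because the product y w is integrable, and by the
  preceding lemma that limit can only be 0. For equal spectral parameters the Wronskian at A itself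
  must therefore vanish.\<close>

lemma wronskian_identity:
  assumes U: "appell_solution A q l P Q R" and l: "l > 0"
    and B: "\<And>x. x \<ge> A \<Longrightarrow> R x \<le> B" "\<And>x. x \<ge> A \<Longrightarrow> P x \<le> B"
    and y: "schroedinger_solution A q z1 y y'" "square_integrable_from A y"
    and w: "schroedinger_solution A q z2 w w'" "square_integrable_from A w"
  shows "(z1 - z2) * integral {A..} (\<lambda>x. y x * w x) = - wronskian y y' w w' A"
proof -
  let ?W = "wronskian y y' w w'"
  have ai: "(\<lambda>x. y x * w x) absolutely_integrable_on {A..}"
    by (rule square_integrable_product[OF y(2) w(2)]) (use schroedinger_solutionD y w in auto)
  have W: "?W b = ?W A + (z1 - z2) * integral {A..b} (\<lambda>x. y x * w x)" if "b \<ge> A" for b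
  proof -
    have "?W b - ?W A = (z1 - z2) * integral {A..b} (\<lambda>x. y x * w x)"
      using integral_unique[OF wronskian_integral[OF y(1) w(1) that]] by simp
    then show ?thesis by (simp only: diff_eq_eq add.commute)
  qed
  define Wlim where "Wlim = ?W A + (z1 - z2) * integral {A..} (\<lambda>x. y x * w x)"
  have "((\<lambda>b. ?W A + (z1 - z2) * integral {A..b} (\<lambda>x. y x * w x)) \<longlongrightarrow> Wlim) at_top"
    unfolding Wlim_def by (intro tendsto_intros integral_tendsto_at_top ai)
  then have lim: "(?W \<longlongrightarrow> Wlim) at_top"
    by (rule Lim_transform_eventually)
       (rule eventually_mono[OF eventually_ge_at_top[of A]], rule W[symmetric])
  have "Wlim = 0"
  proof (rule ccontr)
    assume ne: "Wlim \<noteq> 0"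
    have "\<forall>\<^sub>F x in at_top. cmod Wlim / 2 < cmod (?W x)"
      by (rule order_tendstoD(1)[OF tendsto_norm[OF lim]]) (use ne in simp)
    then obtain X where X: "\<And>x. x \<ge> X \<Longrightarrow> cmod Wlim / 2 < cmod (?W x)"
      by (auto simp: eventually_at_top_linorder)
    have "\<exists>x\<ge>max A X. cmod (?W x) < cmod Wlim / 2"
      by (rule wronskian_not_bounded_below[OF U l B y w]) (use ne in auto)
    then show False using X by force
  qed
  then show ?thesis unfolding Wlim_def by (simp add: eq_neg_iff_add_eq_0 add.commute)
qed

section \<open>Square integrable solutions near the real axis\<close>

lemma csqrt_near_one:
  fixes \<delta> :: real
  assumes \<delta>: "0 < \<delta>" "\<delta> \<le> 1"
  defines "k \<equiv> csqrt (1 + \<i> * of_real \<delta>)"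
  shows "k\<^sup>2 = 1 + \<i> * of_real \<delta>" "1 \<le> cmod k" "(cmod k)\<^sup>2 \<le> 2" "\<delta> / 4 \<le> Im k" "cmod (k - 1) \<le> \<delta>"
proof -
  show k2: "k\<^sup>2 = 1 + \<i> * of_real \<delta>" by (simp add: k_def)
  have n: "(cmod k)\<^sup>2 = cmod (1 + \<i> * of_real \<delta>)" by (simp add: k2[symmetric] norm_power)
  have "1 \<le> cmod (1 + \<i> * of_real \<delta>)" using complex_Re_le_cmod[of "1 + \<i> * of_real \<delta>"] by simp
  then have "1\<^sup>2 \<le> (cmod k)\<^sup>2" by (simp add: n)
  then show "1 \<le> cmod k" by (rule power2_le_imp_le) simp
  have "cmod (1 + \<i> * of_real \<delta>) \<le> 1 + \<delta>"
    by (rule order_trans[OF norm_triangle_ineq]) (use \<delta> in \<open>simp add: norm_mult\<close>)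
  then show le2: "(cmod k)\<^sup>2 \<le> 2" using \<delta> by (simp add: n)
  then have "(cmod k)\<^sup>2 \<le> 2\<^sup>2" by simp
  then have "cmod k \<le> 2" by (rule power2_le_imp_le) simp
  then have Re2: "Re k \<le> 2" using complex_Re_le_cmod[of k] by linarith
  have Re0: "Re k \<ge> 0" unfolding k_def using csqrt_principal[of "1 + \<i> * of_real \<delta>"] by auto
  have "Im (k\<^sup>2) = 2 * (Re k * Im k)" by (simp add: power2_eq_square)
  then have prod: "2 * (Re k * Im k) = \<delta>" by (simp add: k2)
  then have "Re k \<noteq> 0" using \<delta> by auto
  then have Re: "Re k > 0" using Re0 by simp
  have "0 < Re k * Im k" using prod \<delta> by linarith
  then have Im: "Im k > 0" using Re by (simp add: zero_less_mult_iff)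
  have "Re k * Im k \<le> 2 * Im k" using Re2 Im by (intro mult_right_mono) auto
  then show "\<delta> / 4 \<le> Im k" using prod by linarith
  have "cmod (k - 1) * 1 \<le> cmod (k - 1) * cmod (k + 1)"
    using complex_Re_le_cmod[of "k + 1"] Re by (intro mult_left_mono) auto
  also have "\<dots> = cmod ((k - 1) * (k + 1))" by (simp add: norm_mult)
  also have "(k - 1) * (k + 1) = k\<^sup>2 - 1" by (simp add: power2_eq_square algebra_simps)
  also have "cmod (k\<^sup>2 - 1) = \<delta>" using \<delta> by (simp add: k2 norm_mult)
  finally show "cmod (k - 1) \<le> \<delta>" by simp
qed

text \<open>The right-hand side is the damage done by the coupling a Y to the growth of |p|^2 - d^2
  |s|^2. It is kept within half of the free gain, which is 2 \<kappa> times the sum on the left. The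
  cross term |p| |s| costs a factor 1/d against that sum, which is why a must be small relative to
  d.\<close>

lemma riccati_form_bound:
  fixes p s Y a k :: complex and d :: real
  assumes d: "0 < d" "d \<le> 1" and a: "cmod a \<le> d * \<kappa> / 2"
    and Y: "2 * cmod Y \<le> cmod p + cmod s"
  shows "\<kappa> * ((cmod p)\<^sup>2 + d\<^sup>2 * (cmod s)\<^sup>2) \<ge> - 2 * Re (cnj p * (a * Y)) + d\<^sup>2 * (2 * Re (cnj s * (a * Y)))"
proof -
  define x y where "x = cmod p" and "y = cmod s"
  have xy: "x \<ge> 0" "y \<ge> 0" by (simp_all add: x_def y_def)
  define S where "S = x\<^sup>2 + d\<^sup>2 * y\<^sup>2"
  have "- Re (cnj p * (a * Y)) \<le> x * (cmod a * cmod Y)"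
    using abs_Re_le_cmod[of "cnj p * (a * Y)"] by (simp add: norm_mult x_def)
  moreover have "Re (cnj s * (a * Y)) \<le> y * (cmod a * cmod Y)"
    using abs_Re_le_cmod[of "cnj s * (a * Y)"] by (simp add: norm_mult y_def)
  then have "d\<^sup>2 * Re (cnj s * (a * Y)) \<le> d\<^sup>2 * (y * (cmod a * cmod Y))"
    by (intro mult_left_mono) auto
  ultimately have "- 2 * Re (cnj p * (a * Y)) + d\<^sup>2 * (2 * Re (cnj s * (a * Y))) \<le>
      cmod a * ((2 * cmod Y) * (x + d\<^sup>2 * y))"
    by (simp add: algebra_simps)
  also have "\<dots> \<le> cmod a * ((x + y) * (x + d\<^sup>2 * y))"
    using Y xy by (intro mult_left_mono mult_right_mono) (auto simp: x_def y_def)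
  also have "\<dots> \<le> cmod a * (2 / d * S)"
  proof (rule mult_left_mono)
    have d2: "d\<^sup>2 \<le> 1" using d by (simp add: power_le_one)
    have "0 \<le> (x - d * y)\<^sup>2" by simp
    then have "2 * (d * (x * y)) \<le> S" by (simp add: S_def power2_eq_square algebra_simps)
    then have xy_le: "2 * (x * y) \<le> S / d" using d by (simp add: pos_le_divide_eq mult_ac)
    have "(x + y) * (x + d\<^sup>2 * y) = S + (1 + d\<^sup>2) * (x * y)"
      by (simp add: S_def power2_eq_square algebra_simps)
    also have "\<dots> \<le> S + 2 * (x * y)" using d2 xy by (intro add_left_mono mult_right_mono) auto
    also have "\<dots> \<le> S / d + S / d"
    proof -
      have "S \<le> S / d" using d by (simp add: S_def pos_le_divide_eq mult_left_le)
      then show ?thesis using xy_le by linarith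
    qed
    finally show "(x + y) * (x + d\<^sup>2 * y) \<le> 2 / d * S" by simp
  qed simp
  also have "\<dots> \<le> (d * \<kappa> / 2) * (2 / d * S)"
    using a d by (intro mult_right_mono) (auto simp: S_def)
  also have "\<dots> = \<kappa> * S" using d by simp
  finally show ?thesis by (simp add: S_def x_def y_def)
qed

text \<open>With respect to the frozen wave number \<open>k\<close>, \<open>p\<close> is the incoming and \<open>s\<close> the outgoing
  component. A solution with \<open>|p| > d |s|\<close> at one point would grow exponentially.\<close>

lemma square_integrable_is_outgoing:
  assumes U: "appell_solution A q l P Q R" and l: "l > 0"
    and B: "\<And>x. x \<ge> A \<Longrightarrow> R x \<le> B"
    and d: "0 < d" "d \<le> 1" and X: "X \<ge> A"
    and asym: "\<And>x. x \<ge> X \<Longrightarrow> \<bar>l * (R x)\<^sup>2 - 1\<bar> \<le> d / 8"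
    and \<epsilon>: "0 < \<epsilon>" "\<epsilon> \<le> l"
    and y: "schroedinger_solution A q (of_real l + \<i> * of_real \<epsilon>) y y'" and L2: "square_integrable_from A y"
    and k: "k = csqrt (1 + \<i> * of_real (\<epsilon> / l))"
    and x1: "x1 \<ge> X"
  shows "cmod (liouville_V Q R y y' x1 - \<i> * k * liouville_Y R y x1) \<le>
     d * cmod (liouville_V Q R y y' x1 + \<i> * k * liouville_Y R y x1)"
proof (rule ccontr)
  assume neg: "\<not> ?thesis"
  define V where "V = liouville_V Q R y y'"
  define Y where "Y = liouville_Y R y"
  define p where "p = (\<lambda>x. V x - \<i> * k * Y x)"
  define s where "s = (\<lambda>x. V x + \<i> * k * Y x)"
  \<comment> \<open>Positivity of \<Phi> describes the cone |p| > d |s|; the differential inequality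
    below shows that solutions cannot leave it and grow inside it.\<close>
  define \<Phi> where "\<Phi> = (\<lambda>x. (cmod (p x))\<^sup>2 - d\<^sup>2 * (cmod (s x))\<^sup>2)"
  define S where "S = (\<lambda>x. (cmod (p x))\<^sup>2 + d\<^sup>2 * (cmod (s x))\<^sup>2)"
  define a where "a = (\<lambda>x. \<i> * of_real (\<epsilon> * (1 / l - (R x)\<^sup>2)))"
  \<comment> \<open>Growth per unit of phase is at least Im k, and the phase advances at rate 1/R >=
    1/B.\<close>
  define \<kappa> where "\<kappa> = Im k / B"
  have \<epsilon>l: "0 < \<epsilon> / l" "\<epsilon> / l \<le> 1" using \<epsilon> l by auto
  note K = csqrt_near_one[OF \<epsilon>l, folded k]
  have R: "R x > 0" if "x \<ge> A" for x using appell_pos[OF U l that] by simp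
  have Bpos: "B > 0" using R[of A] B[of A] by simp
  have "0 < \<epsilon> / l / 4" using \<epsilon>l by simp
  then have Imk: "Im k > 0" using K(4) by (rule less_le_trans)
  have \<kappa>: "\<kappa> > 0" using Imk Bpos by (simp add: \<kappa>_def)
  have \<Phi>1: "\<Phi> x1 > 0"
  proof -
    have "d * cmod (s x1) < cmod (p x1)" using neg by (simp add: p_def s_def V_def Y_def)
    then have "(d * cmod (s x1))\<^sup>2 < (cmod (p x1))\<^sup>2" using d by (intro power_strict_mono) auto
    then show ?thesis by (simp add: \<Phi>_def power_mult_distrib)
  qed
  have ka: "k\<^sup>2 - (1 + \<i> * of_real \<epsilon> * of_real ((R x)\<^sup>2)) = a x" for x
    unfolding K(1) a_def using l by (simp add: algebra_simps)
  have deriv: "(\<Phi> has_real_derivative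
      1 / R x * (2 * Im k * S x + 2 * Re (cnj (p x) * (a x * Y x)) - d\<^sup>2 * (2 * Re (cnj (s x) * (a x * Y x)))))
      (at x within {A..})" if x: "x \<ge> A" for x
  proof -
    note L = liouville_derivatives[OF U l y x, folded V_def Y_def]
    have LV: "(V has_vector_derivative - (of_real (1 / R x) * ((1 + \<i> * of_real \<epsilon> * of_real ((R x)\<^sup>2)) * Y x))) (at x within {A..})"
      using L(2) by simp
    have pd: "(p has_vector_derivative of_real (1 / R x) * (- \<i> * k * p x + a x * Y x)) (at x within {A..})"
      unfolding p_def
    proof (rule has_vector_derivative_eq_rhs)
      show "((\<lambda>x. V x - \<i> * k * Y x) has_vector_derivative
         - (of_real (1 / R x) * ((1 + \<i> * of_real \<epsilon> * of_real ((R x)\<^sup>2)) * Y x)) - \<i> * k * (of_real (1 / R x) * V x)) (at x within {A..})"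
        by (intro has_vector_derivative_diff has_vector_derivative_mult_right LV L(1))
      show "- (of_real (1 / R x) * ((1 + \<i> * of_real \<epsilon> * of_real ((R x)\<^sup>2)) * Y x)) - \<i> * k * (of_real (1 / R x) * V x)
        = of_real (1 / R x) * (- \<i> * k * (V x - \<i> * k * Y x) + a x * Y x)"
        unfolding ka[symmetric] by (simp add: algebra_simps power2_eq_square)
    qed
    have sd: "(s has_vector_derivative of_real (1 / R x) * (\<i> * k * s x + a x * Y x)) (at x within {A..})"
      unfolding s_def
    proof (rule has_vector_derivative_eq_rhs)
      show "((\<lambda>x. V x + \<i> * k * Y x) has_vector_derivative
         - (of_real (1 / R x) * ((1 + \<i> * of_real \<epsilon> * of_real ((R x)\<^sup>2)) * Y x)) + \<i> * k * (of_real (1 / R x) * V x)) (at x within {A..})"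
        by (intro has_vector_derivative_add has_vector_derivative_mult_right LV L(1))
      show "- (of_real (1 / R x) * ((1 + \<i> * of_real \<epsilon> * of_real ((R x)\<^sup>2)) * Y x)) + \<i> * k * (of_real (1 / R x) * V x)
        = of_real (1 / R x) * (\<i> * k * (V x + \<i> * k * Y x) + a x * Y x)"
        unfolding ka[symmetric] by (simp add: algebra_simps power2_eq_square)
    qed
    have re: "Re (cnj w * (of_real r * (c * w + b))) = r * (Re c * (cmod w)\<^sup>2 + Re (cnj w * b))"
      for w c b :: complex and r :: real
      unfolding cmod_power2 by (simp add: algebra_simps power2_eq_square)
    have "(\<Phi> has_real_derivative
        2 * (1 / R x * (Re (- \<i> * k) * (cmod (p x))\<^sup>2 + Re (cnj (p x) * (a x * Y x)))) -
        d\<^sup>2 * (2 * (1 / R x * (Re (\<i> * k) * (cmod (s x))\<^sup>2 + Re (cnj (s x) * (a x * Y x)))))) (at x within {A..})"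
      unfolding \<Phi>_def
      using DERIV_diff[OF has_real_derivative_cmod_squared[OF pd]
          DERIV_cmult[OF has_real_derivative_cmod_squared[OF sd], of "d\<^sup>2"]]
      unfolding re .
    moreover have "2 * (1 / r * (kk * pp + b1)) - dd * (2 * (1 / r * (- kk * ss + b2)))
       = 1 / r * (2 * kk * (pp + dd * ss) + 2 * b1 - dd * (2 * b2))" for r kk pp b1 dd ss b2 :: real
      by (simp add: algebra_simps)
    moreover have "Re (- \<i> * k) = Im k" "Re (\<i> * k) = - Im k" by simp_all
    ultimately show ?thesis unfolding S_def by (simp only:)
  qed
  define \<Phi>' where "\<Phi>' = (\<lambda>x. 1 / R x * (2 * Im k * S x + 2 * Re (cnj (p x) * (a x * Y x)) - d\<^sup>2 * (2 * Re (cnj (s x) * (a x * Y x)))))"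
  \<comment> \<open>The size of a is at most (\<epsilon>/l) d/8, while Im k is at least
    \<epsilon>/(4 l). The factor \<epsilon>/l cancels, giving |a| <= d Im k / 2 for every
    \<epsilon>; this fixes the constant 8 in \<open>asym\<close>.\<close>
  have ge: "\<Phi>' x \<ge> \<kappa> * \<Phi> x" if x: "x \<ge> X" for x
  proof -
    have xA: "x \<ge> A" using x X by simp
    have "cmod (a x) = \<epsilon> / l * \<bar>l * (R x)\<^sup>2 - 1\<bar>"
    proof -
      have "\<epsilon> * (1 / l - (R x)\<^sup>2) = - (\<epsilon> / l * (l * (R x)\<^sup>2 - 1))" using l by (simp add: field_simps)
      then have "cmod (a x) = \<bar>\<epsilon> / l * (l * (R x)\<^sup>2 - 1)\<bar>"
        unfolding a_def norm_mult norm_of_real by simp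
      then show ?thesis using \<epsilon>l by (simp only: abs_mult abs_of_pos)
    qed
    also have "\<dots> \<le> \<epsilon> / l * (d / 8)" using asym[OF x] \<epsilon>l by (intro mult_left_mono) auto
    also have "\<dots> = d * (\<epsilon> / l / 4) / 2" by (simp add: mult.commute)
    also have "\<dots> \<le> d * Im k / 2" using K(4) d by (intro divide_right_mono mult_left_mono) auto
    finally have a_le: "cmod (a x) \<le> d * Im k / 2" .
    have "2 * cmod (Y x) \<le> 2 * (cmod k * cmod (Y x))"
      using K(2) by (simp add: mult_le_cancel_right1)
    also have "\<dots> = cmod (2 * \<i> * k * Y x)" by (simp add: norm_mult)
    also have "2 * \<i> * k * Y x = s x - p x" by (simp add: s_def p_def)
    also have "cmod (s x - p x) \<le> cmod (p x) + cmod (s x)" by (metis add.commute norm_triangle_ineq4)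
    finally have Y_le: "2 * cmod (Y x) \<le> cmod (p x) + cmod (s x)" .
    have S0: "S x \<ge> 0" by (simp add: S_def)
    have "Im k * S x \<ge> - 2 * Re (cnj (p x) * (a x * Y x)) + d\<^sup>2 * (2 * Re (cnj (s x) * (a x * Y x)))"
      unfolding S_def by (rule riccati_form_bound[OF d a_le Y_le])
    then have "Im k * S x \<le> 2 * Im k * S x + 2 * Re (cnj (p x) * (a x * Y x)) - d\<^sup>2 * (2 * Re (cnj (s x) * (a x * Y x)))"
      by linarith
    then have "1 / R x * (Im k * S x) \<le> \<Phi>' x"
      unfolding \<Phi>'_def using R[OF xA] by (intro mult_left_mono) auto
    moreover have "1 / B * (Im k * S x) \<le> 1 / R x * (Im k * S x)"
      using B[OF xA] R[OF xA] Imk S0 by (intro mult_right_mono divide_left_mono) auto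
    moreover have "\<kappa> * \<Phi> x \<le> \<kappa> * S x"
      using \<kappa> by (intro mult_left_mono) (auto simp: \<Phi>_def S_def)
    ultimately show ?thesis by (simp add: \<kappa>_def)
  qed
  have grow: "\<Phi> x1 * exp (- \<kappa> * x1) \<le> \<Phi> x * exp (- \<kappa> * x)" if x: "x \<ge> x1" for x
  proof (rule nondecreasing_from_derivative[where A=A and f="\<lambda>t. \<Phi> t * exp (- \<kappa> * t)"
        and f'="\<lambda>t. (\<Phi>' t - \<kappa> * \<Phi> t) * exp (- \<kappa> * t)"])
    fix t assume t: "x1 \<le> t" "t \<le> x"
    then have tA: "t \<ge> A" "t \<ge> X" using x1 X by auto
    have "(\<Phi> has_real_derivative \<Phi>' t) (at t within {A..})"
      using deriv[OF tA(1)] by (simp only: \<Phi>'_def)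
    then show "((\<lambda>t. \<Phi> t * exp (- \<kappa> * t)) has_real_derivative (\<Phi>' t - \<kappa> * \<Phi> t) * exp (- \<kappa> * t)) (at t within {A..})"
      by (auto intro!: derivative_eq_intros simp: algebra_simps)
    show "0 \<le> (\<Phi>' t - \<kappa> * \<Phi> t) * exp (- \<kappa> * t)" using ge[OF tA(2)] by simp
  qed (use x x1 X in auto)
  obtain C where C: "C > 0" "\<And>x. x \<ge> A \<Longrightarrow> liouville_energy Q R y y' x \<le> C * (1 + (x - A))"
    using liouville_energy_growth[OF U l B y L2] by auto
  \<comment> \<open>Linear energy growth caps \<Phi>, against the exponential lower bound in
    \<open>grow\<close>. The factor 4 uses |k|^2 <= 2.\<close>
  have upper: "\<Phi> x \<le> 4 * C * (1 + (x - A))" if x: "x \<ge> A" for x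
  proof -
    have "cmod (p x) \<le> cmod (V x) + cmod k * cmod (Y x)"
      unfolding p_def by (rule order_trans[OF norm_triangle_ineq4]) (simp add: norm_mult)
    then have "(cmod (p x))\<^sup>2 \<le> (cmod (V x) + cmod k * cmod (Y x))\<^sup>2" by (intro power_mono) auto
    also have "\<dots> \<le> 2 * (cmod (V x))\<^sup>2 + 2 * ((cmod k)\<^sup>2 * (cmod (Y x))\<^sup>2)"
    proof -
      have "0 \<le> (cmod (V x) - cmod k * cmod (Y x))\<^sup>2" by simp
      then show ?thesis by (simp add: power2_eq_square algebra_simps)
    qed
    also have "\<dots> \<le> 4 * (cmod (V x))\<^sup>2 + 2 * (2 * (cmod (Y x))\<^sup>2)"
      using K(3) by (intro add_mono mult_left_mono mult_right_mono) auto
    also have "\<dots> = 4 * liouville_energy Q R y y' x" by (simp add: liouville_energy_def V_def Y_def)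
    also have "\<dots> \<le> 4 * (C * (1 + (x - A)))" using C(2)[OF x] by simp
    finally have "(cmod (p x))\<^sup>2 \<le> 4 * C * (1 + (x - A))" by simp
    moreover have "0 \<le> d\<^sup>2 * (cmod (s x))\<^sup>2" by simp
    ultimately show ?thesis unfolding \<Phi>_def by linarith
  qed
  have "((\<lambda>x. 4 * C * (1 + (x - A)) * exp (- \<kappa> * x)) \<longlongrightarrow> 0) at_top" using \<kappa> by real_asymp
  then have "\<forall>\<^sub>F x in at_top. 4 * C * (1 + (x - A)) * exp (- \<kappa> * x) < \<Phi> x1 * exp (- \<kappa> * x1)"
    by (rule order_tendstoD(2)) (use \<Phi>1 in simp)
  from eventually_happens[OF eventually_conj[OF this eventually_ge_at_top[of x1]]]
  obtain x where x: "x \<ge> x1" "4 * C * (1 + (x - A)) * exp (- \<kappa> * x) < \<Phi> x1 * exp (- \<kappa> * x1)" by auto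
  have "\<Phi> x * exp (- \<kappa> * x) \<le> 4 * C * (1 + (x - A)) * exp (- \<kappa> * x)"
    using upper[of x] x(1) x1 X by (intro mult_right_mono) auto
  then show False using grow[OF x(1)] x(2) by linarith
qed

text \<open>\<open>V - \<i> Y\<close> vanishes exactly for the solutions proportional to \<open>sqrt R exp (\<i> \<theta>)\<close>,
  whose logarithmic derivative is \<open>- Q / (2 R) + \<i> / R\<close>.\<close>

lemma incoming_part_transfer:
  assumes U: "appell_solution A q l P Q R" and l: "l > 0"
    and B: "\<And>x. x \<ge> A \<Longrightarrow> R x \<le> B"
    and X: "X \<ge> A" and \<epsilon>: "\<epsilon> > 0"
    and y: "schroedinger_solution A q (of_real l + \<i> * of_real \<epsilon>) y y'"
    and c: "cmod (liouville_V Q R y y' X - \<i> * liouville_Y R y X) \<le> c * sqrt (liouville_energy Q R y y' X)" "c \<ge> 0"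
    and small: "\<epsilon> * B * (X - A) \<le> 1"
  shows "(cmod (liouville_V Q R y y' A - \<i> * liouville_Y R y A))\<^sup>2 \<le>
    (3 * c\<^sup>2 + 12 * (\<epsilon> * B * (X - A))) * liouville_energy Q R y y' A"
proof -
  define V where "V = liouville_V Q R y y'"
  define Y where "Y = liouville_Y R y"
  define E where "E = liouville_energy Q R y y'"
  define n where "n = (\<lambda>x. V x - \<i> * Y x)"
  have E_eq: "E x = (cmod (V x))\<^sup>2 + (cmod (Y x))\<^sup>2" for x by (simp add: E_def liouville_energy_def V_def Y_def)
  have E0: "E x \<ge> 0" for x by (simp add: E_eq)
  have R: "R x > 0" if "x \<ge> A" for x using appell_pos[OF U l that] by simp
  have Bpos: "B > 0" using R[of A] B[of A] by simp
  have VY: "cmod (V x) * cmod (Y x) \<le> E x / 2" for x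
    using sum_squares_bound[of "cmod (V x)" "cmod (Y x)"] by (simp add: E_eq)
  define \<beta> where "\<beta> = \<epsilon> * B"
  have \<beta>: "\<beta> > 0" using \<epsilon> Bpos by (simp add: \<beta>_def)
  \<comment> \<open>The relative growth rate of the energy is at most \<epsilon> B, and
    \<open>small\<close> limits the total exponent to 1; hence the factor e <= 3.\<close>
  have E_upper: "E x \<le> 3 * E A" if x: "A \<le> x" "x \<le> X" for x
  proof -
    have "- (E A * exp (- \<beta> * A)) \<le> - (E x * exp (- \<beta> * x))"
    proof (rule nondecreasing_from_derivative[where A=A and f="\<lambda>t. - (E t * exp (- \<beta> * t))"
          and f'="\<lambda>t. (\<beta> * E t + 2 * R t * Re (\<i> * of_real \<epsilon> * (cnj (V t) * Y t))) * exp (- \<beta> * t)"])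
      fix t assume t: "A \<le> t" "t \<le> x"
      have "(E has_real_derivative - 2 * R t * Re (\<i> * of_real \<epsilon> * (cnj (V t) * Y t))) (at t within {A..})"
        using liouville_energy_derivative[OF U l y t(1)] by (simp add: E_def V_def Y_def)
      then show "((\<lambda>t. - (E t * exp (- \<beta> * t))) has_real_derivative
          (\<beta> * E t + 2 * R t * Re (\<i> * of_real \<epsilon> * (cnj (V t) * Y t))) * exp (- \<beta> * t)) (at t within {A..})"
        by (auto intro!: derivative_eq_intros simp: algebra_simps)
      define T where "T = \<i> * of_real \<epsilon> * (cnj (V t) * Y t)"
      have "- Re T \<le> cmod T" using abs_Re_le_cmod[of T] by linarith
      also have "cmod T = \<epsilon> * (cmod (V t) * cmod (Y t))" using \<epsilon> by (simp add: T_def norm_mult)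
      also have "\<dots> \<le> \<epsilon> * (E t / 2)" using VY \<epsilon> by (intro mult_left_mono) auto
      finally have "R t * - Re T \<le> R t * (\<epsilon> * (E t / 2))" using R[OF t(1)] by (intro mult_left_mono) auto
      also have "\<dots> \<le> B * (\<epsilon> * (E t / 2))" using B[OF t(1)] \<epsilon> E0[of t] by (intro mult_right_mono) auto
      finally have "0 \<le> \<beta> * E t + 2 * R t * Re T" by (simp add: \<beta>_def algebra_simps)
      then show "0 \<le> (\<beta> * E t + 2 * R t * Re (\<i> * of_real \<epsilon> * (cnj (V t) * Y t))) * exp (- \<beta> * t)"
        by (simp add: T_def del: Re_complex_of_real)
    qed (use x in auto)
    then have "E x * exp (- \<beta> * x) \<le> E A * exp (- \<beta> * A)" by simp
    then have "E x * exp (- \<beta> * x) * exp (\<beta> * x) \<le> E A * exp (- \<beta> * A) * exp (\<beta> * x)"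
      by (rule mult_right_mono) simp
    then have "E x \<le> E A * exp (\<beta> * (x - A))"
      by (simp add: mult.assoc exp_add[symmetric] algebra_simps)
    also have "\<dots> \<le> E A * 3"
    proof (rule mult_left_mono[OF _ E0])
      have "\<beta> * (x - A) \<le> \<beta> * (X - A)" using x \<beta> by (intro mult_left_mono) auto
      then have "exp (\<beta> * (x - A)) \<le> exp 1" using small by (simp add: \<beta>_def)
      then show "exp (\<beta> * (x - A)) \<le> 3" using exp_le by linarith
    qed
    finally show ?thesis by simp
  qed
  have "(cmod (n A))\<^sup>2 + (- 12 * \<beta> * E A) * A \<le> (cmod (n X))\<^sup>2 + (- 12 * \<beta> * E A) * A + 12 * \<beta> * E A * (X - A)"
  proof -
    have "(cmod (n A))\<^sup>2 + 12 * \<beta> * E A * A \<le> (cmod (n X))\<^sup>2 + 12 * \<beta> * E A * X"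
    proof (rule nondecreasing_from_derivative[where A=A and f="\<lambda>t. (cmod (n t))\<^sup>2 + 12 * \<beta> * E A * t"
          and f'="\<lambda>t. - 2 * (\<epsilon> * R t) * Re (cnj (n t) * (\<i> * Y t)) + 12 * \<beta> * E A"])
      fix t assume t: "A \<le> t" "t \<le> X"
      note L = liouville_derivatives[OF U l y t(1), folded V_def Y_def]
      \<comment> \<open>The term -i n / R merely rotates n and drops out of the derivative of |n|^2,
        leaving a source of order \<epsilon>. The source is bounded by 2 \<epsilon> R times 6 E(A),
        which explains the constant 12.\<close>
      have nd: "(n has_vector_derivative of_real (1 / R t) * (- \<i> * n t) - \<i> * of_real (\<epsilon> * R t) * Y t) (at t within {A..})"
        unfolding n_def
      proof (rule has_vector_derivative_eq_rhs)
        show "((\<lambda>t. V t - \<i> * Y t) has_vector_derivative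
           - (of_real (1 / R t) * ((1 + (of_real l + \<i> * of_real \<epsilon> - of_real l) * of_real ((R t)\<^sup>2)) * Y t))
           - \<i> * (of_real (1 / R t) * V t)) (at t within {A..})"
          by (intro has_vector_derivative_diff has_vector_derivative_mult_right L)
        show "- (of_real (1 / R t) * ((1 + (of_real l + \<i> * of_real \<epsilon> - of_real l) * of_real ((R t)\<^sup>2)) * Y t))
           - \<i> * (of_real (1 / R t) * V t) =
           of_real (1 / R t) * (- \<i> * (V t - \<i> * Y t)) - \<i> * of_real (\<epsilon> * R t) * Y t"
          using R[OF t(1)] by (simp add: field_simps power2_eq_square)
      qed
      have "2 * Re (cnj w * (of_real r * (- \<i> * w) - \<i> * of_real b * f)) = - 2 * b * Re (cnj w * (\<i> * f))"
        for w f :: complex and r b :: real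
        by (simp add: algebra_simps)
      with has_real_derivative_cmod_squared[OF nd]
      have "((\<lambda>t. (cmod (n t))\<^sup>2) has_real_derivative - 2 * (\<epsilon> * R t) * Re (cnj (n t) * (\<i> * Y t))) (at t within {A..})"
        by (simp only:)
      then show "((\<lambda>t. (cmod (n t))\<^sup>2 + 12 * \<beta> * E A * t) has_real_derivative
          - 2 * (\<epsilon> * R t) * Re (cnj (n t) * (\<i> * Y t)) + 12 * \<beta> * E A) (at t within {A..})"
        by (intro DERIV_add) (auto intro!: derivative_eq_intros)
      have "Re (cnj (n t) * (\<i> * Y t)) \<le> cmod (n t) * cmod (Y t)"
        using complex_Re_le_cmod[of "cnj (n t) * (\<i> * Y t)"] by (simp add: norm_mult)
      also have "\<dots> \<le> (cmod (V t) + cmod (Y t)) * cmod (Y t)"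
        unfolding n_def
        by (intro mult_right_mono order_trans[OF norm_triangle_ineq4]) (simp_all add: norm_mult)
      also have "\<dots> \<le> 2 * E t"
      proof -
        have "(cmod (Y t))\<^sup>2 \<le> E t" by (simp add: E_eq)
        then show ?thesis using VY[of t] E0[of t] by (simp add: power2_eq_square distrib_right)
      qed
      also have "\<dots> \<le> 6 * E A" using E_upper[OF t] by simp
      finally have "\<epsilon> * R t * Re (cnj (n t) * (\<i> * Y t)) \<le> \<epsilon> * R t * (6 * E A)"
        using \<epsilon> R[OF t(1)] by (intro mult_left_mono) auto
      also have "\<dots> \<le> \<beta> * (6 * E A)"
        unfolding \<beta>_def using B[OF t(1)] \<epsilon> E0[of A] by (intro mult_right_mono mult_left_mono) auto
      finally show "0 \<le> - 2 * (\<epsilon> * R t) * Re (cnj (n t) * (\<i> * Y t)) + 12 * \<beta> * E A" by linarith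
    qed (use X in auto)
    then show ?thesis by (simp add: algebra_simps)
  qed
  then have "(cmod (n A))\<^sup>2 \<le> (cmod (n X))\<^sup>2 + 12 * \<beta> * E A * (X - A)" by simp
  also have "(cmod (n X))\<^sup>2 \<le> c\<^sup>2 * (3 * E A)"
  proof -
    have "(cmod (n X))\<^sup>2 \<le> (c * sqrt (E X))\<^sup>2"
      using c by (intro power_mono) (auto simp: n_def V_def Y_def E_def)
    also have "\<dots> = c\<^sup>2 * E X" using E0 by (simp add: power_mult_distrib)
    also have "\<dots> \<le> c\<^sup>2 * (3 * E A)" using E_upper[of X] X by (intro mult_left_mono) auto
    finally show ?thesis .
  qed
  finally show ?thesis by (simp add: n_def V_def Y_def E_def \<beta>_def algebra_simps)
qed

text \<open>For y(A) = 1 the quantity V - i Y at A equals sqrt R times the difference between y'(A)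
  and -Q/(2 R) + i/R. A small incoming part relative to the energy is therefore closeness of the
  logarithmic derivative to the claimed value.\<close>

lemma weyl_solution_near_boundary_value:
  assumes U: "appell_solution A q l P Q R" and l: "l > 0"
    and B: "\<And>x. x \<ge> A \<Longrightarrow> R x \<le> B" "\<And>x. x \<ge> A \<Longrightarrow> P x \<le> B"
    and d: "0 < d" "d \<le> 1" and X: "X \<ge> A"
    and asym: "\<And>x. x \<ge> X \<Longrightarrow> \<bar>l * (R x)\<^sup>2 - 1\<bar> \<le> d / 8"
    and \<epsilon>: "0 < \<epsilon>" "\<epsilon> \<le> l" "\<epsilon> / l \<le> d" and small: "\<epsilon> * B * (X - A) \<le> 1"
    and \<tau>: "48 * d\<^sup>2 + 12 * (\<epsilon> * B * (X - A)) \<le> \<tau>" "\<tau> \<le> 1 / 4"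
    and y: "schroedinger_solution A q (of_real l + \<i> * of_real \<epsilon>) y y'" and L2: "square_integrable_from A y"
    and yA: "y A = 1"
  shows "(cmod (y' A - Complex (- Q A / (2 * R A)) (1 / R A)))\<^sup>2 \<le> 6 * \<tau> * B\<^sup>2"
proof -
  define V where "V = liouville_V Q R y y'"
  define Y where "Y = liouville_Y R y"
  define E where "E = liouville_energy Q R y y'"
  have E_eq: "E x = (cmod (V x))\<^sup>2 + (cmod (Y x))\<^sup>2" for x by (simp add: E_def liouville_energy_def V_def Y_def)
  define k where "k = csqrt (1 + \<i> * of_real (\<epsilon> / l))"
  have \<epsilon>l: "0 < \<epsilon> / l" "\<epsilon> / l \<le> 1" using \<epsilon> l by auto
  note K = csqrt_near_one[OF \<epsilon>l, folded k_def]
  have "(cmod k)\<^sup>2 \<le> 2\<^sup>2" using K(3) by simp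
  then have k2: "cmod k \<le> 2" by (rule power2_le_imp_le) simp
  have VE: "cmod (V X) \<le> sqrt (E X)" and YE: "cmod (Y X) \<le> sqrt (E X)"
    by (auto intro!: real_le_rsqrt simp: E_eq)
  have "cmod (V X - \<i> * k * Y X) \<le> d * cmod (V X + \<i> * k * Y X)"
    unfolding V_def Y_def
    by (rule square_integrable_is_outgoing[OF U l B(1) d X asym \<epsilon>(1,2) y L2 k_def]) auto
  also have "\<dots> \<le> d * (3 * sqrt (E X))"
  proof (rule mult_left_mono)
    have "cmod (V X + \<i> * k * Y X) \<le> cmod (V X) + cmod k * cmod (Y X)"
      by (rule order_trans[OF norm_triangle_ineq]) (simp add: norm_mult)
    also have "\<dots> \<le> sqrt (E X) + 2 * sqrt (E X)"
      using VE YE k2 by (intro add_mono mult_mono) auto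
    finally show "cmod (V X + \<i> * k * Y X) \<le> 3 * sqrt (E X)" by simp
  qed (use d in simp)
  finally have p_le: "cmod (V X - \<i> * k * Y X) \<le> d * (3 * sqrt (E X))" .
  have split: "V X - \<i> * Y X = (V X - \<i> * k * Y X) + \<i> * (k - 1) * Y X" by (simp add: algebra_simps)
  have "cmod (V X - \<i> * Y X) \<le> cmod (V X - \<i> * k * Y X) + cmod (k - 1) * cmod (Y X)"
    unfolding split by (rule order_trans[OF norm_triangle_ineq]) (simp add: norm_mult)
  also have "\<dots> \<le> d * (3 * sqrt (E X)) + d * sqrt (E X)"
    using p_le K(5) \<epsilon>(3) YE d by (intro add_mono mult_mono) auto
  \<comment> \<open>Three d come from the outgoing estimate and one from replacing k by 1.
    Transported to A this becomes 3 (4 d)^2 = 48 d^2, the constant in the hypothesis on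
    \<tau>.\<close>
  finally have c: "cmod (V X - \<i> * Y X) \<le> 4 * d * sqrt (E X)" by simp
  have "(cmod (V A - \<i> * Y A))\<^sup>2 \<le> (3 * (4 * d)\<^sup>2 + 12 * (\<epsilon> * B * (X - A))) * E A"
    unfolding V_def Y_def E_def
    by (rule incoming_part_transfer[OF U l B(1) X \<epsilon>(1) y _ _ small])
       (use c d in \<open>auto simp: V_def Y_def E_def\<close>)
  also have "\<dots> \<le> \<tau> * E A"
    using \<tau> by (intro mult_right_mono) (auto simp: E_eq power_mult_distrib)
  finally have n_le: "(cmod (V A - \<i> * Y A))\<^sup>2 \<le> \<tau> * E A" .
  have \<tau>0: "\<tau> \<ge> 0"
  proof -
    have "R A > 0" using appell_pos[OF U l] by simp
    then have "B > 0" using B(1)[of A] by simp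
    then have "0 \<le> \<epsilon> * B * (X - A)" using \<epsilon> X by simp
    moreover have "0 \<le> 48 * d\<^sup>2" by simp
    ultimately show ?thesis using \<tau>(1) by linarith
  qed
  \<comment> \<open>The energy at A contains V, hence N itself: it is at most 2 N + 3 |Y|^2. The
    restriction \<tau> <= 1/4 lets 2 \<tau> N <= N/2 be absorbed, so N is small relative to |Y(A)|^2
    = 1 / R(A).\<close>
  define N where "N = (cmod (V A - \<i> * Y A))\<^sup>2"
  have "(cmod (V A))\<^sup>2 \<le> 2 * N + 2 * (cmod (Y A))\<^sup>2"
  proof -
    have "cmod (V A) \<le> cmod (V A - \<i> * Y A) + cmod (Y A)"
      using norm_triangle_ineq[of "V A - \<i> * Y A" "\<i> * Y A"] by (simp add: norm_mult)
    then have "(cmod (V A))\<^sup>2 \<le> (cmod (V A - \<i> * Y A) + cmod (Y A))\<^sup>2" by (intro power_mono) auto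
    also have "\<dots> \<le> 2 * N + 2 * (cmod (Y A))\<^sup>2"
    proof -
      have "0 \<le> (cmod (V A - \<i> * Y A) - cmod (Y A))\<^sup>2" by simp
      then show ?thesis by (simp add: N_def power2_eq_square algebra_simps)
    qed
    finally show ?thesis .
  qed
  then have "\<tau> * E A \<le> \<tau> * (2 * N + 3 * (cmod (Y A))\<^sup>2)" using \<tau>0 by (intro mult_left_mono) (auto simp: E_eq)
  moreover have "2 * \<tau> * N \<le> 1 / 2 * N" using \<tau>(2) by (intro mult_right_mono) (auto simp: N_def)
  ultimately have N_le: "N \<le> 6 * \<tau> * (cmod (Y A))\<^sup>2"
    using n_le unfolding N_def[symmetric] by (simp add: algebra_simps)
  have RA: "R A > 0" using appell_pos[OF U l] by simp
  define s where "s = sqrt (R A)"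
  have s: "s > 0" "R A = s * s" using RA by (simp_all add: s_def)
  define D where "D = y' A - Complex (- Q A / (2 * R A)) (1 / R A)"
  have "V A - \<i> * Y A = of_real s * D"
    using s by (simp add: V_def Y_def D_def liouville_V_def liouville_Y_def yA s_def[symmetric] Complex_eq field_simps)
  then have "N = s\<^sup>2 * (cmod D)\<^sup>2" using s by (simp add: N_def norm_mult power_mult_distrib)
  moreover have "(cmod (Y A))\<^sup>2 = (1 / s)\<^sup>2"
    using s by (simp add: Y_def liouville_Y_def yA s_def[symmetric] norm_divide)
  ultimately have "s\<^sup>2 * (cmod D)\<^sup>2 \<le> 6 * \<tau> * (1 / s)\<^sup>2" using N_le by simp
  then have "(cmod D)\<^sup>2 \<le> 6 * \<tau> * (1 / s)\<^sup>2 / s\<^sup>2" using s by (simp add: pos_le_divide_eq mult.commute)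
  also have "\<dots> = 6 * \<tau> * (1 / R A)\<^sup>2" using s by (simp add: power2_eq_square)
  also have "\<dots> \<le> 6 * \<tau> * B\<^sup>2"
    using appell_inverse_le[OF U l, of A] B(2)[of A] RA \<tau>0 by (intro mult_left_mono power_mono) auto
  finally show ?thesis by (simp add: D_def)
qed

section \<open>The Titchmarsh--Weyl function\<close>

lemma nonneg_bounded_integrable:
  fixes h :: "real \<Rightarrow> real"
  assumes nonneg: "\<And>x. x \<ge> a \<Longrightarrow> 0 \<le> h x" and int: "\<And>y. h integrable_on {a..y}"
    and bd: "\<And>y. y \<ge> a \<Longrightarrow> integral {a..y} h \<le> K"
  shows "h integrable_on {a..}"
proof -
  define f where "f = (\<lambda>y. integral {a..y} h)"
  define L where "L = Sup (f ` {a..})"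
  have mono: "f x \<le> f y" if "x \<le> y" for x y
    unfolding f_def by (rule integral_subset_le) (use that int nonneg in auto)
  have bdd: "bdd_above (f ` {a..})" using bd by (intro bdd_aboveI2[where M=K]) (auto simp: f_def)
  have le: "f y \<le> L" if "y \<ge> a" for y unfolding L_def using that by (intro cSup_upper bdd) auto
  have "(f \<longlongrightarrow> L) at_top"
  proof (rule order_tendstoI)
    fix c assume "c < L"
    then obtain y where y: "y \<ge> a" "c < f y"
      unfolding L_def by (subst (asm) less_cSup_iff[OF _ bdd]) auto
    then show "\<forall>\<^sub>F x in at_top. c < f x"
      using mono by (intro eventually_at_top_linorderI[of y]) (auto intro: less_le_trans)
  next
    fix c assume "L < c"
    then show "\<forall>\<^sub>F x in at_top. f x < c"
      using le by (intro eventually_at_top_linorderI[of a]) (auto intro: le_less_trans)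
  qed
  then have "(h has_integral L) {a..}"
    unfolding f_def by (intro has_integral_to_inf int nonneg)
  then show ?thesis by blast
qed

text \<open>The real potential contributes a real multiple of |y|^2 to the derivative of cnj y times
  y', so only Im z is left in the imaginary part.\<close>

lemma flux_identity:
  assumes y: "schroedinger_solution A q z y y'" and b: "A \<le> b"
  shows "Im (cnj (y b) * y' b) = Im (cnj (y A) * y' A) - Im z * integral {A..b} (\<lambda>x. (cmod (y x))\<^sup>2)"
proof -
  have "((\<lambda>x. - Im z * (cmod (y x))\<^sup>2) has_integral Im (cnj (y b) * y' b) - Im (cnj (y A) * y' A)) {A..b}"
  proof (rule fundamental_theorem_of_calculus[OF b])
    fix x assume x: "x \<in> {A..b}"
    have "((\<lambda>x. cnj (y x) * y' x) has_vector_derivative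
        cnj (y x) * ((of_real (q x) - z) * y x) + cnj (y' x) * y' x) (at x within {A..})"
      using x by (intro has_vector_derivative_mult has_vector_derivative_cnj schroedinger_solutionD[OF y]) auto
    then have "((\<lambda>x. Im (cnj (y x) * y' x)) has_vector_derivative
        Im (cnj (y x) * ((of_real (q x) - z) * y x) + cnj (y' x) * y' x)) (at x within {A..})"
      by (rule bounded_linear.has_vector_derivative[OF bounded_linear_Im])
    moreover have "Im (cnj (y x) * ((of_real (q x) - z) * y x) + cnj (y' x) * y' x) = - Im z * (cmod (y x))\<^sup>2"
      unfolding cmod_power2 by (simp add: algebra_simps power2_eq_square)
    ultimately show "((\<lambda>x. Im (cnj (y x) * y' x)) has_vector_derivative - Im z * (cmod (y x))\<^sup>2) (at x within {A..b})"
      by (auto intro: has_vector_derivative_within_subset)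
  qed
  from integral_unique[OF this] show ?thesis by simp
qed

text \<open>Cauchy-Schwarz in the form with a free weight t; the weight is chosen at each use to
  balance the two norms.\<close>

lemma square_integrable_product_bound:
  assumes f: "square_integrable_from A f" "continuous_on {A..} f"
    and g: "square_integrable_from A g" "continuous_on {A..} g" and t: "t > 0"
  shows "cmod (integral {A..} (\<lambda>x. f x * g x)) \<le>
    (t * integral {A..} (\<lambda>x. (cmod (f x))\<^sup>2) + integral {A..} (\<lambda>x. (cmod (g x))\<^sup>2) / t) / 2"
proof -
  have fi: "(\<lambda>x. (cmod (f x))\<^sup>2) integrable_on {A..}" and gi: "(\<lambda>x. (cmod (g x))\<^sup>2) integrable_on {A..}"
    using f g unfolding square_integrable_from_def by auto
  have hi: "((\<lambda>x. (t * (cmod (f x))\<^sup>2 + (cmod (g x))\<^sup>2 / t) / 2) has_integral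
      (t * integral {A..} (\<lambda>x. (cmod (f x))\<^sup>2) + integral {A..} (\<lambda>x. (cmod (g x))\<^sup>2) / t) / 2) {A..}"
    by (intro has_integral_divide has_integral_add has_integral_mult_right integrable_integral fi gi)
  have "cmod (integral {A..} (\<lambda>x. f x * g x)) \<le> integral {A..} (\<lambda>x. (t * (cmod (f x))\<^sup>2 + (cmod (g x))\<^sup>2 / t) / 2)"
  proof (rule integral_norm_bound_integral)
    show "(\<lambda>x. f x * g x) integrable_on {A..}"
      by (rule set_lebesgue_integral_eq_integral(1)[OF square_integrable_product[OF f(1) g(1) f(2) g(2)]])
    show "(\<lambda>x. (t * (cmod (f x))\<^sup>2 + (cmod (g x))\<^sup>2 / t) / 2) integrable_on {A..}"
      using hi by blast
    fix x
    define a b where "a = cmod (f x)" and "b = cmod (g x)"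
    have "0 \<le> (t * a - b)\<^sup>2 / t" using t by simp
    also have "\<dots> = t * a\<^sup>2 + b\<^sup>2 / t - 2 * (a * b)"
      using t by (simp add: power2_eq_square field_simps)
    finally show "cmod (f x * g x) \<le> (t * (cmod (f x))\<^sup>2 + (cmod (g x))\<^sup>2 / t) / 2"
      by (simp add: norm_mult a_def b_def)
  qed
  also have "\<dots> = (t * integral {A..} (\<lambda>x. (cmod (f x))\<^sup>2) + integral {A..} (\<lambda>x. (cmod (g x))\<^sup>2) / t) / 2"
    by (rule integral_unique[OF hi])
  finally show ?thesis .
qed

text \<open>A single Appell solution at one real parameter serves as reference for all complex z:
  the energy estimates treat z minus that parameter as a constant.\<close>

locale weyl_problem =
  fixes A :: real and q :: "real \<Rightarrow> real" and u u' v v' :: "real \<Rightarrow> complex \<Rightarrow> complex"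
    and l\<^sub>0 :: real and P Q R :: "real \<Rightarrow> real" and B :: real
  assumes appell: "appell_solution A q l\<^sub>0 P Q R" and l0_pos: "l\<^sub>0 > 0"
    and R_le: "\<And>x. x \<ge> A \<Longrightarrow> R x \<le> B" and P_le: "\<And>x. x \<ge> A \<Longrightarrow> P x \<le> B"
    and u_sol: "\<And>z. schroedinger_solution A q z (\<lambda>x. u x z) (\<lambda>x. u' x z)"
    and v_sol: "\<And>z. schroedinger_solution A q z (\<lambda>x. v x z) (\<lambda>x. v' x z)"
    and init: "\<And>z. u A z = 1" "\<And>z. u' A z = 0" "\<And>z. v A z = 0" "\<And>z. v' A z = 1"
begin

lemma lagrange_identity:
  assumes "schroedinger_solution A q z1 y y'" "square_integrable_from A y"
    "schroedinger_solution A q z2 w w'" "square_integrable_from A w"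
  shows "(z1 - z2) * integral {A..} (\<lambda>x. y x * w x) = - wronskian y y' w w' A"
  by (rule wronskian_identity[OF appell l0_pos R_le P_le assms])

section \<open>Weyl discs and the square integrable solution\<close>

lemma combination_sol:
  "schroedinger_solution A q z (\<lambda>x. u x z + m * v x z) (\<lambda>x. u' x z + m * v' x z)"
  by (rule schroedinger_solution_add_scaled[OF u_sol v_sol])

lemma combination_integrable: "(\<lambda>x. (cmod (u x z + m * v x z))\<^sup>2) integrable_on {A..c}"
  by (intro integrable_continuous_real continuous_intros
      continuous_on_subset[OF schroedinger_solutionD(3)[OF u_sol]]
      continuous_on_subset[OF schroedinger_solutionD(3)[OF v_sol]]) auto

text \<open>The flux of v starts at 0 and decreases with the integral of |v|^2. If that integral
  vanished, v and its derivative would vanish at an interior point, although the Wronskian of u and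
  v is 1. The strict sign makes the discs non-empty and bounded.\<close>

lemma v_flux_neg:
  assumes z: "Im z > 0" and b: "A < b"
  shows "Im (cnj (v b z) * v' b z) < 0"
proof -
  note cont = schroedinger_solutionD(3)[OF v_sol]
  have cont_sq: "continuous_on {A..b} (\<lambda>x. (cmod (v x z))\<^sup>2)"
    by (intro continuous_intros continuous_on_subset[OF cont]) auto
  have "integral {A..b} (\<lambda>x. (cmod (v x z))\<^sup>2) \<noteq> 0"
  proof
    assume "integral {A..b} (\<lambda>x. (cmod (v x z))\<^sup>2) = 0"
    then have v0: "v x z = 0" if "x \<in> {A..b}" for x
      using integral_eq_0_iff[OF cont_sq b] that by auto
    define x where "x = (A + b) / 2"
    have x: "A < x" "x < b" using b by (simp_all add: x_def)
    have "((\<lambda>x. v x z) has_vector_derivative v' x z) (at x)"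
      using schroedinger_solutionD(1)[OF v_sol, of x z] x at_within_interior[of x "{A..}"] by simp
    moreover have "((\<lambda>x. v x z) has_vector_derivative 0) (at x)"
      by (rule has_vector_derivative_transform_within_open[of "\<lambda>_. 0" _ _ "{A<..<b}"]) (use x v0 in auto)
    ultimately have "v' x z = 0" by (rule vector_derivative_unique_at)
    moreover have "v x z = 0" using v0 x by auto
    moreover have "wronskian (\<lambda>x. u x z) (\<lambda>x. u' x z) (\<lambda>x. v x z) (\<lambda>x. v' x z) x = 1"
      using integral_unique[OF wronskian_integral[OF u_sol[of z] v_sol[of z], of x]] x
      by (simp add: wronskian_def init)
    ultimately show False by (simp add: wronskian_def)
  qed
  moreover have "integral {A..b} (\<lambda>x. (cmod (v x z))\<^sup>2) \<ge> 0"
    by (intro integral_nonneg integrable_continuous_real cont_sq) auto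
  ultimately have "integral {A..b} (\<lambda>x. (cmod (v x z))\<^sup>2) > 0" by linarith
  then show ?thesis using flux_identity[OF v_sol[of z], of b] b z by (simp add: init)
qed

text \<open>The classical Weyl disc, encoded by the flux at b. In this form it is visibly closed and
  quadratic in m; \<open>mem_weyl_disc\<close> recovers the integral inequality.\<close>

definition weyl_disc :: "complex \<Rightarrow> real \<Rightarrow> complex set" where
  "weyl_disc z b = {m. 0 \<le> Im (cnj (u b z + m * v b z) * (u' b z + m * v' b z))}"

lemma mem_weyl_disc:
  assumes "A \<le> b"
  shows "m \<in> weyl_disc z b \<longleftrightarrow> Im z * integral {A..b} (\<lambda>x. (cmod (u x z + m * v x z))\<^sup>2) \<le> Im m"
  using flux_identity[OF combination_sol[of z m] assms] by (simp add: weyl_disc_def init)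

text \<open>The witness -u/v imposes a Dirichlet condition at b, so the flux there is 0.\<close>

lemma weyl_disc_nonempty:
  assumes "Im z > 0" "A < b"
  shows "weyl_disc z b \<noteq> {}"
proof -
  have "v b z \<noteq> 0" using v_flux_neg[OF assms] by auto
  then have "u b z + - u b z / v b z * v b z = 0" by simp
  then have "- u b z / v b z \<in> weyl_disc z b" unfolding weyl_disc_def mem_Collect_eq by (simp only:) simp
  then show ?thesis by blast
qed

text \<open>As a polynomial in m the flux has quadratic part |m|^2 times the flux of v, which is
  negative; large m are therefore excluded.\<close>

lemma weyl_disc_compact:
  assumes z: "Im z > 0" and b: "A < b"
  shows "compact (weyl_disc z b)"
proof -
  define \<kappa> where "\<kappa> = - Im (cnj (v b z) * v' b z)"
  have \<kappa>: "\<kappa> > 0" using v_flux_neg[OF z b] by (simp add: \<kappa>_def)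
  define c0 where "c0 = cmod (u b z) * cmod (u' b z)"
  define c1 where "c1 = cmod (u b z) * cmod (v' b z) + cmod (v b z) * cmod (u' b z)"
  have c: "c0 \<ge> 0" "c1 \<ge> 0" by (simp_all add: c0_def c1_def)
  have "cmod m \<le> 1 + (c0 + c1) / \<kappa>" if m: "m \<in> weyl_disc z b" for m
  proof (cases "cmod m \<le> 1")
    case True
    then show ?thesis using c \<kappa> by (simp add: add_increasing2)
  next
    case False
    have eq: "cnj (u b z + m * v b z) * (u' b z + m * v' b z) =
        (cnj (u b z) * u' b z + cnj (u b z) * (m * v' b z) + cnj (m * v b z) * u' b z) +
        of_real ((cmod m)\<^sup>2) * (cnj (v b z) * v' b z)"
      unfolding complex_norm_square by (simp add: algebra_simps)
    have "Im (of_real ((cmod m)\<^sup>2) * (cnj (v b z) * v' b z)) = - \<kappa> * (cmod m)\<^sup>2"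
      by (simp add: \<kappa>_def algebra_simps)
    then have "\<kappa> * (cmod m)\<^sup>2 \<le> Im (cnj (u b z) * u' b z + cnj (u b z) * (m * v' b z) + cnj (m * v b z) * u' b z)"
      using m unfolding weyl_disc_def mem_Collect_eq eq plus_complex.sel(2)[of _ "of_real ((cmod m)\<^sup>2) * _"] by linarith
    also have "\<dots> \<le> cmod (cnj (u b z) * u' b z + cnj (u b z) * (m * v' b z) + cnj (m * v b z) * u' b z)"
      using abs_Im_le_cmod by (rule order_trans[OF abs_ge_self])
    also have "\<dots> \<le> c0 + cmod m * c1"
      by (rule order_trans[OF norm_triangle_ineq] order_trans[OF add_right_mono[OF norm_triangle_ineq]])+
         (simp add: norm_mult c0_def c1_def algebra_simps)
    also have "\<dots> \<le> cmod m * (c0 + c1)" using False c by (simp add: distrib_left mult_le_cancel_right1)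
    finally have "cmod m * (\<kappa> * cmod m) \<le> cmod m * (c0 + c1)" by (simp add: power2_eq_square mult_ac)
    then have "\<kappa> * cmod m \<le> c0 + c1" by (rule mult_left_le_imp_le) (use False in auto)
    then have "cmod m \<le> (c0 + c1) / \<kappa>" using \<kappa> by (simp add: pos_le_divide_eq mult.commute)
    then show ?thesis by simp
  qed
  then have "bounded (weyl_disc z b)" by (auto simp: bounded_iff)
  moreover have "closed (weyl_disc z b)"
    unfolding weyl_disc_def by (intro closed_Collect_le continuous_intros)
  ultimately show ?thesis by (simp add: compact_eq_bounded_closed)
qed

lemma weyl_disc_antimono:
  assumes z: "Im z > 0" and b: "A \<le> b" "b \<le> b'"
  shows "weyl_disc z b' \<subseteq> weyl_disc z b"
proof
  fix m assume m: "m \<in> weyl_disc z b'"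
  have "integral {A..b} (\<lambda>x. (cmod (u x z + m * v x z))\<^sup>2) \<le> integral {A..b'} (\<lambda>x. (cmod (u x z + m * v x z))\<^sup>2)"
    by (rule integral_subset_le) (use b combination_integrable in auto)
  then have "Im z * integral {A..b} (\<lambda>x. (cmod (u x z + m * v x z))\<^sup>2) \<le>
      Im z * integral {A..b'} (\<lambda>x. (cmod (u x z + m * v x z))\<^sup>2)"
    using z by (intro mult_left_mono) auto
  then show "m \<in> weyl_disc z b" using m b by (simp add: mem_weyl_disc)
qed

lemma weyl_solution_exists:
  assumes z: "Im z > 0"
  shows "\<exists>m. square_integrable_from A (\<lambda>x. u x z + m * v x z)"
proof -
  define D where "D = (\<lambda>n::nat. weyl_disc z (A + 1 + real n))"
  \<comment> \<open>The right ends start at A + 1 because at b = A, where v vanishes, the set is an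
    unbounded half-plane. A common point of all discs has integrals bounded by Im m / Im z.\<close>
  have "\<Inter> (range D) \<noteq> {}"
  proof (rule compact_nest)
    show "compact (D n)" "D n \<noteq> {}" for n
      unfolding D_def by (intro weyl_disc_compact weyl_disc_nonempty z; simp)+
    show "D n \<subseteq> D m" if "m \<le> n" for m n
      unfolding D_def by (intro weyl_disc_antimono z) (use that in auto)
  qed
  then obtain m where m: "\<And>n. m \<in> D n" by blast
  have "(\<lambda>x. (cmod (u x z + m * v x z))\<^sup>2) integrable_on {A..}"
  proof (rule nonneg_bounded_integrable[OF _ combination_integrable])
    fix y assume y: "y \<ge> A"
    obtain n :: nat where "y - A \<le> real n" using real_arch_simple by blast
    then have "m \<in> weyl_disc z y"
      using m[of n] weyl_disc_antimono[OF z y, of "A + 1 + real n"] unfolding D_def by auto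
    then show "integral {A..y} (\<lambda>x. (cmod (u x z + m * v x z))\<^sup>2) \<le> Im m / Im z"
      using y z by (simp add: mem_weyl_disc pos_le_divide_eq mult.commute)
  qed simp
  then show ?thesis unfolding square_integrable_from_def by blast
qed

text \<open>The Wronskian of the two combinations at A is m2 - m1, and for equal spectral parameters
  the Lagrange identity makes it 0.\<close>

lemma weyl_solution_unique:
  assumes "square_integrable_from A (\<lambda>x. u x z + m1 * v x z)"
    "square_integrable_from A (\<lambda>x. u x z + m2 * v x z)"
  shows "m1 = m2"
  using lagrange_identity[OF combination_sol assms(1) combination_sol assms(2)]
  by (simp add: wronskian_def init)

section \<open>The Weyl function as a Herglotz function\<close>

definition m_fun :: "complex \<Rightarrow> complex" where "m_fun z = TW_m u v A z"
definition psi :: "complex \<Rightarrow> real \<Rightarrow> complex" where "psi z x = u x z + m_fun z * v x z"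
definition psi' :: "complex \<Rightarrow> real \<Rightarrow> complex" where "psi' z x = u' x z + m_fun z * v' x z"

lemma psi_L2:
  assumes "Im z > 0"
  shows "square_integrable_from A (psi z)"
proof -
  have "\<exists>!m. (\<lambda>x. (cmod (u x z + m * v x z))\<^sup>2) integrable_on {A..}"
    using weyl_solution_exists[OF assms] weyl_solution_unique[of z]
    unfolding square_integrable_from_def by blast
  from theI'[OF this] show ?thesis
    unfolding square_integrable_from_def psi_def[abs_def] m_fun_def TW_m_def .
qed

lemma psi_sol: "schroedinger_solution A q z (psi z) (psi' z)"
  unfolding psi_def[abs_def] psi'_def[abs_def] by (rule combination_sol)

lemma psi_cont: "continuous_on {A..} (psi z)"
  using schroedinger_solutionD(3)[OF psi_sol] .

lemma psi_init: "psi z A = 1" "psi' z A = m_fun z"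
  by (simp_all add: psi_def psi'_def init)

definition psi_norm2 :: "complex \<Rightarrow> real" where "psi_norm2 z = integral {A..} (\<lambda>x. (cmod (psi z x))\<^sup>2)"

lemma psi_norm2_nonneg: "Im z > 0 \<Longrightarrow> psi_norm2 z \<ge> 0"
  unfolding psi_norm2_def using psi_L2[of z] by (intro integral_nonneg) (auto simp: square_integrable_from_def)

text \<open>At A the Wronskian of two Weyl solutions is the difference of their m values. Continuity
  and holomorphy of m in z are read off from this identity and its conjugate form.\<close>

lemma m_diff:
  assumes "Im z > 0" "Im w > 0"
  shows "m_fun z - m_fun w = (z - w) * integral {A..} (\<lambda>x. psi z x * psi w x)"
  using lagrange_identity[OF psi_sol psi_L2[OF assms(1)] psi_sol psi_L2[OF assms(2)]]
  by (simp add: wronskian_def psi_init)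

lemma m_diff_cnj:
  assumes "Im z > 0" "Im w > 0"
  shows "m_fun z - cnj (m_fun w) = (z - cnj w) * integral {A..} (\<lambda>x. psi z x * cnj (psi w x))"
proof -
  have "square_integrable_from A (\<lambda>x. cnj (psi w x))"
    using psi_L2[OF assms(2)] by (simp add: square_integrable_from_def)
  from lagrange_identity[OF psi_sol psi_L2[OF assms(1)] schroedinger_solution_cnj[OF psi_sol] this]
  show ?thesis by (simp add: wronskian_def psi_init)
qed

lemma Im_m_fun:
  assumes z: "Im z > 0"
  shows "Im (m_fun z) = Im z * psi_norm2 z"
proof -
  have "integral {A..} (\<lambda>x. psi z x * cnj (psi z x)) = of_real (psi_norm2 z)"
  proof -
    have "(\<lambda>x. (cmod (psi z x))\<^sup>2) integrable_on {A..}"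
      using psi_L2[OF z] by (simp add: square_integrable_from_def)
    from has_integral_of_real[OF integrable_integral[OF this], where 'b=complex]
    have "((\<lambda>x. psi z x * cnj (psi z x)) has_integral of_real (psi_norm2 z)) {A..}"
      by (simp only: psi_norm2_def complex_norm_square)
    then show ?thesis by (rule integral_unique)
  qed
  with m_diff_cnj[OF z z] have "m_fun z - cnj (m_fun z) = (z - cnj z) * of_real (psi_norm2 z)" by simp
  from arg_cong[OF this, of Im] show ?thesis by simp
qed

lemma m_diff_bound:
  assumes z: "Im z > 0" and w: "Im w > 0" and t: "t > 0"
  shows "cmod (m_fun z - m_fun w) \<le> cmod (z - w) * ((t * psi_norm2 z + psi_norm2 w / t) / 2)"
  unfolding m_diff[OF z w] norm_mult psi_norm2_def
  by (intro mult_left_mono square_integrable_product_bound psi_L2 psi_cont z w t) auto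

lemma psi_norm2_le:
  assumes "Im z > 0"
  shows "psi_norm2 z \<le> cmod (m_fun z) / Im z"
proof -
  have "Im z * psi_norm2 z \<le> cmod (m_fun z)"
    using Im_m_fun[OF assms] abs_Im_le_cmod[of "m_fun z"] by linarith
  then show ?thesis using assms by (simp add: pos_le_divide_eq mult.commute)
qed

text \<open>Comparison with the point i. With weight |z - i| / Im z the norm of \<open>psi z\<close>
  enters as Im z times \<open>psi_norm2 z\<close> over 2, which is Im m / 2 and hence at most half
  of |m|; it is absorbed on the left.\<close>

lemma m_fun_bound:
  assumes z: "Im z > 0"
  shows "cmod (m_fun z) \<le> 2 * cmod (m_fun \<i>) + (cmod (z - \<i>))\<^sup>2 * psi_norm2 \<i> / Im z"
proof (cases "z = \<i>")
  case False
  define d where "d = cmod (z - \<i>)"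
  have d: "d > 0" using False by (simp add: d_def)
  define D where "D = d\<^sup>2 * psi_norm2 \<i> / Im z"
  define t where "t = d / Im z"
  have t: "t > 0" using d z by (simp add: t_def)
  have "cmod (m_fun \<i> - m_fun z) \<le> d * ((t * psi_norm2 \<i> + psi_norm2 z / t) / 2)"
    using m_diff_bound[of \<i> z t] z t by (simp add: d_def norm_minus_commute)
  also have "\<dots> = D / 2 + Im z * psi_norm2 z / 2"
    using d z by (simp add: t_def D_def power2_eq_square field_simps)
  also have "Im z * psi_norm2 z \<le> cmod (m_fun z)"
    using Im_m_fun[OF z] abs_Im_le_cmod[of "m_fun z"] by linarith
  finally have "cmod (m_fun \<i> - m_fun z) \<le> D / 2 + cmod (m_fun z) / 2"
    by simp
  moreover have "cmod (m_fun z) \<le> cmod (m_fun \<i>) + cmod (m_fun \<i> - m_fun z)"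
    by (metis norm_minus_commute norm_triangle_sub)
  ultimately have "cmod (m_fun z) \<le> 2 * cmod (m_fun \<i>) + D" by linarith
  then show ?thesis by (simp only: D_def d_def)
qed simp

text \<open>On the disc of radius Im z / 2 all points stay at height above Im z / 2, so
  \<open>m_fun_bound\<close> bounds the norms of the Weyl solutions uniformly by K and
  \<open>m_diff_bound\<close> becomes a Lipschitz estimate at z.\<close>

lemma m_fun_isCont:
  assumes z: "Im z > 0"
  shows "isCont m_fun z"
proof -
  define h where "h = Im z / 2"
  have h: "h > 0" using z by (simp add: h_def)
  define K where "K = (2 * cmod (m_fun \<i>) + (cmod (z - \<i>) + h)\<^sup>2 * psi_norm2 \<i> / h) / h"
  have near: "cmod (m_fun w - m_fun z) \<le> cmod (w - z) * ((K + psi_norm2 z) / 2)" if w: "cmod (w - z) < h" for w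
  proof -
    have "\<bar>Im (w - z)\<bar> < h" using abs_Im_le_cmod[of "w - z"] w by linarith
    then have "Im z - Im w < h" by (simp add: abs_less_iff)
    then have Imw: "Im w > h" "Im w > 0" using z unfolding h_def by linarith+
    have "psi_norm2 w \<le> cmod (m_fun w) / Im w" by (rule psi_norm2_le[OF Imw(2)])
    also have "\<dots> \<le> (2 * cmod (m_fun \<i>) + (cmod (z - \<i>) + h)\<^sup>2 * psi_norm2 \<i> / h) / h"
    proof (rule frac_le)
      have "cmod (w - \<i>) \<le> cmod (z - \<i>) + h"
        using norm_triangle_ineq[of "w - z" "z - \<i>"] w by simp
      then have "(cmod (w - \<i>))\<^sup>2 * psi_norm2 \<i> / Im w \<le> (cmod (z - \<i>) + h)\<^sup>2 * psi_norm2 \<i> / h"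
        using psi_norm2_nonneg[of \<i>] Imw h by (intro frac_le mult_right_mono power_mono mult_nonneg_nonneg) auto
      then show "cmod (m_fun w) \<le> 2 * cmod (m_fun \<i>) + (cmod (z - \<i>) + h)\<^sup>2 * psi_norm2 \<i> / h"
        using m_fun_bound[OF Imw(2)] by linarith
    qed (use Imw h psi_norm2_nonneg[of \<i>] in auto)
    finally have "psi_norm2 w \<le> K" by (simp add: K_def)
    have "cmod (m_fun w - m_fun z) \<le> cmod (w - z) * ((1 * psi_norm2 w + psi_norm2 z / 1) / 2)"
      by (rule m_diff_bound) (use Imw z in auto)
    also have "\<dots> \<le> cmod (w - z) * ((K + psi_norm2 z) / 2)"
      using \<open>psi_norm2 w \<le> K\<close> by (intro mult_left_mono) auto
    finally show ?thesis .
  qed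
  have "((\<lambda>w. m_fun w - m_fun z) \<longlongrightarrow> 0) (at z)"
  proof (rule Lim_null_comparison)
    show "\<forall>\<^sub>F w in at z. cmod (m_fun w - m_fun z) \<le> cmod (w - z) * ((K + psi_norm2 z) / 2)"
      unfolding eventually_at using h near by (intro exI[of _ h]) (auto simp: dist_norm)
    have "((\<lambda>w. cmod (w - z) * ((K + psi_norm2 z) / 2)) \<longlongrightarrow> cmod (z - z) * ((K + psi_norm2 z) / 2)) (at z)"
      by (intro tendsto_intros)
    then show "((\<lambda>w. cmod (w - z) * ((K + psi_norm2 z) / 2)) \<longlongrightarrow> 0) (at z)" by simp
  qed
  then show ?thesis by (simp add: isCont_def LIM_zero_iff)
qed

text \<open>Expanding the square leaves a cross term that \<open>m_diff_cnj\<close> evaluates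
  through m. Thus continuity of m already implies L2 continuity of the Weyl solutions.\<close>

lemma psi_diff_norm:
  assumes z: "Im z > 0" and w: "Im w > 0"
  shows "square_integrable_from A (\<lambda>x. psi w x - psi z x)"
    and "integral {A..} (\<lambda>x. (cmod (psi w x - psi z x))\<^sup>2) =
      psi_norm2 w + psi_norm2 z - 2 * Re ((m_fun w - cnj (m_fun z)) / (w - cnj z))"
proof -
  have ai: "(\<lambda>x. psi w x * cnj (psi z x)) integrable_on {A..}"
    by (rule set_lebesgue_integral_eq_integral(1)[OF square_integrable_product])
       (use psi_L2 psi_cont z w in \<open>auto simp: square_integrable_from_def intro!: continuous_intros\<close>)
  have ne: "w - cnj z \<noteq> 0" using z w by (auto simp: complex_eq_iff)
  have val: "integral {A..} (\<lambda>x. psi w x * cnj (psi z x)) = (m_fun w - cnj (m_fun z)) / (w - cnj z)"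
    using m_diff_cnj[OF w z] ne by (simp add: field_simps)
  have "((\<lambda>x. Re (psi w x * cnj (psi z x))) has_integral Re ((m_fun w - cnj (m_fun z)) / (w - cnj z))) {A..}"
    using has_integral_Re[OF integrable_integral[OF ai]] by (simp only: val)
  moreover have "((\<lambda>x. (cmod (psi w x))\<^sup>2) has_integral psi_norm2 w) {A..}"
     "((\<lambda>x. (cmod (psi z x))\<^sup>2) has_integral psi_norm2 z) {A..}"
    using psi_L2[OF w] psi_L2[OF z] unfolding psi_norm2_def square_integrable_from_def
    by (auto intro: integrable_integral)
  ultimately have "((\<lambda>x. (cmod (psi w x))\<^sup>2 + (cmod (psi z x))\<^sup>2 - 2 * Re (psi w x * cnj (psi z x))) has_integral
      psi_norm2 w + psi_norm2 z - 2 * Re ((m_fun w - cnj (m_fun z)) / (w - cnj z))) {A..}"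
    by (intro has_integral_diff has_integral_add has_integral_mult_right)
  moreover have "(cmod (psi w x))\<^sup>2 + (cmod (psi z x))\<^sup>2 - 2 * Re (psi w x * cnj (psi z x)) = (cmod (psi w x - psi z x))\<^sup>2" for x
    unfolding cmod_power2 by (simp add: power2_eq_square algebra_simps)
  ultimately have *: "((\<lambda>x. (cmod (psi w x - psi z x))\<^sup>2) has_integral
      psi_norm2 w + psi_norm2 z - 2 * Re ((m_fun w - cnj (m_fun z)) / (w - cnj z))) {A..}" by simp
  then show "square_integrable_from A (\<lambda>x. psi w x - psi z x)"
    unfolding square_integrable_from_def by blast
  show "integral {A..} (\<lambda>x. (cmod (psi w x - psi z x))\<^sup>2) =
      psi_norm2 w + psi_norm2 z - 2 * Re ((m_fun w - cnj (m_fun z)) / (w - cnj z))"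
    by (rule integral_unique[OF *])
qed

lemma psi_diff_norm_tendsto_0:
  assumes z: "Im z > 0"
  shows "((\<lambda>w. integral {A..} (\<lambda>x. (cmod (psi w x - psi z x))\<^sup>2)) \<longlongrightarrow> 0) (at z)"
proof -
  have ne: "z - cnj z \<noteq> 0" using z by (auto simp: complex_eq_iff)
  have cont: "(m_fun \<longlongrightarrow> m_fun z) (at z)" using m_fun_isCont[OF z] by (simp add: isCont_def)
  have "((\<lambda>w. Im (m_fun w) / Im w + psi_norm2 z - 2 * Re ((m_fun w - cnj (m_fun z)) / (w - cnj z))) \<longlongrightarrow>
      Im (m_fun z) / Im z + psi_norm2 z - 2 * Re ((m_fun z - cnj (m_fun z)) / (z - cnj z))) (at z)"
    using z ne by (intro tendsto_intros cont) auto
  moreover have "(m_fun z - cnj (m_fun z)) / (z - cnj z) = of_real (psi_norm2 z)"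
    using Im_m_fun[OF z] z by (simp add: complex_diff_cnj field_simps)
  moreover have "Im (m_fun z) / Im z = psi_norm2 z" using Im_m_fun[OF z] z by simp
  ultimately have "((\<lambda>w. Im (m_fun w) / Im w + psi_norm2 z - 2 * Re ((m_fun w - cnj (m_fun z)) / (w - cnj z))) \<longlongrightarrow> 0) (at z)"
    by simp
  then show ?thesis
  proof (rule Lim_transform_eventually)
    have "\<forall>\<^sub>F w in at z. w \<in> {w. 0 < Im w}"
      by (rule eventually_at_in_open'[OF open_halfspace_Im_gt[of 0]]) (use z in auto)
    then show "\<forall>\<^sub>F w in at z. Im (m_fun w) / Im w + psi_norm2 z - 2 * Re ((m_fun w - cnj (m_fun z)) / (w - cnj z)) =
        integral {A..} (\<lambda>x. (cmod (psi w x - psi z x))\<^sup>2)"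
      by (rule eventually_mono) (use Im_m_fun psi_diff_norm(2)[OF z] in auto)
  qed
qed

text \<open>By \<open>m_diff\<close> the difference quotient equals the integral of the product of
  \<open>psi z\<close> and \<open>psi w\<close>, so L2 convergence of the second factor
  suffices.\<close>

lemma m_fun_deriv:
  assumes z: "Im z > 0"
  shows "(m_fun has_field_derivative integral {A..} (\<lambda>x. psi z x * psi z x)) (at z)"
  unfolding has_field_derivative_iff
proof (rule tendstoI)
  let ?I = "\<lambda>w. integral {A..} (\<lambda>x. psi z x * psi w x)"
  fix e :: real assume e: "e > 0"
  \<comment> \<open>This weight makes the fixed norm contribute less than e; the squared distance of
    the Weyl solutions is then required to be below e t.\<close>
  define t where "t = e / (psi_norm2 z + 1)"
  have t: "t > 0" using e psi_norm2_nonneg[OF z] by (simp add: t_def)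
  have tn: "t * psi_norm2 z < e"
    using e psi_norm2_nonneg[OF z] by (simp add: t_def field_simps)
  have "\<forall>\<^sub>F w in at z. dist (integral {A..} (\<lambda>x. (cmod (psi w x - psi z x))\<^sup>2)) 0 < e * t"
    by (rule tendstoD[OF psi_diff_norm_tendsto_0[OF z]]) (use e t in simp)
  moreover have "\<forall>\<^sub>F w in at z. w \<in> {w. 0 < Im w}"
    by (rule eventually_at_in_open'[OF open_halfspace_Im_gt[of 0]]) (use z in auto)
  moreover have "\<forall>\<^sub>F w in at z. w \<noteq> z" by (simp add: eventually_at_filter)
  ultimately show "\<forall>\<^sub>F w in at z. dist ((m_fun w - m_fun z) / (w - z)) (?I z) < e"
  proof eventually_elim
    case (elim w)
    then have w: "Im w > 0" "w \<noteq> z" by auto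
    have small: "integral {A..} (\<lambda>x. (cmod (psi w x - psi z x))\<^sup>2) < e * t" using elim(1) by simp
    have "(m_fun w - m_fun z) / (w - z) = integral {A..} (\<lambda>x. psi w x * psi z x)"
      using m_diff[OF w(1) z] w by simp
    also have "\<dots> = ?I w" by (simp add: mult.commute)
    finally have quot: "(m_fun w - m_fun z) / (w - z) = ?I w" .
    have int: "(\<lambda>x. psi z x * psi w x) integrable_on {A..}" if "Im w > 0" for w
      by (rule set_lebesgue_integral_eq_integral(1)[OF square_integrable_product])
         (use psi_L2 psi_cont z that in auto)
    have eq: "?I w - ?I z = integral {A..} (\<lambda>x. psi z x * (psi w x - psi z x))"
      using integral_diff[OF int[OF w(1)] int[OF z]] by (simp add: algebra_simps)
    have "cmod (?I w - ?I z) \<le> (t * psi_norm2 z + integral {A..} (\<lambda>x. (cmod (psi w x - psi z x))\<^sup>2) / t) / 2"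
      unfolding psi_norm2_def eq
      by (intro square_integrable_product_bound psi_L2 psi_cont psi_diff_norm(1) z w t continuous_intros)
    also have "\<dots> < (e + e) / 2"
    proof -
      have "integral {A..} (\<lambda>x. (cmod (psi w x - psi z x))\<^sup>2) / t < e"
        using small t by (simp add: pos_divide_less_eq)
      then show ?thesis using tn by simp
    qed
    finally show ?case by (simp add: quot dist_norm)
  qed
qed

lemma m_fun_holomorphic: "m_fun holomorphic_on {z. 0 < Im z}"
  using m_fun_deriv unfolding holomorphic_on_def field_differentiable_def
  by (metis has_field_derivative_at_within mem_Collect_eq)

end

section \<open>Spectral function and density\<close>

text \<open>The Appell system is the evolution of the coefficients that compensates the motion of
  (y, y'). For v, with initial data (0, 1), the constant is R(A), which gives the last formula of
  the theorem.\<close>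

lemma appell_quadratic_form_constant:
  assumes U: "appell_solution A q l P Q R"
    and y: "schroedinger_solution A q (of_real l) y y'" and x: "x \<ge> A"
  shows "of_real (P x) * (y x)\<^sup>2 + of_real (Q x) * (y x * y' x) + of_real (R x) * (y' x)\<^sup>2 =
    of_real (P A) * (y A)\<^sup>2 + of_real (Q A) * (y A * y' A) + of_real (R A) * (y' A)\<^sup>2"
proof -
  let ?F = "\<lambda>x. of_real (P x) * (y x * y x) + of_real (Q x) * (y x * y' x) + of_real (R x) * (y' x * y' x)"
  note D = appell_solutionD[OF U] and Dy = schroedinger_solutionD[OF y]
  have "\<exists>c. \<forall>x\<in>{A..}. ?F x = c"
  proof (rule has_derivative_zero_constant)
    fix x assume "x \<in> {A..}"
    then have x: "x \<ge> A" by simp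
    have "(?F has_vector_derivative
       of_real (P x) * (y x * y' x + y' x * y x) + of_real ((l - q x) * Q x) * (y x * y x) +
       (of_real (Q x) * (y x * ((of_real (q x) - of_real l) * y x) + y' x * y' x) +
         of_real (- 2 * P x + 2 * (l - q x) * R x) * (y x * y' x)) +
       (of_real (R x) * (y' x * ((of_real (q x) - of_real l) * y x) + (of_real (q x) - of_real l) * y x * y' x) +
         of_real (- Q x) * (y' x * y' x))) (at x within {A..})"
      by (intro has_vector_derivative_add has_vector_derivative_mult has_vector_derivative_of_real D Dy x)
    then have "(?F has_vector_derivative 0) (at x within {A..})"
      by (rule has_vector_derivative_eq_rhs) (simp add: algebra_simps)
    then show "(?F has_derivative (\<lambda>h. 0)) (at x within {A..})"
      by (simp add: has_vector_derivative_def)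
  qed simp
  then obtain c where "\<And>x. x \<ge> A \<Longrightarrow> ?F x = c" by auto
  from this[OF x] this[of A] show ?thesis by (simp add: power2_eq_square)
qed

lemma lipschitz_imp_abs_cont_on:
  fixes f :: "real \<Rightarrow> real"
  assumes "\<And>x y. x \<in> S \<Longrightarrow> y \<in> S \<Longrightarrow> x \<le> y \<Longrightarrow> \<bar>f y - f x\<bar> \<le> K * (y - x)"
  shows "abs_cont_on S f"
  unfolding abs_cont_on_def
proof (intro allI impI)
  fix e :: real assume e: "e > 0"
  define d where "d = e / (\<bar>K\<bar> + 1)"
  have "d > 0" using e by (simp add: d_def)
  moreover have "(\<Sum>k<n. \<bar>f (b k) - f (a k)\<bar>) < e"
    if ab: "\<forall>k<n. a k \<le> b k \<and> {a k..b k} \<subseteq> S" and lt: "(\<Sum>k<n. b k - a k) < d" for n :: nat and a b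
  proof -
    have "(\<Sum>k<n. \<bar>f (b k) - f (a k)\<bar>) \<le> (\<Sum>k<n. (\<bar>K\<bar> + 1) * (b k - a k))"
    proof (rule sum_mono)
      fix k assume "k \<in> {..<n}"
      then have k: "a k \<le> b k" "{a k..b k} \<subseteq> S" using ab by auto
      then have "\<bar>f (b k) - f (a k)\<bar> \<le> K * (b k - a k)" by (intro assms) auto
      also have "\<dots> \<le> (\<bar>K\<bar> + 1) * (b k - a k)" using k by (intro mult_right_mono) auto
      finally show "\<bar>f (b k) - f (a k)\<bar> \<le> (\<bar>K\<bar> + 1) * (b k - a k)" .
    qed
    also have "\<dots> = (\<bar>K\<bar> + 1) * (\<Sum>k<n. b k - a k)" by (simp add: sum_distrib_left)
    also have "\<dots> < (\<bar>K\<bar> + 1) * d" using lt by (intro mult_strict_left_mono) auto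
    also have "\<dots> = e" by (simp add: d_def)
    finally show ?thesis .
  qed
  ultimately show "\<exists>d>0. \<forall>(n::nat) a b.
        (\<forall>k<n. a k \<le> b k \<and> {a k..b k} \<subseteq> S) \<and>
        (\<forall>i<n. \<forall>j<n. i \<noteq> j \<longrightarrow> b i \<le> a j \<or> b j \<le> a i) \<and>
        (\<Sum>k<n. b k - a k) < d
        \<longrightarrow> (\<Sum>k<n. \<bar>f (b k) - f (a k)\<bar>) < e" by blast
qed

locale spectral_problem = weyl_problem +
  fixes q' :: "real \<Rightarrow> real" and X0 :: real and P1 Q1 R1 :: "real \<Rightarrow> real \<Rightarrow> real"
  assumes q_cond: "q absolutely_integrable_on {X0..} \<or>
      (q' absolutely_integrable_on {X0..} \<and>
       (\<forall>x\<ge>X0. (q has_real_derivative q' x) (at x within {X0..})) \<and> (q \<longlongrightarrow> 0) at_top)"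
    and q_cont: "continuous_on {A..} q"
    and family: "\<And>l. l > 0 \<Longrightarrow> appell_solution A q l (\<lambda>x. P1 x l) (\<lambda>x. Q1 x l) (\<lambda>x. R1 x l)"
begin

text \<open>The limit of m at l. In terms of the representation, Q1(A) = -tb and R1(A) = ta, so this
  number is tb/(2 ta) + i/ta.\<close>

definition boundary_value :: "real \<Rightarrow> complex" where
  "boundary_value l = Complex (- Q1 A l / (2 * R1 A l)) (1 / R1 A l)"

text \<open>Uniformity in l holds because M depends only on [a, b], and X only on a and the required
  accuracy; the condition on \<epsilon> then involves just these.\<close>

lemma m_fun_uniform_boundary_limit:
  assumes a: "0 < a" and e: "e > 0"
  shows "\<exists>\<epsilon>\<^sub>0>0. \<forall>l\<in>{a..b}. \<forall>\<epsilon>. 0 < \<epsilon> \<longrightarrow> \<epsilon> < \<epsilon>\<^sub>0 \<longrightarrow> cmod (m_fun (of_real l + \<i> * of_real \<epsilon>) - boundary_value l) < e"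
proof -
  obtain M where M: "M > 0" "\<And>l P Q R x. l \<in> {a..b} \<Longrightarrow> appell_solution A q l P Q R \<Longrightarrow> x \<ge> A \<Longrightarrow> P x \<le> M \<and> R x \<le> M"
    using appell_uniformly_bounded[OF q_cond q_cont a, of b] by auto
  \<comment> \<open>The second entry gives 6 \<tau> M^2 <= e^2 / 2; the first is the absorption
    threshold of \<open>weyl_solution_near_boundary_value\<close>.\<close>
  define \<tau> where "\<tau> = min (1 / 4) (e\<^sup>2 / (12 * M\<^sup>2))"
  have \<tau>: "0 < \<tau>" "\<tau> \<le> 1 / 4" "\<tau> \<le> e\<^sup>2 / (12 * M\<^sup>2)" using e M by (simp_all add: \<tau>_def)
  have \<tau>e: "6 * \<tau> * M\<^sup>2 < e\<^sup>2"
  proof -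
    have "12 * M\<^sup>2 * \<tau> \<le> e\<^sup>2" using \<tau>(3) M by (simp add: pos_le_divide_eq mult_ac)
    moreover have "0 < e\<^sup>2" using e by simp
    moreover have "6 * \<tau> * M\<^sup>2 = 12 * M\<^sup>2 * \<tau> / 2" by simp
    ultimately show ?thesis by linarith
  qed
  \<comment> \<open>Makes 48 d^2 = \<tau>/2, leaving the other half of \<tau> to the term of order
    \<epsilon>.\<close>
  define d where "d = sqrt (\<tau> / 96)"
  have d: "0 < d" "48 * d\<^sup>2 = \<tau> / 2" using \<tau> by (simp_all add: d_def)
  have "d\<^sup>2 \<le> 1\<^sup>2" using d(2) \<tau> by simp
  then have d1: "d \<le> 1" by (rule power2_le_imp_le) simp
  have d8: "d / 8 > 0" using d by simp
  from appell_uniform_asymptotics[OF q_cond a d8, of A] obtain X where X: "X \<ge> A"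
    and asym: "\<And>l P Q R x. l \<ge> a \<Longrightarrow> appell_solution A q l P Q R \<Longrightarrow> x \<ge> X \<Longrightarrow> \<bar>l * (R x)\<^sup>2 - 1\<bar> \<le> d / 8"
    by auto
  define L where "L = M * (X - A) + 1"
  have L: "L > 0" "M * (X - A) \<le> L" using M X by (simp_all add: L_def add_nonneg_pos)
  \<comment> \<open>The first entry ensures \<epsilon>/l <= d, the second 12 \<epsilon> M (X - A) <=
    \<tau>/2. Adding 1 in L keeps the quotient meaningful when X = A.\<close>
  define \<epsilon>\<^sub>0 where "\<epsilon>\<^sub>0 = min (a * d) (\<tau> / (24 * L))"
  have \<epsilon>0: "\<epsilon>\<^sub>0 > 0" using a d \<tau> L by (simp add: \<epsilon>\<^sub>0_def)
  have "cmod (m_fun (of_real l + \<i> * of_real \<epsilon>) - boundary_value l) < e"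
    if l: "l \<in> {a..b}" and \<epsilon>: "0 < \<epsilon>" "\<epsilon> < \<epsilon>\<^sub>0" for l \<epsilon>
  proof -
    have l0: "l > 0" "l \<ge> a" using l a by auto
    note U = family[OF l0(1)]
    have "\<epsilon> \<le> a * d" "\<epsilon> \<le> \<tau> / (24 * L)" using \<epsilon> by (simp_all add: \<epsilon>\<^sub>0_def)
    have "a * d \<le> l * d" using l0 d by simp
    then have \<epsilon>ld: "\<epsilon> \<le> l * d" using \<open>\<epsilon> \<le> a * d\<close> by linarith
    have "l * d \<le> l" using d1 l0 by simp
    then have \<epsilon>l: "\<epsilon> \<le> l" using \<epsilon>ld by linarith
    have \<epsilon>d: "\<epsilon> / l \<le> d" using \<epsilon>ld l0 by (simp add: pos_divide_le_eq mult.commute)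
    have "24 * (\<epsilon> * L) \<le> \<tau>" using \<open>\<epsilon> \<le> \<tau> / (24 * L)\<close> L by (simp add: pos_le_divide_eq mult_ac)
    moreover have "\<epsilon> * (M * (X - A)) \<le> \<epsilon> * L" using L \<epsilon> by (intro mult_left_mono) auto
    ultimately have sm: "24 * (\<epsilon> * M * (X - A)) \<le> \<tau>" by (simp add: mult.assoc)
    have small: "\<epsilon> * M * (X - A) \<le> 1" and \<tau>1: "48 * d\<^sup>2 + 12 * (\<epsilon> * M * (X - A)) \<le> \<tau>"
      using sm \<tau> d(2) by linarith+
    have Imz: "Im (of_real l + \<i> * of_real \<epsilon>) > 0" using \<epsilon> by simp
    have "(cmod (psi' (of_real l + \<i> * of_real \<epsilon>) A - Complex (- Q1 A l / (2 * R1 A l)) (1 / R1 A l)))\<^sup>2 \<le> 6 * \<tau> * M\<^sup>2"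
      by (rule weyl_solution_near_boundary_value[OF U l0(1) _ _ d(1) d1 X _ \<epsilon>(1) \<epsilon>l \<epsilon>d small \<tau>1 \<tau>(2) psi_sol psi_L2[OF Imz] psi_init(1)])
         (use M(2)[OF l U] asym[OF l0(2) U] in auto)
    also have "\<dots> < e\<^sup>2" by (rule \<tau>e)
    finally show ?thesis
      unfolding psi_init boundary_value_def by (rule power_less_imp_less_base) (use e in simp)
  qed
  then show ?thesis using \<epsilon>0 by blast
qed

section \<open>Density and spectral function\<close>

definition density :: "real \<Rightarrow> real" where "density l = 1 / R1 A l"

lemma Im_m_fun_uniform_limit:
  assumes "0 < a" "e > 0"
  shows "\<exists>\<epsilon>\<^sub>0>0. \<forall>l\<in>{a..b}. \<forall>\<epsilon>. 0 < \<epsilon> \<longrightarrow> \<epsilon> < \<epsilon>\<^sub>0 \<longrightarrow> \<bar>Im (m_fun (of_real l + \<i> * of_real \<epsilon>)) - density l\<bar> < e"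
proof -
  have "\<bar>Im w - density l\<bar> \<le> cmod (w - boundary_value l)" for w l
    using abs_Im_le_cmod[of "w - boundary_value l"] by (simp add: boundary_value_def density_def)
  then show ?thesis
    using m_fun_uniform_boundary_limit[OF assms, of b] by (meson le_less_trans)
qed

lemma Im_m_fun_tendsto:
  assumes l: "l > 0"
  shows "((\<lambda>\<epsilon>. Im (m_fun (of_real l + \<i> * of_real \<epsilon>))) \<longlongrightarrow> density l) (at_right 0)"
proof (rule tendstoI)
  fix e :: real assume "e > 0"
  from Im_m_fun_uniform_limit[OF l this, of l] obtain \<epsilon>\<^sub>0 where "\<epsilon>\<^sub>0 > 0"
    "\<And>\<epsilon>. 0 < \<epsilon> \<Longrightarrow> \<epsilon> < \<epsilon>\<^sub>0 \<Longrightarrow> \<bar>Im (m_fun (of_real l + \<i> * of_real \<epsilon>)) - density l\<bar> < e" by auto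
  then show "\<forall>\<^sub>F \<epsilon> in at_right 0. dist (Im (m_fun (of_real l + \<i> * of_real \<epsilon>))) (density l) < e"
    by (intro eventually_at_rightI[of 0 \<epsilon>\<^sub>0]) (auto simp: dist_real_def)
qed

lemma Im_m_fun_line_continuous:
  assumes "\<epsilon> > 0"
  shows "continuous_on S (\<lambda>t. Im (m_fun (of_real t + \<i> * of_real \<epsilon>)))"
  by (intro continuous_intros continuous_on_compose2[OF holomorphic_on_imp_continuous_on[OF m_fun_holomorphic]])
     (use assms in auto)

text \<open>Continuity of R1 at A in the spectral parameter comes from the uniform limit of the
  continuous functions Im m, without an argument on parameter dependence of the Appell
  system.\<close>

lemma density_continuous:
  assumes a: "0 < a"
  shows "continuous_on {a..b} density"
proof (rule uniform_limit_theorem)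
  let ?f = "\<lambda>\<epsilon> t. Im (m_fun (of_real t + \<i> * of_real \<epsilon>))"
  show "\<forall>\<^sub>F \<epsilon> in at_right 0. continuous_on {a..b} (?f \<epsilon>)"
    by (intro eventually_at_rightI[of 0 1]) (auto intro: Im_m_fun_line_continuous)
  show "uniform_limit {a..b} ?f density (at_right 0)"
  proof (rule uniform_limitI)
    fix e :: real assume "e > 0"
    from Im_m_fun_uniform_limit[OF a this, of b] obtain \<epsilon>\<^sub>0 where "\<epsilon>\<^sub>0 > 0"
      "\<And>l \<epsilon>. l \<in> {a..b} \<Longrightarrow> 0 < \<epsilon> \<Longrightarrow> \<epsilon> < \<epsilon>\<^sub>0 \<Longrightarrow> \<bar>?f \<epsilon> l - density l\<bar> < e" by blast
    then show "\<forall>\<^sub>F \<epsilon> in at_right 0. \<forall>l\<in>{a..b}. dist (?f \<epsilon> l) (density l) < e"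
      by (intro eventually_at_rightI[of 0 \<epsilon>\<^sub>0]) (auto simp: dist_real_def)
  qed
qed simp

lemma integral_Im_m_fun_tendsto:
  assumes a: "0 < a" and ab: "a \<le> b"
  shows "((\<lambda>\<epsilon>. integral {a..b} (\<lambda>t. Im (m_fun (of_real t + \<i> * of_real \<epsilon>)))) \<longlongrightarrow> integral {a..b} density) (at_right 0)"
proof (rule tendstoI)
  let ?f = "\<lambda>\<epsilon> t. Im (m_fun (of_real t + \<i> * of_real \<epsilon>))"
  fix e :: real assume e: "e > 0"
  define d where "d = e / (b - a + 1)"
  have d: "d > 0" using e ab by (simp add: d_def)
  from Im_m_fun_uniform_limit[OF a this, of b] obtain \<epsilon>\<^sub>0 where \<epsilon>0: "\<epsilon>\<^sub>0 > 0"
    "\<And>l \<epsilon>. l \<in> {a..b} \<Longrightarrow> 0 < \<epsilon> \<Longrightarrow> \<epsilon> < \<epsilon>\<^sub>0 \<Longrightarrow> \<bar>?f \<epsilon> l - density l\<bar> < d" by blast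
  have gi: "density integrable_on {a..b}" by (rule integrable_continuous_real[OF density_continuous[OF a]])
  show "\<forall>\<^sub>F \<epsilon> in at_right 0. dist (integral {a..b} (?f \<epsilon>)) (integral {a..b} density) < e"
  proof (rule eventually_at_rightI[of 0 \<epsilon>\<^sub>0])
    fix \<epsilon> assume \<epsilon>: "\<epsilon> \<in> {0<..<\<epsilon>\<^sub>0}"
    have fi: "?f \<epsilon> integrable_on {a..b}"
      by (rule integrable_continuous_real[OF Im_m_fun_line_continuous]) (use \<epsilon> in auto)
    have "norm (integral {a..b} (\<lambda>t. ?f \<epsilon> t - density t)) \<le> integral {a..b} (\<lambda>_. d)"
      by (rule integral_norm_bound_integral[OF integrable_diff[OF fi gi]])
         (use \<epsilon>0(2) \<epsilon> in \<open>auto intro: less_imp_le\<close>)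
    also have "\<dots> = d * (b - a)" using ab by simp
    also have "\<dots> < d * (b - a + 1)" using d by simp
    also have "\<dots> = e" using ab by (simp add: d_def)
    finally show "dist (integral {a..b} (?f \<epsilon>)) (integral {a..b} density) < e"
      using integral_diff[OF fi gi] by (simp add: dist_real_def)
  qed (rule \<epsilon>0(1))
qed

lemma spec_integral_eq:
  assumes "0 \<le> l"
  shows "spec_integral u v A l \<epsilon> = 1 / pi * integral {0..l} (\<lambda>t. Im (m_fun (of_real t + \<i> * of_real \<epsilon>)))"
  using assms by (simp add: spec_integral_def m_fun_def)

text \<open>Since \<open>spec_fun\<close> is a \<open>Lim\<close>, its values can be used only once
  convergence is known. The integral reaches down to 0, where the boundary limit of m is not
  controlled, so the Herglotz argument is used instead.\<close>

lemma spec_integral_tendsto: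
  assumes l: "0 \<le> l"
  shows "(spec_integral u v A l \<longlongrightarrow> spec_fun u v A l) (at_right 0)"
proof -
  have "\<exists>L. ((\<lambda>\<epsilon>. integral {0..l} (\<lambda>t. Im (m_fun (of_real t + \<i> * of_real \<epsilon>)))) \<longlongrightarrow> L) (at_right 0)"
  proof (rule stieltjes_inversion_limit[OF m_fun_holomorphic _ _ l])
    show "0 \<le> Im (m_fun z)" if "0 < Im z" for z
      using that psi_norm2_nonneg[OF that] by (simp add: Im_m_fun)
    fix r :: real
    have "cmod (m_fun z) \<le> (2 * cmod (m_fun \<i>) + (r + 1)\<^sup>2 * psi_norm2 \<i>) / Im z"
      if z: "\<bar>Re z\<bar> \<le> r" "0 < Im z" "Im z \<le> 1" for z
    proof -
      have "cmod (z - \<i>) \<le> \<bar>Re z\<bar> + \<bar>Im z - 1\<bar>" using cmod_le[of "z - \<i>"] by simp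
      also have "\<dots> \<le> r + 1" using z by simp
      finally have "(cmod (z - \<i>))\<^sup>2 * psi_norm2 \<i> / Im z \<le> (r + 1)\<^sup>2 * psi_norm2 \<i> / Im z"
        using z psi_norm2_nonneg[of \<i>] by (intro divide_right_mono mult_right_mono power_mono) auto
      moreover have "2 * cmod (m_fun \<i>) \<le> 2 * cmod (m_fun \<i>) / Im z"
        using z by (simp add: pos_le_divide_eq mult_left_le)
      ultimately show ?thesis using m_fun_bound[OF z(2)] by (simp add: add_divide_distrib)
    qed
    then show "\<exists>C. \<forall>z. \<bar>Re z\<bar> \<le> r \<longrightarrow> 0 < Im z \<longrightarrow> Im z \<le> 1 \<longrightarrow> cmod (m_fun z) \<le> C / Im z" by blast
  qed
  then obtain L where "((\<lambda>\<epsilon>. integral {0..l} (\<lambda>t. Im (m_fun (of_real t + \<i> * of_real \<epsilon>)))) \<longlongrightarrow> L) (at_right 0)" ..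
  from tendsto_mult_left[OF this, of "1 / pi"]
  have lim: "(spec_integral u v A l \<longlongrightarrow> 1 / pi * L) (at_right 0)"
    by (simp only: spec_integral_eq[OF l, symmetric])
  have "spec_fun u v A l = 1 / pi * L"
    unfolding spec_fun_def by (rule tendsto_Lim[OF _ lim]) simp
  with lim show ?thesis by simp
qed

text \<open>Subtracting two convergent integrals from 0 leaves one over [a, b], which stays away
  from 0; there Im m converges uniformly to the density.\<close>

lemma spec_fun_increment:
  assumes a: "0 < a" and ab: "a \<le> b"
  shows "spec_fun u v A b - spec_fun u v A a = 1 / pi * integral {a..b} density"
proof -
  have "((\<lambda>\<epsilon>. spec_integral u v A b \<epsilon> - spec_integral u v A a \<epsilon>) \<longlongrightarrow> spec_fun u v A b - spec_fun u v A a) (at_right 0)"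
    using a ab by (intro tendsto_diff spec_integral_tendsto) auto
  moreover have "((\<lambda>\<epsilon>. spec_integral u v A b \<epsilon> - spec_integral u v A a \<epsilon>) \<longlongrightarrow> 1 / pi * integral {a..b} density) (at_right 0)"
  proof (rule Lim_transform_eventually)
    let ?f = "\<lambda>\<epsilon> t. Im (m_fun (of_real t + \<i> * of_real \<epsilon>))"
    show "((\<lambda>\<epsilon>. 1 / pi * integral {a..b} (?f \<epsilon>)) \<longlongrightarrow> 1 / pi * integral {a..b} density) (at_right 0)"
      by (intro tendsto_mult_left integral_Im_m_fun_tendsto a ab)
    show "\<forall>\<^sub>F \<epsilon> in at_right 0. 1 / pi * integral {a..b} (?f \<epsilon>) = spec_integral u v A b \<epsilon> - spec_integral u v A a \<epsilon>"
    proof (rule eventually_at_rightI[of 0 1])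
      fix \<epsilon> :: real assume "\<epsilon> \<in> {0<..<1}"
      then have "?f \<epsilon> integrable_on {0..b}"
        by (intro integrable_continuous_real Im_m_fun_line_continuous) auto
      from Henstock_Kurzweil_Integration.integral_combine[OF _ ab this] a
      have "integral {0..b} (?f \<epsilon>) = integral {0..a} (?f \<epsilon>) + integral {a..b} (?f \<epsilon>)" by simp
      then show "1 / pi * integral {a..b} (?f \<epsilon>) = spec_integral u v A b \<epsilon> - spec_integral u v A a \<epsilon>"
        using a ab by (simp add: spec_integral_eq add_divide_distrib)
    qed simp
  qed
  ultimately show ?thesis by (rule tendsto_unique[rotated]) simp
qed

lemma spec_fun_deriv:
  assumes l: "l > 0"
  shows "(spec_fun u v A has_real_derivative density l / pi) (at l)"
proof -
  define a b where "a = l / 2" and "b = l + 1"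
  have ab: "0 < a" "a < l" "l < b" using l by (simp_all add: a_def b_def)
  have "((\<lambda>x. integral {a..x} density) has_real_derivative density l) (at l within {a..b})"
    by (rule integral_has_real_derivative[OF density_continuous]) (use ab in auto)
  then have "((\<lambda>x. integral {a..x} density) has_real_derivative density l) (at l)"
    using at_within_interior[of l "{a..b}"] ab by simp
  then have "((\<lambda>x. spec_fun u v A a + 1 / pi * integral {a..x} density) has_real_derivative density l / pi) (at l)"
    by (auto intro!: derivative_eq_intros)
  then show ?thesis
  proof (rule has_field_derivative_transform_within_open)
    show "spec_fun u v A a + 1 / pi * integral {a..x} density = spec_fun u v A x" if "x \<in> {a<..<b}" for x
      using spec_fun_increment[OF ab(1), of x] that by simp
  qed (use ab in auto)
qed

lemma spec_fun_loc_abs_cont: "loc_abs_cont_on {0<..} (spec_fun u v A)"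
  unfolding loc_abs_cont_on_def
proof (intro allI impI)
  fix a b :: real assume ab: "a \<le> b" "{a..b} \<subseteq> {0<..}"
  then have a: "0 < a" by auto
  have cont: "continuous_on {a..b} density" by (rule density_continuous[OF a])
  then have "bounded (density ` {a..b})" by (intro compact_imp_bounded compact_continuous_image) auto
  then obtain K where "\<forall>y\<in>density ` {a..b}. norm y \<le> K" unfolding bounded_iff by blast
  then have K: "\<And>x. x \<in> {a..b} \<Longrightarrow> \<bar>density x\<bar> \<le> K" by simp
  show "abs_cont_on {a..b} (spec_fun u v A)"
  proof (rule lipschitz_imp_abs_cont_on)
    fix x y assume x: "x \<in> {a..b}" and y: "y \<in> {a..b}" and xy: "x \<le> y"
    have sub: "{x..y} \<subseteq> {a..b}" using x y by auto
    have "norm (integral {x..y} density) \<le> K * (y - x)"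
      by (rule integral_bound[OF xy continuous_on_subset[OF cont sub]]) (use K sub in auto)
    then have "1 / pi * \<bar>integral {x..y} density\<bar> \<le> 1 / pi * (K * (y - x))"
      by (intro mult_left_mono) (auto simp del: real_norm_def simp: real_norm_def[symmetric])
    moreover have "spec_fun u v A y - spec_fun u v A x = 1 / pi * integral {x..y} density"
      by (rule spec_fun_increment) (use x a xy in auto)
    ultimately show "\<bar>spec_fun u v A y - spec_fun u v A x\<bar> \<le> K / pi * (y - x)"
      by (simp only: abs_mult) simp
  qed
qed

end

text \<open>Convergence for all positive x makes the radius of convergence infinite, so q is
  differentiable on the positive half-line. This makes \<open>deriv q\<close> in the integrability
  hypothesis a genuine derivative and supplies continuity of q.\<close>

lemma power_series_potential_differentiable:
  fixes c :: "nat \<Rightarrow> real"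
  assumes summ: "\<forall>x>0. summable (\<lambda>n. c (n + 2) * x ^ n)"
    and q: "\<forall>x>0. q x = c 0 / x\<^sup>2 + c 1 / x + (\<Sum>n. c (n + 2) * x ^ n)" and x: "x > 0"
  shows "(q has_real_derivative deriv q x) (at x)"
proof -
  have "summable (\<lambda>n. c (n + 2) * y ^ n)" for y
    by (rule powser_inside[of _ "\<bar>y\<bar> + 1"]) (use summ in auto)
  from termdiffs_strong_converges_everywhere[OF this, of x]
  obtain D where "((\<lambda>x. \<Sum>n. c (n + 2) * x ^ n) has_real_derivative D) (at x)" by blast
  then have "((\<lambda>x. c 0 / x\<^sup>2 + c 1 / x + (\<Sum>n. c (n + 2) * x ^ n)) has_real_derivative
      (0 * x\<^sup>2 - c 0 * (2 * x)) / (x\<^sup>2 * x\<^sup>2) + (0 * x - c 1 * 1) / (x * x) + D) (at x)"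
    using x by (intro DERIV_add DERIV_divide) (auto intro!: derivative_eq_intros)
  then have "(q has_real_derivative
      (0 * x\<^sup>2 - c 0 * (2 * x)) / (x\<^sup>2 * x\<^sup>2) + (0 * x - c 1 * 1) / (x * x) + D) (at x)"
    by (rule has_field_derivative_transform_within_open[where S="{0<..}"]) (use x q in auto)
  then show ?thesis by (metis DERIV_imp_deriv)
qed

theorem theorem1:
  fixes A :: real and qc :: "nat \<Rightarrow> real" and q :: "real \<Rightarrow> real"
    and u u' v v' :: "real \<Rightarrow> complex \<Rightarrow> complex"
    and P1 Q1 R1 :: "real \<Rightarrow> real \<Rightarrow> real"
    and ta tb tc :: "real \<Rightarrow> real"
  assumes A_pos: "A > 0"
    and q_summable: "\<forall>x>0. summable (\<lambda>n. qc (n + 2) * x ^ n)"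
    and q_def: "\<forall>x>0. q x = qc 0 / x\<^sup>2 + qc 1 / x + (\<Sum>n. qc (n + 2) * x ^ n)"
    and q0: "qc 0 \<ge> - 1 / 4"
    and q01: "qc 0 \<noteq> 0 \<or> qc 1 \<noteq> 0"
    and q_infty: "\<exists>x0>0. q absolutely_integrable_on {x0..}
                     \<or> ((deriv q) absolutely_integrable_on {x0..}
                        \<and> loc_abs_cont_on {x0..} q \<and> (q \<longlongrightarrow> 0) at_top)"
    and u_ode: "\<forall>l x. x \<ge> A \<longrightarrow>
                   ((\<lambda>t. u t l) has_vector_derivative u' x l) (at x within {A..}) \<and>
                   ((\<lambda>t. u' t l) has_vector_derivative ((complex_of_real (q x) - l) * u x l))
                      (at x within {A..})"
    and u_init: "\<forall>l. u A l = 1 \<and> u' A l = 0"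
    and v_ode: "\<forall>l x. x \<ge> A \<longrightarrow>
                   ((\<lambda>t. v t l) has_vector_derivative v' x l) (at x within {A..}) \<and>
                   ((\<lambda>t. v' t l) has_vector_derivative ((complex_of_real (q x) - l) * v x l))
                      (at x within {A..})"
    and v_init: "\<forall>l. v A l = 0 \<and> v' A l = 1"
    and U1_ode: "\<forall>l>0. \<forall>x\<ge>A.
                   ((\<lambda>t. P1 t l) has_real_derivative ((l - q x) * Q1 x l)) (at x within {A..}) \<and>
                   ((\<lambda>t. Q1 t l) has_real_derivative (- 2 * P1 x l + 2 * (l - q x) * R1 x l))
                      (at x within {A..}) \<and>
                   ((\<lambda>t. R1 t l) has_real_derivative (- Q1 x l)) (at x within {A..})"
    and U1_lim: "\<forall>l>0. ((\<lambda>x. P1 x l) \<longlongrightarrow> sqrt l) at_top \<and>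
                        ((\<lambda>x. Q1 x l) \<longlongrightarrow> 0) at_top \<and>
                        ((\<lambda>x. R1 x l) \<longlongrightarrow> 1 / sqrt l) at_top"
    and U1_repr: "\<forall>l>0. \<forall>x\<ge>A.
        complex_of_real (P1 x l) =
           of_real (ta l) * (u' x l)\<^sup>2 + of_real (tb l) * (u' x l * v' x l)
           + of_real (tc l) * (v' x l)\<^sup>2 \<and>
        complex_of_real (Q1 x l) =
           of_real (ta l) * (- 2 * u x l * u' x l)
           + of_real (tb l) * (- (u x l * v' x l + u' x l * v x l))
           + of_real (tc l) * (- 2 * v x l * v' x l) \<and>
        complex_of_real (R1 x l) =
           of_real (ta l) * (u x l)\<^sup>2 + of_real (tb l) * (u x l * v x l)
           + of_real (tc l) * (v x l)\<^sup>2"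
  shows "loc_abs_cont_on {0<..} (spec_fun u v A)
    \<and> (\<forall>l>0. (spec_integral u v A l \<longlongrightarrow> spec_fun u v A l) (at_right 0))
    \<and> (\<forall>l>0.
         (spec_fun u v A has_real_derivative 1 / (pi * ta l)) (at l)
       \<and> ((\<lambda>\<epsilon>. Im (TW_m u v A (complex_of_real l + \<i> * complex_of_real \<epsilon>)) / pi)
             \<longlongrightarrow> 1 / (pi * ta l)) (at_right 0)
       \<and> (\<forall>x\<ge>A. complex_of_real (1 / (pi * ta l)) =
             1 / (complex_of_real pi * (of_real (P1 x l) * (v x l)\<^sup>2
                + of_real (Q1 x l) * (v x l * v' x l) + of_real (R1 x l) * (v' x l)\<^sup>2))))"
proof -
  from q_infty obtain x0 where x0: "x0 > 0"
    and q_x0: "q absolutely_integrable_on {x0..} \<or>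
       (deriv q absolutely_integrable_on {x0..} \<and> loc_abs_cont_on {x0..} q \<and> (q \<longlongrightarrow> 0) at_top)" by blast
  have q_deriv: "(q has_real_derivative deriv q x) (at x within S)" if "x > 0" for x S
    by (rule has_field_derivative_at_within[OF power_series_potential_differentiable[OF q_summable q_def that]])
  have "\<forall>x\<ge>x0. (q has_real_derivative deriv q x) (at x within {x0..})"
    using q_deriv x0 by simp
  with q_x0 have q_cond: "q absolutely_integrable_on {x0..} \<or>
      (deriv q absolutely_integrable_on {x0..} \<and>
       (\<forall>x\<ge>x0. (q has_real_derivative deriv q x) (at x within {x0..})) \<and> (q \<longlongrightarrow> 0) at_top)"
    by blast
  have q_cont: "continuous_on {A..} q"
    by (rule DERIV_continuous_on[where D="deriv q"]) (use A_pos q_deriv in auto)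
  have appell_all: "appell_solution A q l (\<lambda>x. P1 x l) (\<lambda>x. Q1 x l) (\<lambda>x. R1 x l)" if "l > 0" for l
    unfolding appell_solution_def using U1_ode U1_lim that by blast
  \<comment> \<open>The one-point interval fixes l = 1 as the reference parameter for the limit
    point estimates at all complex z.\<close>
  obtain B where B0: "\<forall>l\<in>{1..1}. \<forall>P Q R x. appell_solution A q l P Q R \<longrightarrow> x \<ge> A \<longrightarrow> P x \<le> B \<and> R x \<le> B"
    using appell_uniformly_bounded[OF q_cond q_cont zero_less_one] by blast
  have B: "P1 x 1 \<le> B \<and> R1 x 1 \<le> B" if "x \<ge> A" for x
    using B0[rule_format, OF _ appell_all[OF zero_less_one] that] by simp
  have sols: "schroedinger_solution A q z (\<lambda>x. u x z) (\<lambda>x. u' x z)"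
    "schroedinger_solution A q z (\<lambda>x. v x z) (\<lambda>x. v' x z)" for z
    unfolding schroedinger_solution_def using u_ode v_ode by blast+
  interpret spectral_problem A q u u' v v' 1 "\<lambda>x. P1 x 1" "\<lambda>x. Q1 x 1" "\<lambda>x. R1 x 1" B "deriv q" x0 P1 Q1 R1
    by unfold_locales (use appell_all B sols q_cond q_cont u_init v_init in auto)
  \<comment> \<open>At x = A the values u = 1 and v = 0 reduce the third component of the
    representation to its first coefficient.\<close>
  have ta: "ta l = R1 A l" if "l > 0" for l
  proof -
    have "complex_of_real (R1 A l) = of_real (ta l)"
      using U1_repr u_init v_init that by simp
    then show ?thesis by simp
  qed
  have density: "density l = 1 / ta l" if "l > 0" for l
    by (simp add: density_def ta[OF that])
  have form: "of_real (P1 x l) * (v x l)\<^sup>2 + of_real (Q1 x l) * (v x l * v' x l) + of_real (R1 x l) * (v' x l)\<^sup>2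
      = complex_of_real (ta l)" if "l > 0" "x \<ge> A" for l x
    using appell_quadratic_form_constant[OF appell_all[OF that(1)] sols(2) that(2)] v_init
    by (simp add: ta[OF that(1)])
  show ?thesis
  proof (intro conjI allI impI)
    show "loc_abs_cont_on {0<..} (spec_fun u v A)" by (rule spec_fun_loc_abs_cont)
    fix l :: real assume l: "l > 0"
    show "(spec_integral u v A l \<longlongrightarrow> spec_fun u v A l) (at_right 0)"
      by (rule spec_integral_tendsto) (use l in simp)
    show "(spec_fun u v A has_real_derivative 1 / (pi * ta l)) (at l)"
      using spec_fun_deriv[OF l] by (simp add: density[OF l] mult.commute)
    show "((\<lambda>\<epsilon>. Im (TW_m u v A (complex_of_real l + \<i> * complex_of_real \<epsilon>)) / pi) \<longlongrightarrow> 1 / (pi * ta l)) (at_right 0)"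
      using tendsto_divide[OF Im_m_fun_tendsto[OF l] tendsto_const[of pi]]
      by (simp add: density[OF l] m_fun_def mult.commute)
    fix x assume x: "x \<ge> A"
    show "complex_of_real (1 / (pi * ta l)) =
             1 / (complex_of_real pi * (of_real (P1 x l) * (v x l)\<^sup>2
                + of_real (Q1 x l) * (v x l * v' x l) + of_real (R1 x l) * (v' x l)\<^sup>2))"
      by (simp add: form[OF l x])
  qed
qed

end
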